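(* Let $\Theta=(\theta_i)_{i\ge 0}$ be a sequence in $[0,\infty)$ with $\sum_{i\ge 0}\theta_i^2=1$ and $\theta_1\ge\theta_2\ge\cdots$, let $(\mathcal T,d_{\mathcal T})$ be the $\Theta$-ICRT, and let $\mathfrak G:\mathbb R^+\to\mathbb R$ be the Gaussian free field on it (defined on the dense subset $\mathbb R^+$ of $\mathcal T$). If $$\int^\infty\frac{dl}{l\sqrt{\mathbb E[\mu[0,l]]}}<\infty ,$$ then almost surely $\mathfrak G$ extends to a continuous function on $(\mathcal T,d_{\mathcal T})$.
   Context: Notation: $\mathbb N=\{1,2,\dots\}$, $\mathbb R^+=[0,\infty)$; $\int^\infty$ means integrability at $+\infty$. ICRT. Let $(X_i)_{i\in\mathbb N}$ be independent exponential random variables of parameters $(\theta_i)_{i\in\mathbb N}$ ($X_i=+\infty$ if $\theta_i=0$). Let $\mu=\theta_0^2\,dx+\sum_{i\ge1}\theta_i\delta_{X_i}$ on $\mathbb R^+$; $\mu_l$ is the restriction of $\mu$ to $[0,l]$ and $\mathfrak p_l=\mu_l/\mu[0,l]$. Given $\mu$, let $Y_1<Y_2<\cdots$ be the points of a Poisson point process on $\mathbb R^+$ of rate $\mu[0,l]\,dl$; given $(\mu,(Y_i))$, let $(Z_i)_{i\in\mathbb N}$ be independent with laws $(\mathfrak p_{Y_i})_{i\in\mathbb N}$. Put $Y_0=Z_0=0$. Define $d_{\mathcal T}$ on $\mathbb R^+$ inductively: for $i\ge0$ and $x\le y\le Y_{i+1}$, if $x\le Y_i<y$ then $d_{\mathcal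 T}(x,y)=d_{\mathcal T}(x,Z_i)+(y-Y_i)$, and if $x,y\in(Y_i,Y_{i+1}]$ then $d_{\mathcal T}(x,y)=y-x$. The $\Theta$-ICRT $(\mathcal T,d_{\mathcal T})$ is the completion of $(\mathbb R^+,d_{\mathcal T})$. Gaussian free field on the ICRT. Let $\mathfrak B:\mathbb R^+\to\mathbb R$ be a standard Brownian motion started at $0$, independent of $(\mu,(X_i),(Y_i),(Z_i))$. Define $\mathfrak G$ inductively on $\mathbb R^+$ by $\mathfrak G(0)=0$ and, for every $i\ge0$ and $Y_i<x\le Y_{i+1}$, $\mathfrak G(x)=\mathfrak G(Z_i)+\mathfrak B(x)-\mathfrak B(Y_i)$. *)

theory Defs
  imports "HOL-Probability.Probability"
begin

text \<open>
  The completion is realised as the closure of the image of the Kuratowski embedding in the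
  complete space of bounded functions; lemma \<open>metric_completion_is_completion\<close> shows that it is
  a complete space containing an isometric dense copy of the original one.
\<close>

definition completion_map :: "'a metric \<Rightarrow> 'a \<Rightarrow> 'a \<Rightarrow> real" where
  "completion_map m x =
     (\<lambda>u\<in>mspace m. mdist m x u - mdist m (SOME a. a \<in> mspace m) u)"

definition metric_completion :: "'a metric \<Rightarrow> ('a \<Rightarrow> real) metric" where
  "metric_completion m =
     submetric (funspace (mspace m) euclidean_metric)
       (mtopology_of (funspace (mspace m) euclidean_metric)
          closure_of (completion_map m ` mspace m))"

lemma metric_completion_is_completion:
  assumes ne: "mspace m \<noteq> {}"
  shows "mcomplete_of (metric_completion m)"
    and "completion_map m \<in> mspace m \<rightarrow> mspace (metric_completion m)"
    and "mtopology_of (metric_completion m) closure_of (completion_map m ` mspace m)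
           = mspace (metric_completion m)"
    and "\<And>x y. \<lbrakk>x \<in> mspace m; y \<in> mspace m\<rbrakk> \<Longrightarrow>
           mdist (metric_completion m) (completion_map m x) (completion_map m y) = mdist m x y"
proof -
  define M where "M = mspace m"
  define d where "d = mdist m"
  interpret Metric_space M d by (simp add: M_def d_def)
  define a where "a = (SOME a. a \<in> M)"
  have aM: "a \<in> M" using ne some_in_eq unfolding a_def M_def by blast
  define f where "f = completion_map m"
  have f: "f = (\<lambda>x. (\<lambda>u\<in>M. d x u - d a u))"
    by (simp add: f_def completion_map_def M_def d_def a_def fun_eq_iff)
  define m' :: "('a \<Rightarrow> real) metric" where "m' = funspace M euclidean_metric"
  define S where "S = mtopology_of m' closure_of (f ` M)"
  have mc: "metric_completion m = submetric m' S"
    by (simp add: metric_completion_def m'_def S_def M_def f_def)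
  interpret S: Submetric "Met_TC.fspace M" "Met_TC.fdist M" "S \<inter> Met_TC.fspace M"
    by (simp add: Met_TC.Metric_space_funspace Submetric.intro Submetric_axioms_def)
  have fim: "f ` M \<subseteq> mspace m'"
  proof (clarsimp simp: m'_def Met_TC.fspace_def)
    fix b assume b: "b \<in> M"
    then have "\<And>c. c \<in> M \<Longrightarrow> \<bar>d b c - d a c\<bar> \<le> d a b"
      by (smt (verit, best) aM commute triangle'')
    then have "(\<lambda>x. d b x - d a x) ` M \<subseteq> cball 0 (d a b)"
      by force
    then show "f b \<in> extensional M \<and> bounded (f b ` M)"
      by (metis bounded_cball bounded_subset f image_restrict_eq restrict_extensional_sub set_eq_subset)
  qed
  have Ssub: "S \<subseteq> mspace m'"
    by (simp add: S_def in_closure_of subset_iff)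
  have "closedin S.mtopology (S \<inter> Met_TC.fspace M)"
    by (simp add: S_def m'_def closedin_Int funspace_def)
  moreover have "S.mcomplete"
    using Metric_space.mcomplete_funspace Met_TC.Metric_space_axioms by (fastforce simp: mcomplete_of_def)
  ultimately have mcom: "mcomplete_of (submetric m' S)"
    by (simp add: S.closedin_eq_mcomplete mcomplete_of_def m'_def)
  have fS: "f \<in> M \<rightarrow> S"
    using S_def fim in_closure_of m'_def by fastforce
  have eqd: "mdist m' (f x) (f y) = d x y" if "x \<in> M" "y \<in> M" for x y
  proof -
    have "\<forall>c\<in>M. dist (f x c) (f y c) \<le> r \<Longrightarrow> d x y \<le> r" for r
      using that by (auto simp: f dist_real_def)
    moreover have "dist (f x z) (f y z) \<le> r" if "d x y \<le> r" and "z \<in> M" for r z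
      using that \<open>x \<in> M\<close> \<open>y \<in> M\<close>
      apply (simp add: f Met_TC.fdist_def dist_real_def)
      by (smt (verit, best) commute triangle')
    ultimately have "(SUP c \<in> M. dist (f x c) (f y c)) = d x y"
      by (intro cSup_unique) auto
    with that fim show ?thesis
      using that fim aM by (auto simp: Met_TC.fdist_def m'_def image_subset_iff)
  qed
  show "mcomplete_of (metric_completion m)"
    using mcom mc by simp
  show "completion_map m \<in> mspace m \<rightarrow> mspace (metric_completion m)"
    using Ssub fS by (auto simp: mc f_def[symmetric] M_def[symmetric])
  show "mtopology_of (metric_completion m) closure_of (completion_map m ` mspace m)
           = mspace (metric_completion m)"
    using fS Ssub S_def
    by (force simp: mc f_def[symmetric] M_def[symmetric] mtopology_of_submetric
        closure_of_subtopology Int_absorb1 image_subset_iff_funcset)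
  show "mdist (metric_completion m) (completion_map m x) (completion_map m y) = mdist m x y"
    if "x \<in> mspace m" "y \<in> mspace m" for x y
    using that eqd by (simp add: mc f_def[symmetric] M_def[symmetric] d_def[symmetric])
qed

text \<open>
  \<open>y\<close> is the sequence of cut points and \<open>z\<close> that of glue points, with \<open>y 0 = z 0 = 0\<close>.
  \<open>stick_dist y z n\<close> is the distance on \<open>[0, y n]\<close>. The values outside of \<open>[0, y n]\<close> are
  irrelevant, and so are the values of \<open>icrt_dist\<close> and \<open>icrt_field\<close> beyond \<open>sup y\<close>; the lemmas
  below give the defining recursions when \<open>y\<close> increases to infinity and \<open>0 \<le> z i \<le> y i\<close>.
\<close>

fun stick_dist :: "(nat \<Rightarrow> real) \<Rightarrow> (nat \<Rightarrow> real) \<Rightarrow> nat \<Rightarrow> real \<Rightarrow> real \<Rightarrow> real" where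
  "stick_dist y z 0 u v = 0"
| "stick_dist y z (Suc n) u v =
     (if u \<le> y n \<and> v \<le> y n then stick_dist y z n u v
      else if u \<le> y n then stick_dist y z n u (z n) + (v - y n)
      else if v \<le> y n then stick_dist y z n v (z n) + (u - y n)
      else \<bar>u - v\<bar>)"

definition icrt_dist :: "(nat \<Rightarrow> real) \<Rightarrow> (nat \<Rightarrow> real) \<Rightarrow> real \<Rightarrow> real \<Rightarrow> real" where
  "icrt_dist y z u v = stick_dist y z (LEAST n. u \<le> y n \<and> v \<le> y n) u v"

fun stick_field ::
  "(nat \<Rightarrow> real) \<Rightarrow> (nat \<Rightarrow> real) \<Rightarrow> (real \<Rightarrow> real) \<Rightarrow> nat \<Rightarrow> real \<Rightarrow> real" where
  "stick_field y z b 0 u = 0"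
| "stick_field y z b (Suc n) u =
     (if u \<le> y n then stick_field y z b n u
      else stick_field y z b n (z n) + b u - b (y n))"

definition icrt_field ::
  "(nat \<Rightarrow> real) \<Rightarrow> (nat \<Rightarrow> real) \<Rightarrow> (real \<Rightarrow> real) \<Rightarrow> real \<Rightarrow> real" where
  "icrt_field y z b u = stick_field y z b (LEAST n. u \<le> y n) u"

definition line_metric :: "(nat \<Rightarrow> real) \<Rightarrow> (nat \<Rightarrow> real) \<Rightarrow> real metric" where
  "line_metric y z = metric ({0..}, icrt_dist y z)"

definition icrt :: "(nat \<Rightarrow> real) \<Rightarrow> (nat \<Rightarrow> real) \<Rightarrow> (real \<Rightarrow> real) metric" where
  "icrt y z = metric_completion (line_metric y z)"

abbreviation icrt_embed :: "(nat \<Rightarrow> real) \<Rightarrow> (nat \<Rightarrow> real) \<Rightarrow> real \<Rightarrow> real \<Rightarrow> real" where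
  "icrt_embed y z \<equiv> completion_map (line_metric y z)"

context
  fixes y z :: "nat \<Rightarrow> real"
  assumes y_mono: "strict_mono y" and y_unbounded: "\<And>u. \<exists>n. u \<le> y n"
    and y0: "y 0 = 0" and z0: "z 0 = 0" and z_le: "\<And>i. 0 \<le> z i \<and> z i \<le> y i"
begin

lemma y_le: "m \<le> n \<Longrightarrow> y m \<le> y n"
  using y_mono by (simp add: strict_mono_less_eq)

lemma stick_dist_stable:
  assumes "u \<le> y n" "v \<le> y n" shows "stick_dist y z (n + k) u v = stick_dist y z n u v"
proof (induction k)
  case (Suc k)
  have "y n \<le> y (n + k)" by (simp add: y_le)
  with assms have "u \<le> y (n + k)" "v \<le> y (n + k)" by linarith+
  with Suc show ?case by simp
qed simp

lemma stick_field_stable: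
  assumes "u \<le> y n" shows "stick_field y z b (n + k) u = stick_field y z b n u"
proof (induction k)
  case (Suc k)
  have "y n \<le> y (n + k)" by (simp add: y_le)
  with assms have "u \<le> y (n + k)" by linarith
  with Suc show ?case by simp
qed simp

lemma icrt_dist_eq_stick_dist:
  assumes "u \<le> y n" "v \<le> y n" shows "icrt_dist y z u v = stick_dist y z n u v"
proof -
  define l where "l = (LEAST n. u \<le> y n \<and> v \<le> y n)"
  have "u \<le> y l \<and> v \<le> y l" unfolding l_def by (rule LeastI[of _ n]) (use assms in simp)
  moreover have "l \<le> n" unfolding l_def by (rule Least_le) (use assms in simp)
  ultimately have "stick_dist y z n u v = stick_dist y z l u v"
    using stick_dist_stable[of u l v "n - l"] by simp
  then show ?thesis by (simp add: icrt_dist_def l_def)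
qed

lemma icrt_field_eq_stick_field:
  assumes "u \<le> y n" shows "icrt_field y z b u = stick_field y z b n u"
proof -
  define l where "l = (LEAST n. u \<le> y n)"
  have "u \<le> y l" unfolding l_def by (rule LeastI[of _ n]) (use assms in simp)
  moreover have "l \<le> n" unfolding l_def by (rule Least_le) (use assms in simp)
  ultimately have "stick_field y z b n u = stick_field y z b l u"
    using stick_field_stable[of u l b "n - l"] by simp
  then show ?thesis by (simp add: icrt_field_def l_def)
qed

lemma icrt_dist_glue:
  assumes "u \<le> y i" "y i < v" "v \<le> y (Suc i)"
  shows "icrt_dist y z u v = icrt_dist y z u (z i) + (v - y i)"
proof -
  have "u \<le> y (Suc i)" using assms by linarith
  then show ?thesis
    using assms z_le[of i] icrt_dist_eq_stick_dist[of u "Suc i" v] icrt_dist_eq_stick_dist[of u i "z i"]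
    by simp
qed

lemma icrt_dist_stick:
  assumes "y i < u" "u \<le> v" "v \<le> y (Suc i)"
  shows "icrt_dist y z u v = v - u"
  using assms icrt_dist_eq_stick_dist[of u "Suc i" v] by simp

lemma icrt_field_0: "icrt_field y z b 0 = 0"
  using icrt_field_eq_stick_field[of 0 0 b] by (simp add: y0)

lemma icrt_field_stick:
  assumes "y i < u" "u \<le> y (Suc i)"
  shows "icrt_field y z b u = icrt_field y z b (z i) + b u - b (y i)"
  using assms z_le[of i] icrt_field_eq_stick_field[of u "Suc i" b]
    icrt_field_eq_stick_field[of "z i" i b] by simp

lemma stick_dist_sym: "stick_dist y z n u v = stick_dist y z n v u"
  by (induction n arbitrary: u v) auto

lemma stick_dist_nonneg:
  "0 \<le> stick_dist y z n u v"
  by (induction n arbitrary: u v) (auto simp: add_nonneg_nonneg)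

lemma stick_dist_eq_0:
  assumes "0 \<le> u" "u \<le> y n" "0 \<le> v" "v \<le> y n"
  shows "stick_dist y z n u v = 0 \<longleftrightarrow> u = v"
  using assms
proof (induction n arbitrary: u v)
  case 0 then show ?case using y0 by simp
next
  case (Suc n)
  show ?case
    using Suc stick_dist_nonneg[of n u "z n"] stick_dist_nonneg[of n v "z n"] by auto
qed

lemma stick_dist_triangle:
  assumes "0 \<le> u" "u \<le> y n" "0 \<le> v" "v \<le> y n" "0 \<le> w" "w \<le> y n"
  shows "stick_dist y z n u w \<le> stick_dist y z n u v + stick_dist y z n v w"
  using assms
proof (induction n arbitrary: u v w)
  case 0 then show ?case by simp
next
  case (Suc n)
  note z = z_le[of n]
  note nn = stick_dist_nonneg[of n]
  show ?case
    using Suc.prems z nn[of u "z n"] nn[of v "z n"] nn[of w "z n"]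
      Suc.IH[of u v w] Suc.IH[of u "z n" w] Suc.IH[of u v "z n"] Suc.IH[of w v "z n"]
      stick_dist_sym[of n w "z n"] stick_dist_sym[of n w v]
    by (auto split: if_splits)
qed

lemma Metric_space_icrt_dist: "Metric_space {0..} (icrt_dist y z)"
proof
  fix u v w :: real
  obtain a where a: "u \<le> y a" using y_unbounded by blast
  obtain b where b: "v \<le> y b" using y_unbounded by blast
  obtain c where c: "w \<le> y c" using y_unbounded by blast
  define n where "n = max a (max b c)"
  have "y a \<le> y n" "y b \<le> y n" "y c \<le> y n" by (simp_all add: y_le n_def)
  then have le: "u \<le> y n" "v \<le> y n" "w \<le> y n" using a b c by linarith+
  show "0 \<le> icrt_dist y z u v" by (simp add: icrt_dist_def stick_dist_nonneg)
  show "icrt_dist y z u v = icrt_dist y z v u"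
    using le stick_dist_sym by (simp add: icrt_dist_eq_stick_dist)
  assume "u \<in> {0..}" "v \<in> {0..}"
  then show "icrt_dist y z u v = 0 \<longleftrightarrow> u = v"
    using le stick_dist_eq_0 by (simp add: icrt_dist_eq_stick_dist)
  assume "w \<in> {0..}"
  with \<open>u \<in> {0..}\<close> \<open>v \<in> {0..}\<close>
  show "icrt_dist y z u w \<le> icrt_dist y z u v + icrt_dist y z v w"
    using le stick_dist_triangle[of u n v w] by (simp add: icrt_dist_eq_stick_dist)
qed

lemma line_metric_simps: 
  "mspace (line_metric y z) = {0..}" "mdist (line_metric y z) = icrt_dist y z"
  by (simp_all add: line_metric_def Metric_space.mspace_metric Metric_space.mdist_metric
      Metric_space_icrt_dist)

end

definition ext_exponential :: "real \<Rightarrow> ereal measure" where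
  "ext_exponential \<theta> =
     (if \<theta> = 0 then return borel \<infinity>
      else distr (density lborel (exponential_density \<theta>)) borel ereal)"

text \<open>
  \<open>icrt_mu \<theta> x\<close> is \<open>\<theta>\<^sub>0\<^sup>2 dx + \<Sum>i\<ge>1. \<theta>\<^sub>i \<delta>\<^bsub>x\<^sub>i\<^esub>\<close>, as a measure on the real line; the atoms
  \<open>x\<^sub>i = \<infinity>\<close> do not contribute.
\<close>

definition icrt_mu :: "(nat \<Rightarrow> real) \<Rightarrow> (nat \<Rightarrow> ereal) \<Rightarrow> real measure" where
  "icrt_mu \<theta> x = measure_of UNIV (sets borel)
     (\<lambda>A. ennreal ((\<theta> 0)\<^sup>2) * emeasure lborel (A \<inter> {0..})
        + (\<Sum>i. ennreal (\<theta> (Suc i)) * indicator (ereal ` A) (x (Suc i))))"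

lemma sets_icrt_mu [simp, measurable_cong]: "sets (icrt_mu \<theta> x) = sets borel"
  using sets.sigma_sets_eq[of "borel :: real measure"] by (simp add: icrt_mu_def)

lemma emeasure_icrt_mu:
  assumes "A \<in> sets borel"
  shows "emeasure (icrt_mu \<theta> x) A = ennreal ((\<theta> 0)\<^sup>2) * emeasure lborel (A \<inter> {0..})
        + (\<Sum>i. ennreal (\<theta> (Suc i)) * indicator (ereal ` A) (x (Suc i)))"
    (is "_ = ?m A")
proof -
  have ca: "countably_additive (sets borel) ?m"
  proof (rule countably_additiveI)
    fix F :: "nat \<Rightarrow> real set"
    assume F: "range F \<subseteq> sets borel" "disjoint_family F" "\<Union> (range F) \<in> sets borel"
    have 1: "(\<Sum>n. emeasure lborel (F n \<inter> {0..})) = emeasure lborel ((\<Union>n. F n) \<inter> {0..})"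
    proof -
      have "range (\<lambda>n. F n \<inter> {0..}) \<subseteq> sets lborel" using F(1) by auto
      moreover have "disjoint_family (\<lambda>n. F n \<inter> {0..})"
        using F(2) by (auto simp: disjoint_family_on_def)
      ultimately have "(\<Sum>n. emeasure lborel (F n \<inter> {0..})) = emeasure lborel (\<Union>n. F n \<inter> {0..})"
        by (rule suminf_emeasure)
      then show ?thesis by simp
    qed
    have 2: "(\<Sum>n. indicator (ereal ` F n) w :: ennreal) = indicator (ereal ` (\<Union>n. F n)) w" for w
    proof -
      have "disjoint_family (\<lambda>n. ereal ` F n)" using F(2) by (auto simp: disjoint_family_on_def)
      then show ?thesis
        using suminf_indicator[of "\<lambda>n. ereal ` F n" w] by (simp add: image_UN)
    qed
    have "(\<Sum>n. \<Sum>i. ennreal (\<theta> (Suc i)) * indicator (ereal ` F n) (x (Suc i)))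
        = (\<Sum>i. \<Sum>n. ennreal (\<theta> (Suc i)) * indicator (ereal ` F n) (x (Suc i)))"
      using nn_integral_suminf[of "\<lambda>i n. ennreal (\<theta> (Suc n)) * indicator (ereal ` F i) (x (Suc n))"
          "count_space UNIV"]
      by (simp add: nn_integral_count_space_nat)
    also have "\<dots> = (\<Sum>i. ennreal (\<theta> (Suc i)) * indicator (ereal ` (\<Union>n. F n)) (x (Suc i)))"
      by (simp add: 2)
    finally show "(\<Sum>n. ?m (F n)) = ?m (\<Union> (range F))"
      using 1 by (simp add: suminf_add[symmetric])
  qed
  show ?thesis
    using assms ca sets.sigma_sets_eq[of "borel :: real measure"]
    by (intro emeasure_measure_of[OF icrt_mu_def]) (auto simp: positive_def)
qed

definition cond_prob :: "'w measure \<Rightarrow> 'w measure \<Rightarrow> 'w set \<Rightarrow> 'w \<Rightarrow> real" where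
  "cond_prob M F E = real_cond_exp M F (indicator E)"

text \<open>The sigma-algebra generated by the masses that a random measure gives to the Borel sets.\<close>

definition measure_algebra :: "'w measure \<Rightarrow> ('w \<Rightarrow> real measure) \<Rightarrow> 'w measure" where
  "measure_algebra M \<mu> =
     vimage_algebra (space M) (\<lambda>\<omega>. \<lambda>A\<in>sets borel. emeasure (\<mu> \<omega>) A)
       (\<Pi>\<^sub>M A\<in>sets borel. borel :: ennreal measure)"

definition measure_points_algebra ::
  "'w measure \<Rightarrow> ('w \<Rightarrow> real measure) \<Rightarrow> (nat \<Rightarrow> 'w \<Rightarrow> real) \<Rightarrow> 'w measure" where
  "measure_points_algebra M \<mu> Y =
     vimage_algebra (space M) (\<lambda>\<omega>. (\<lambda>A\<in>sets borel. emeasure (\<mu> \<omega>) A, \<lambda>i\<in>{1..}. Y i \<omega>))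
       ((\<Pi>\<^sub>M A\<in>sets borel. borel :: ennreal measure) \<Otimes>\<^sub>M (\<Pi>\<^sub>M i\<in>{1..}. borel))"

text \<open>
  Conditionally on \<open>F\<close>, \<open>0 < Y\<^sub>1 < Y\<^sub>2 < \<dots>\<close> are the points of a Poisson point process on
  \<open>[0,\<infinity>)\<close> of intensity \<open>r \<omega> l dl\<close>: the numbers of points in disjoint bounded Borel sets are
  independent Poisson variables. Finiteness is required explicitly because \<^const>\<open>card\<close>
  vanishes on infinite sets. The value \<open>Y 0 = 0\<close> is a convention, not a point.
\<close>

definition cond_poisson_points ::
  "'w measure \<Rightarrow> 'w measure \<Rightarrow> (nat \<Rightarrow> 'w \<Rightarrow> real) \<Rightarrow> ('w \<Rightarrow> real \<Rightarrow> real) \<Rightarrow> bool" where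
  "cond_poisson_points M F Y r \<longleftrightarrow>
     (AE \<omega> in M. Y 0 \<omega> = 0 \<and> strict_mono (\<lambda>i. Y i \<omega>)) \<and>
     (\<forall>(n::nat) A (k :: nat \<Rightarrow> nat).
        (\<forall>j<n. A j \<in> sets borel \<and> A j \<subseteq> {0..} \<and> bounded (A j)) \<and> disjoint_family_on A {..<n} \<longrightarrow>
        (AE \<omega> in M.
           cond_prob M F {\<omega>' \<in> space M. \<forall>j<n. finite {i. 1 \<le> i \<and> Y i \<omega>' \<in> A j}
                                          \<and> card {i. 1 \<le> i \<and> Y i \<omega>' \<in> A j} = k j} \<omega>
           = (\<Prod>j<n. (LINT l:A j|lborel. r \<omega> l) ^ k j / fact (k j)
                       * exp (- (LINT l:A j|lborel. r \<omega> l)))))"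

definition cond_indep_laws ::
  "'w measure \<Rightarrow> 'w measure \<Rightarrow> (nat \<Rightarrow> 'w \<Rightarrow> real) \<Rightarrow> (nat \<Rightarrow> 'w \<Rightarrow> real measure) \<Rightarrow> bool" where
  "cond_indep_laws M F Z p \<longleftrightarrow>
     (\<forall>(n::nat) C. (\<forall>i\<in>{1..n}. C i \<in> sets borel) \<longrightarrow>
        (AE \<omega> in M. cond_prob M F {\<omega>' \<in> space M. \<forall>i\<in>{1..n}. Z i \<omega>' \<in> C i} \<omega>
                    = (\<Prod>i\<in>{1..n}. measure (p i \<omega>) (C i))))"

text \<open>
  The index \<open>0\<close> of \<open>X\<close> is not used. As \<^const>\<open>uniform_measure\<close> restricts and normalises an
  arbitrary measure, \<open>uniform_measure \<mu> {0..l}\<close> is \<open>\<mu>\<^sub>l / \<mu>[0,l]\<close>.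
\<close>

definition icrt_data ::
  "'w measure \<Rightarrow> (nat \<Rightarrow> real) \<Rightarrow> (nat \<Rightarrow> 'w \<Rightarrow> ereal) \<Rightarrow> (nat \<Rightarrow> 'w \<Rightarrow> real)
     \<Rightarrow> (nat \<Rightarrow> 'w \<Rightarrow> real) \<Rightarrow> bool" where
  "icrt_data M \<theta> X Y Z \<longleftrightarrow>
     (let \<mu> = (\<lambda>\<omega>. icrt_mu \<theta> (\<lambda>i. X i \<omega>)) in
       prob_space.indep_vars M (\<lambda>_. borel) X {1..} \<and>
       (\<forall>i\<ge>1. distr M borel (X i) = ext_exponential (\<theta> i)) \<and>
       (\<forall>i. Y i \<in> borel_measurable M \<and> Z i \<in> borel_measurable M) \<and>
       (AE \<omega> in M. Z 0 \<omega> = 0) \<and>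
       cond_poisson_points M (measure_algebra M \<mu>) Y (\<lambda>\<omega> l. measure (\<mu> \<omega>) {0..l}) \<and>
       cond_indep_laws M (measure_points_algebra M \<mu> Y) Z
         (\<lambda>i \<omega>. uniform_measure (\<mu> \<omega>) {0..Y i \<omega>}))"

definition standard_brownian_motion :: "'w measure \<Rightarrow> (real \<Rightarrow> 'w \<Rightarrow> real) \<Rightarrow> bool" where
  "standard_brownian_motion M B \<longleftrightarrow>
     (\<forall>t\<ge>0. B t \<in> borel_measurable M) \<and>
     (AE \<omega> in M. B 0 \<omega> = 0) \<and>
     (AE \<omega> in M. continuous_on {0..} (\<lambda>t. B t \<omega>)) \<and>
     (\<forall>s t. 0 \<le> s \<and> s < t \<longrightarrow>
        distributed M lborel (\<lambda>\<omega>. B t \<omega> - B s \<omega>) (normal_density 0 (sqrt (t - s)))) \<and>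
     (\<forall>(n::nat) t. 0 \<le> t 0 \<and> (\<forall>i<n. t i < t (Suc i)) \<longrightarrow>
        prob_space.indep_vars M (\<lambda>_. borel) (\<lambda>i \<omega>. B (t (Suc i)) \<omega> - B (t i) \<omega>) {..<n})"

text \<open>
  Independence of \<open>B\<close> from the tree; \<open>\<mu>\<close> need not be listed, being a function of \<open>X\<close>.
\<close>

definition indep_of_data ::
  "'w measure \<Rightarrow> (real \<Rightarrow> 'w \<Rightarrow> real) \<Rightarrow> (nat \<Rightarrow> 'w \<Rightarrow> ereal) \<Rightarrow> (nat \<Rightarrow> 'w \<Rightarrow> real)
     \<Rightarrow> (nat \<Rightarrow> 'w \<Rightarrow> real) \<Rightarrow> bool" where
  "indep_of_data M B X Y Z \<longleftrightarrow>
     prob_space.indep_set M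
       (sets (vimage_algebra (space M) (\<lambda>\<omega>. \<lambda>t\<in>{0..}. B t \<omega>) (\<Pi>\<^sub>M t\<in>{0..}. borel)))
       (sets (vimage_algebra (space M)
          (\<lambda>\<omega>. (\<lambda>i\<in>{1..}. X i \<omega>, \<lambda>i\<in>{1..}. Y i \<omega>, \<lambda>i\<in>{1..}. Z i \<omega>))
          ((\<Pi>\<^sub>M i\<in>{1..}. borel) \<Otimes>\<^sub>M (\<Pi>\<^sub>M i\<in>{1..}. borel) \<Otimes>\<^sub>M (\<Pi>\<^sub>M i\<in>{1..}. borel))))"

end

theory Submission
  imports Defs "HOL-Real_Asymp.Real_Asymp"
begin

text \<open>
  Let \<open>m(l) = E \<mu>[0,l]\<close>, and consider the scales \<open>a = 2^(2^n)\<close>. By Hoeffding's inequality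
  \<open>\<mu>[0,a] \<ge> m(a)/2\<close> for all large \<open>n\<close>. Given the tree, the increment of the field along the path from a
  point \<open>x \<le> b = a\<^sup>2\<close> down to \<open>[0,a]\<close> is Gaussian, its variance being the length of the path. That length has
  exponential moments of order \<open>m(a)/8\<close>: given \<open>\<mu>\<close> and the cut points, the moments satisfy a linear recursion
  solved by a product over the sticks, and by a Stieltjes sum the logarithm of the product is controlled in
  expectation by \<open>ln b\<close>, using nothing on the cut points but void probabilities. There are at most
  polynomially many sticks in \<open>b\<close>, and the oscillation of the Brownian motion on a stick is handled by
  chaining, so the increments are all bounded by a variable whose expectation is of order
  \<open>ln b / sqrt (m a)\<close>. The integral condition says that these bounds are summable over \<open>n\<close>. As the projections to
  \<open>[0,a]\<close> are contractions and the field is continuous on \<open>[0,a]\<close>, the field is a uniform limit of uniformly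
  continuous functions, and extends to the completion.
\<close>

subsection \<open>Projections of the tree\<close>

text \<open>The obstacle is that the distance to \<open>[0, a]\<close> has no usable law: it depends
  on all gaps between cut points and on the masses in them. The product that bounds its exponential
  moments given \<open>mu\<close> and the cut points is itself random, and taking its expectation
  would require joint information on the gaps. Only its logarithm is estimated: it is at most
  \<open>cell_sum\<close>, which is linear in indicators of voids, and a weight
  \<open>exp (- cell_sum)\<close> inside the expectation leaves a quantity bounded by one. The
  constants match as follows. If \<open>m / 2 \<le> W \<omega> a\<close>, a void of length
  \<open>s\<close> beyond \<open>a\<close> has conditional probability at most
  \<open>exp (- m s / 2)\<close>, while the weight \<open>exp (2 \<kappa> s)\<close> with
  \<open>\<kappa> = m / 8\<close> is only \<open>exp (m s / 4)\<close>. A Gaussian of variance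
  \<open>s\<close> has exponential moment \<open>exp (c\<^sup>2 s / 2)\<close>, so
  \<open>c = sqrt m / 2\<close> is the matching parameter; dividing logarithms of order
  \<open>ln b\<close> by it gives \<open>ln b / sqrt m\<close>. Squaring the scale doubles
  \<open>ln l\<close>, so \<open>ln b\<close> is comparable with the integral of
  \<open>1 / l\<close> over one scale, and nothing is lost against the integral condition.\<close>

fun stick_proj :: "(nat \<Rightarrow> real) \<Rightarrow> (nat \<Rightarrow> real) \<Rightarrow> real \<Rightarrow> nat \<Rightarrow> real \<Rightarrow> real" where
  "stick_proj y z a 0 u = u"
| "stick_proj y z a (Suc n) u =
     (if u \<le> y n then stick_proj y z a n u
      else if u \<le> a then u else if y n < a then a else stick_proj y z a n (z n))"

text \<open>
  \<open>exit_len y z a n u i\<close> is the length of the part in stick \<open>i\<close> of the path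
  from \<open>u \<le> y n\<close> down to the subtree \<open>[0, a]\<close>.
\<close>

fun exit_len :: "(nat \<Rightarrow> real) \<Rightarrow> (nat \<Rightarrow> real) \<Rightarrow> real \<Rightarrow> nat \<Rightarrow> real \<Rightarrow> nat \<Rightarrow> real" where
  "exit_len y z a 0 u i = 0"
| "exit_len y z a (Suc n) u i =
     (if u \<le> y n then exit_len y z a n u i
      else (if i = n then max 0 (u - max a (y n)) else 0)
           + (if y n \<le> a then 0 else exit_len y z a n (z n) i))"

definition path_len :: "(nat \<Rightarrow> real) \<Rightarrow> (nat \<Rightarrow> real) \<Rightarrow> real \<Rightarrow> nat \<Rightarrow> real \<Rightarrow> real" where
  "path_len y z a n u = (\<Sum>i<n. exit_len y z a n u i)"

lemma exit_len_eq_0: "n \<le> i \<Longrightarrow> exit_len y z a n u i = 0"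
  by (induction n arbitrary: u) auto

lemma path_len_Suc:
  "path_len y z a (Suc n) u =
     (if u \<le> y n then path_len y z a n u
      else max 0 (u - max a (y n)) + (if y n \<le> a then 0 else path_len y z a n (z n)))"
  by (auto simp: path_len_def exit_len_eq_0)

text \<open>The conditions under which the recursions of distance and field hold, packaged so that
  they can be interpreted for one fixed outcome.\<close>

locale stick_tree =
  fixes y z :: "nat \<Rightarrow> real"
  assumes y_mono: "strict_mono y" and y_unbounded: "\<And>u. \<exists>n. u \<le> y n"
    and y0: "y 0 = 0" and z0: "z 0 = 0" and z_le: "\<And>i. 0 \<le> z i \<and> z i \<le> y i"
begin

lemmas tree = y_mono y_unbounded y0 z0 z_le
lemmas y_le = y_le[OF tree]
lemmas dist_glue = icrt_dist_glue[OF tree]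
lemmas dist_stick = icrt_dist_stick[OF tree]
lemmas field_stick = icrt_field_stick[OF tree]
lemmas line_simps = line_metric_simps[OF tree]

sublocale D: Metric_space "{0..}" "icrt_dist y z"
  by (rule Metric_space_icrt_dist[OF tree])

lemma y_nonneg: "0 \<le> y n"
  using y_le[of 0 n] y0 by simp

lemma stick_cases:
  assumes "0 \<le> u" obtains "u = 0" | i where "y i < u" "u \<le> y (Suc i)"
proof -
  obtain n where "u \<le> y n" using y_unbounded by blast
  then have "u = 0 \<or> (\<exists>i. y i < u \<and> u \<le> y (Suc i))"
    using assms
  proof (induction n)
    case (Suc n) then show ?case by (cases "u \<le> y n") auto
  qed (use y0 in auto)
  then show ?thesis using that by blast
qed

text \<open>Since \<open>z i \<le> y i\<close>, passing from a point to the glue point of its stick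
  lowers the level. This is induction along the path to the root.\<close>

lemma stick_induct [consumes 1, case_names zero stick]:
  assumes "0 \<le> u" and "P 0"
    and step: "\<And>i u. y i < u \<Longrightarrow> u \<le> y (Suc i) \<Longrightarrow> P (z i) \<Longrightarrow> P u"
  shows "P u"
proof -
  obtain n where "u \<le> y n" using y_unbounded by blast
  then show ?thesis
    using \<open>0 \<le> u\<close>
  proof (induction n arbitrary: u)
    case 0 then show ?case using y0 \<open>P 0\<close> by simp
  next
    case (Suc n) then show ?case using step[of n u] z_le[of n] by (cases "u \<le> y n") auto
  qed
qed

text \<open>The point where the path from \<open>u\<close> to the root enters the subtree
  \<open>[0, a]\<close>. The \<open>LEAST\<close> follows the encoding of \<open>icrt_field\<close>;
  any later level gives the same value.\<close>

definition proj :: "real \<Rightarrow> real \<Rightarrow> real" where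
  "proj a u = stick_proj y z a (LEAST n. u \<le> y n) u"

lemma stick_proj_stable:
  assumes "u \<le> y n" shows "stick_proj y z a (n + k) u = stick_proj y z a n u"
proof (induction k)
  case (Suc k)
  have "y n \<le> y (n + k)" by (simp add: y_le)
  with assms have "u \<le> y (n + k)" by linarith
  with Suc show ?case by simp
qed simp

lemma proj_eq_stick_proj: 
  assumes "u \<le> y n" shows "proj a u = stick_proj y z a n u"
proof -
  define l where "l = (LEAST n. u \<le> y n)"
  have "u \<le> y l" unfolding l_def by (rule LeastI[of _ n]) (use assms in simp)
  moreover have "l \<le> n" unfolding l_def by (rule Least_le) (use assms in simp)
  ultimately have "stick_proj y z a n u = stick_proj y z a l u"
    using stick_proj_stable[of u l a "n - l"] by simp
  then show ?thesis by (simp add: proj_def l_def)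
qed

lemma proj_0: "proj a 0 = 0"
  using proj_eq_stick_proj[of 0 0 a] y0 by simp

lemma proj_stick:
  assumes "y i < u" "u \<le> y (Suc i)"
  shows "proj a u = (if u \<le> a then u else if y i < a then a else proj a (z i))"
  using assms z_le[of i] proj_eq_stick_proj[of u "Suc i" a] proj_eq_stick_proj[of "z i" i a] by auto

lemma proj_ident: "0 \<le> u \<Longrightarrow> u \<le> a \<Longrightarrow> proj a u = u"
  by (erule stick_cases) (auto simp: proj_0 proj_stick)

lemma proj_bounds: "0 \<le> u \<Longrightarrow> 0 \<le> a \<Longrightarrow> 0 \<le> proj a u \<and> proj a u \<le> a"
proof (induction u rule: stick_induct)
  case (stick i u) then show ?case using y_nonneg[of i] by (auto simp: proj_stick)
qed (simp add: proj_0)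

text \<open>A path to \<open>[0, a]\<close> enters the larger subtree \<open>[0, a']\<close> on its
  way. This is what lets increments telescope over the scales.\<close>

lemma proj_proj: "0 \<le> u \<Longrightarrow> 0 \<le> a \<Longrightarrow> a \<le> a' \<Longrightarrow> proj a (proj a' u) = proj a u"
proof (induction u rule: stick_induct)
  case (stick i u)
  then show ?case
    by (cases "y i < a'") (auto simp: proj_stick[of i u] proj_stick[of i a'])
qed (simp add: proj_0)

text \<open>Cutting at \<open>[0, a]\<close> only removes end pieces of the path between two points.
  By induction on the level of the later point: if it is alone on the last stick,
  \<open>dist_glue\<close> splits off its height above the glue point; if both points are on that
  stick, they are compared inside one interval.\<close>

lemma proj_dist_le:
  assumes "0 \<le> u" "0 \<le> v" "0 \<le> a"
  shows "icrt_dist y z (proj a u) (proj a v) \<le> icrt_dist y z u v"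
proof -
  have *: "icrt_dist y z (proj a u) (proj a v) \<le> icrt_dist y z u v"
    if "u \<le> v" "v \<le> y n" "0 \<le> u" for u v n
    using that
  proof (induction n arbitrary: u v)
    case 0
    then have "u = 0" "v = 0" using y0 by auto
    then show ?case by (simp add: proj_0)
  next
    case (Suc n)
    have zn: "0 \<le> z n" "z n \<le> y n" using z_le[of n] by auto
    consider "v \<le> y n" | "u \<le> y n" "y n < v" | "y n < u" by linarith
    then show ?case
    proof cases
      case 1 then show ?thesis using Suc by auto
    next
      case 2
      note case2 = 2
      have glue: "icrt_dist y z u w = icrt_dist y z u (z n) + (w - y n)" if "y n < w" "w \<le> v" for w
        using dist_glue[of u n w] 2 Suc.prems that by auto
      have IH: "icrt_dist y z (proj a u) (proj a (z n)) \<le> icrt_dist y z u (z n)"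
        using Suc.IH[of u "z n"] Suc.IH[of "z n" u] zn 2 Suc.prems D.commute by (metis linear)
      \<comment> \<open>The projection of \<open>v\<close> is \<open>v\<close> itself, the point
        \<open>a\<close> inside the stick of \<open>v\<close>, or the projection of the glue point
        \<open>z n\<close>. In the middle case \<open>glue\<close> is applied at both
        \<open>v\<close> and \<open>a\<close>.\<close>
      consider "v \<le> a" | "a < v" "y n < a" | "a < v" "a \<le> y n" by linarith
      then show ?thesis
      proof cases
        case 1
        then have "proj a u = u" "proj a v = v" using Suc.prems by (auto intro!: proj_ident)
        then show ?thesis by simp
      next
        case 2
        then have "proj a u = u" "proj a v = a"
          using Suc.prems case2 2 proj_stick[of n v a] by (auto intro!: proj_ident)
        then show ?thesis using glue[of v] glue[of a] 2 case2 by simp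
      next
        case 3
        then have "proj a v = proj a (z n)"
          using Suc.prems case2 3 proj_stick[of n v a] by auto
        then show ?thesis using glue[of v] IH case2 by simp
      qed
    next
      case 3
      have d: "icrt_dist y z w w' = w' - w" if "y n < w" "w \<le> w'" "w' \<le> v" for w w'
        using dist_stick[of n w w'] that Suc.prems by auto
      show ?thesis
      proof (cases "u \<le> a")
        case True
        then show ?thesis
          using 3 Suc.prems proj_stick[of n v a] proj_ident[of u a] by (auto simp: d)
      next
        case False
        then show ?thesis
          using 3 Suc.prems proj_bounds[of "z n" a] zn assms(3) by (auto simp: proj_stick[of n] d)
      qed
    qed
  qed
  obtain m n where "u \<le> y m" "v \<le> y n" using y_unbounded by meson
  then show ?thesis
    using *[of u v n] *[of v u m] assms D.commute by (metis linear)
qed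

section \<open>Uniform continuity of the field and extension to the completion\<close>

text \<open>Level \<open>Suc n\<close> adds one compact segment, on which \<open>b\<close> is
  uniformly continuous. For points on both sides of \<open>y n\<close> the distance is the sum of
  the distance to \<open>z n\<close> and the height \<open>v - y n\<close>, so both are small and
  each costs \<open>e / 2\<close>.\<close>

lemma field_uniformly_continuous_on_level:
  assumes b: "continuous_on {0..} b" and "0 < e"
  shows "\<exists>d>0. \<forall>u v. 0 \<le> u \<and> u \<le> y n \<and> 0 \<le> v \<and> v \<le> y n \<and> icrt_dist y z u v < d
           \<longrightarrow> \<bar>icrt_field y z b u - icrt_field y z b v\<bar> < e"
  using \<open>0 < e\<close>
proof (induction n arbitrary: e)
  case 0 then show ?case using y0 by (intro exI[of _ 1]) auto
next
  case (Suc n)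
  have zn: "0 \<le> z n" "z n \<le> y n" using z_le[of n] by auto
  obtain d1 where d1: "d1 > 0" "\<And>u v. 0 \<le> u \<Longrightarrow> u \<le> y n \<Longrightarrow> 0 \<le> v \<Longrightarrow> v \<le> y n
      \<Longrightarrow> icrt_dist y z u v < d1 \<Longrightarrow> \<bar>icrt_field y z b u - icrt_field y z b v\<bar> < e / 2"
    using Suc.IH[of "e/2"] Suc.prems by auto
  have "uniformly_continuous_on {y n..y (Suc n)} b"
    by (intro compact_uniformly_continuous continuous_on_subset[OF b]) (use y_nonneg[of n] in auto)
  then obtain d2 where d2: "d2 > 0" "\<And>u v. u \<in> {y n..y (Suc n)} \<Longrightarrow> v \<in> {y n..y (Suc n)}
      \<Longrightarrow> dist u v < d2 \<Longrightarrow> dist (b u) (b v) < e / 2"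
    unfolding uniformly_continuous_on_def using Suc.prems by (metis half_gt_zero)
  have main: "\<bar>icrt_field y z b u - icrt_field y z b v\<bar> < e"
    if "0 \<le> u" "u \<le> v" "v \<le> y (Suc n)" and d: "icrt_dist y z u v < min d1 d2" for u v
  proof -
    have nn: "0 \<le> icrt_dist y z u (z n)" by simp
    consider "v \<le> y n" | "u \<le> y n" "y n < v" | "y n < u" by linarith
    then show ?thesis
    proof cases
      case 1 
      then have "\<bar>icrt_field y z b u - icrt_field y z b v\<bar> < e / 2"
        using that by (intro d1) auto
      then show ?thesis using Suc.prems by linarith
    next
      case 2
      have eq: "icrt_dist y z u v = icrt_dist y z u (z n) + (v - y n)"
        using dist_glue 2 that by auto
      have "\<bar>icrt_field y z b u - icrt_field y z b (z n)\<bar> < e / 2"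
        using that zn 2 eq by (intro d1) auto
      moreover have "dist (b v) (b (y n)) < e / 2"
        using that 2 eq nn by (intro d2(2)) (auto simp: dist_real_def simp del: D.nonneg)
      ultimately show ?thesis
        using field_stick[of n v b] 2 that by (simp add: dist_real_def abs_real_def split: if_splits)
    next
      case 3
      have "dist (b u) (b v) < e / 2"
        using that 3 dist_stick[of n u v] by (intro d2(2)) (auto simp: dist_real_def)
      then show ?thesis
        using field_stick[of n v b] field_stick[of n u b] 3 that Suc.prems
        by (simp add: dist_real_def)
    qed
  qed
  show ?case
  proof (intro exI[of _ "min d1 d2"] conjI allI impI)
    show "0 < min d1 d2" using d1 d2 by simp
    fix u v
    assume *: "0 \<le> u \<and> u \<le> y (Suc n) \<and> 0 \<le> v \<and> v \<le> y (Suc n) \<and> icrt_dist y z u v < min d1 d2"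
    then show "\<bar>icrt_field y z b u - icrt_field y z b v\<bar> < e"
      using main[of u v] main[of v u] D.commute[of u v] by (cases "u \<le> v") (auto simp: abs_minus_commute)
  qed
qed

text \<open>Three-term estimate: \<open>approx\<close> handles everything outside
  \<open>[0, a]\<close> uniformly, \<open>proj_dist_le\<close> keeps the projected points close, and
  \<open>[0, a]\<close> is contained in a single level.\<close>

lemma field_uniformly_continuous:
  assumes b: "continuous_on {0..} b"
    and approx: "\<And>e. 0 < e \<Longrightarrow> \<exists>a\<ge>0. \<forall>x\<ge>0. \<bar>icrt_field y z b x - icrt_field y z b (proj a x)\<bar> \<le> e"
  shows "uniformly_continuous_map (line_metric y z) euclidean_metric (icrt_field y z b)"
  unfolding uniformly_continuous_map_def line_simps
proof (intro conjI allI impI)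
  fix e :: real assume "0 < e"
  obtain a where a: "a \<ge> 0"
    "\<And>x. x \<ge> 0 \<Longrightarrow> \<bar>icrt_field y z b x - icrt_field y z b (proj a x)\<bar> \<le> e / 4"
    using approx[of "e/4"] \<open>0 < e\<close> by auto
  obtain n where n: "a \<le> y n" using y_unbounded by blast
  obtain d where d: "d > 0" "\<And>u v. 0 \<le> u \<Longrightarrow> u \<le> y n \<Longrightarrow> 0 \<le> v \<Longrightarrow> v \<le> y n
      \<Longrightarrow> icrt_dist y z u v < d \<Longrightarrow> \<bar>icrt_field y z b u - icrt_field y z b v\<bar> < e / 4"
    using field_uniformly_continuous_on_level[OF b, of "e/4" n] \<open>0 < e\<close> by auto
  show "\<exists>d>0. \<forall>x\<in>{0..}. \<forall>x'\<in>{0..}. icrt_dist y z x' x < d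
      \<longrightarrow> mdist euclidean_metric (icrt_field y z b x') (icrt_field y z b x) < e"
  proof (intro exI[of _ d] conjI ballI impI d(1))
    fix u v :: real assume uv: "u \<in> {0..}" "v \<in> {0..}" "icrt_dist y z v u < d"
    have "\<bar>icrt_field y z b (proj a v) - icrt_field y z b (proj a u)\<bar> < e / 4"
      using proj_bounds[of u a] proj_bounds[of v a] proj_dist_le[of v u a] uv a(1) n
      by (intro d(2)) auto
    then show "mdist euclidean_metric (icrt_field y z b v) (icrt_field y z b u) < e"
      using a(2)[of u] a(2)[of v] uv \<open>0 < e\<close>
      unfolding mdist_euclidean_metric dist_real_def atLeast_iff by linarith
  qed
qed auto

text \<open>The embedding is isometric, hence injective, so the field can be read on its dense image
  through \<open>the_inv_into\<close>. A uniformly continuous map is Cauchy continuous and, the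
  reals being complete, extends to the closure of the image, which is the whole completion.\<close>

lemma field_extends:
  assumes "uniformly_continuous_map (line_metric y z) euclidean_metric (icrt_field y z b)"
  shows "\<exists>g. continuous_map (mtopology_of (icrt y z)) euclideanreal g \<and>
           (\<forall>x\<ge>0. g (icrt_embed y z x) = icrt_field y z b x)"
proof -
  define m where "m = line_metric y z"
  define m' where "m' = icrt y z"
  define f where "f = icrt_embed y z"
  define S where "S = f ` {0..}"
  have ms: "mspace m = {0..}" by (simp add: m_def line_simps)
  then have ne: "mspace m \<noteq> {}" by auto
  note compl = metric_completion_is_completion[OF ne, folded m_def, unfolded m_def, folded icrt_def,
      folded f_def m'_def, unfolded ms[unfolded m_def]]
  have fS: "f x \<in> mspace m'" if "x \<ge> 0" for x using compl(2) that by auto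
  have iso: "mdist m' (f x) (f v) = icrt_dist y z x v" if "x \<ge> 0" "v \<ge> 0" for x v
    using compl(4)[of x v] that by (simp add: line_simps)
  have inj: "inj_on f {0..}"
    by (rule inj_onI) (metis D.zero atLeast_iff iso)
  have inv: "the_inv_into {0..} f (f x) = x" if "x \<ge> 0" for x
    using the_inv_into_f_f[OF inj] that by simp
  have "uniformly_continuous_map (submetric m' S) euclidean_metric (\<lambda>w. icrt_field y z b (the_inv_into {0..} f w))"
    using assms unfolding uniformly_continuous_map_def line_simps
    by (simp add: S_def iso inv fS Int_absorb2 image_subset_iff)
  from Cauchy_continuous_map_extends_to_continuous_closure_of[OF _ uniformly_imp_Cauchy_continuous_map[OF this]]
  obtain g where g: "continuous_map (subtopology (mtopology_of m') (mtopology_of m' closure_of S)) euclideanreal g"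
      "\<And>w. w \<in> S \<Longrightarrow> g w = icrt_field y z b (the_inv_into {0..} f w)"
    by (auto simp: mcomplete_of_def)
  have "mtopology_of m' closure_of S = topspace (mtopology_of m')" using compl(3) by (simp add: S_def)
  then have "continuous_map (mtopology_of m') euclideanreal g"
    using g(1) subtopology_topspace[of "mtopology_of m'"] by simp
  moreover have "g (f x) = icrt_field y z b x" if "x \<ge> 0" for x
    using g(2)[of "f x"] inv that by (simp add: S_def)
  ultimately show ?thesis unfolding m'_def f_def by blast
qed

text \<open>By \<open>proj_proj\<close> the increment from \<open>x\<close> down to
  \<open>[0, l n1]\<close> is the sum of the increments between consecutive scales, and tails of a
  convergent series are below \<open>e\<close>.\<close>

lemma field_approx_of_summable:
  fixes l \<sigma> :: "nat \<Rightarrow> real"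
  assumes l: "\<And>n. 0 \<le> l n" "mono l" "\<And>x. \<exists>n. x \<le> l n"
    and \<sigma>: "summable \<sigma>" "\<And>n. 0 \<le> \<sigma> n"
    and bound: "\<And>n x. n \<ge> start \<Longrightarrow> 0 \<le> x \<Longrightarrow> x \<le> l (Suc n)
        \<Longrightarrow> \<bar>icrt_field y z b x - icrt_field y z b (proj (l n) x)\<bar> \<le> \<sigma> n"
    and "0 < e"
  shows "\<exists>a\<ge>0. \<forall>x\<ge>0. \<bar>icrt_field y z b x - icrt_field y z b (proj a x)\<bar> \<le> e"
proof -
  obtain N where N: "\<And>m n. m \<ge> N \<Longrightarrow> norm (sum \<sigma> {m..<n}) < e"
    using \<sigma>(1)[unfolded summable_Cauchy] \<open>0 < e\<close> by meson
  define n1 where "n1 = max start N"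
  have tele: "\<bar>icrt_field y z b x - icrt_field y z b (proj (l n1) x)\<bar> \<le> sum \<sigma> {n1..<n1+k}"
    if "0 \<le> x" "x \<le> l (n1 + k)" for x k
    using that
  proof (induction k arbitrary: x)
    case 0 then show ?case by (simp add: proj_ident)
  next
    case (Suc k)
    define x' where "x' = proj (l (n1 + k)) x"
    have x': "0 \<le> x'" "x' \<le> l (n1 + k)" using proj_bounds[of x] l(1) Suc.prems by (auto simp: x'_def)
    have "proj (l n1) x' = proj (l n1) x"
      unfolding x'_def using l Suc.prems by (intro proj_proj) (auto simp: mono_def)
    moreover have "\<bar>icrt_field y z b x - icrt_field y z b x'\<bar> \<le> \<sigma> (n1 + k)"
      unfolding x'_def using Suc.prems by (intro bound) (auto simp: n1_def)
    ultimately show ?case using Suc.IH[OF x'] by simp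
  qed
  show ?thesis
  proof (intro exI[of _ "l n1"] conjI allI impI l(1))
    fix x :: real assume "0 \<le> x"
    obtain n where "x \<le> l n" using l(3) by blast
    then have "x \<le> l (n1 + n)" using monoD[OF l(2), of n "n1 + n"] by linarith
    from tele[OF \<open>0 \<le> x\<close> this] N[of n1 "n1+n"]
    show "\<bar>icrt_field y z b x - icrt_field y z b (proj (l n1) x)\<bar> \<le> e" by (simp add: n1_def)
  qed
qed

section \<open>Increments of the field along paths\<close>

text \<open>A path towards the root visits a stick at most once and leaves it through its base, so
  its part in stick \<open>i\<close> beyond \<open>a\<close> fits into the part of that stick beyond
  \<open>a\<close>. Hence the increments in \<open>field_diff_proj\<close> live on disjoint
  intervals.\<close>

lemma exit_len_bounds:
  assumes "0 \<le> u" "u \<le> y n"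
  shows "0 \<le> exit_len y z a n u i \<and> exit_len y z a n u i \<le> max a (y (Suc i)) - max a (y i)"
  using assms
proof (induction n arbitrary: u)
  case 0 then show ?case using y_le[of i "Suc i"] by auto
next
  case (Suc n)
  have zn: "0 \<le> z n" "z n \<le> y n" using z_le[of n] by auto
  show ?case
    using Suc.IH[of u] Suc.IH[of "z n"] Suc.prems zn y_le[of i "Suc i"] exit_len_eq_0[of n i y z a "z n"]
    by (cases "u \<le> y n") auto
qed

text \<open>Each visited stick contributes the increment of \<open>b\<close> over its initial piece
  beyond \<open>a\<close>; sticks off the path have \<open>exit_len\<close> zero and contribute
  nothing. The increment of the field is thus a sum of increments of \<open>b\<close> over disjoint
  intervals.\<close>

lemma field_diff_proj:
  assumes "0 \<le> u" "u \<le> y n" "0 \<le> a"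
  shows "icrt_field y z b u - icrt_field y z b (proj a u)
           = (\<Sum>i<n. b (max a (y i) + exit_len y z a n u i) - b (max a (y i)))"
  using assms(1,2)
proof (induction n arbitrary: u)
  case 0 then show ?case using y0 by (simp add: proj_0)
next
  case (Suc n)
  have zn: "0 \<le> z n" "z n \<le> y n" using z_le[of n] by auto
  show ?case
  proof (cases "u \<le> y n")
    case True
    then show ?thesis using Suc exit_len_eq_0[of n n y z a u] by simp
  next
    case False
    have fu: "icrt_field y z b u = icrt_field y z b (z n) + b u - b (y n)"
      using field_stick[of n u b] False Suc.prems by simp
    show ?thesis
    proof (cases "y n \<le> a")
      case True
      \<comment> \<open>The third value occurs for \<open>y n = a\<close>: the path then leaves
        stick \<open>n\<close> at its base and lands on \<open>z n\<close>, which already belongs to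
        \<open>[0, a]\<close>.\<close>
      have p: "proj a u = (if u \<le> a then u else if y n < a then a else z n)"
        using False Suc.prems proj_ident[of "z n" a] zn True proj_stick[of n u a] by auto
      have fa: "icrt_field y z b a = icrt_field y z b (z n) + b a - b (y n)" if "y n < a" "a < u"
        using field_stick[of n a b] that Suc.prems by simp
      show ?thesis
        using False True fu fa p by (auto simp: max_def)
    next
      case False': False
      have "proj a u = proj a (z n)"
        using False False' Suc.prems proj_stick[of n u a] by auto
      then show ?thesis
        using False False' fu Suc.IH[OF zn] exit_len_eq_0[of n n y z a "z n"] by (simp add: max_def)
    qed
  qed
qed

end

subsection \<open>Brownian motion\<close>

text \<open>Independence is given for sigma-algebras, not for variables. The joint law of
  \<open>f\<close> and \<open>h\<close> is a product measure, and Tonelli's theorem asks for no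
  integrability, which suits exponentials whose moments are still to be bounded.\<close>

lemma (in prob_space) nn_integral_mult_indep_set:
  fixes f h :: "'a \<Rightarrow> ennreal"
  assumes ind: "indep_set (sets A) (sets D)"
    and sp: "space A = space M" "space D = space M"
    and f: "f \<in> borel_measurable A" and h: "h \<in> borel_measurable D"
  shows "(\<integral>\<^sup>+ \<omega>. f \<omega> * h \<omega> \<partial>M) = (\<integral>\<^sup>+ \<omega>. f \<omega> \<partial>M) * (\<integral>\<^sup>+ \<omega>. h \<omega> \<partial>M)"
proof -
  have sub: "sets A \<subseteq> events" "sets D \<subseteq> events"
    using ind unfolding indep_set_def indep_sets_def by (auto simp: bool.split UNIV_bool)
  have fM: "f \<in> borel_measurable M" and hM: "h \<in> borel_measurable M"
    using f h sub sp by (auto simp: measurable_def)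
  have "indep_var borel f borel h"
    unfolding indep_var_eq
  proof (intro conjI fM hM)
    have "sigma_sets (space M) {f -` X \<inter> space M |X. X \<in> sets borel} \<subseteq> sets A"
      using f sp by (intro sets.sigma_sets_subset[of _ A, unfolded sp]) (auto simp: measurable_def)
    moreover have "sigma_sets (space M) {h -` X \<inter> space M |X. X \<in> sets borel} \<subseteq> sets D"
      using h sp by (intro sets.sigma_sets_subset[of _ D, unfolded sp]) (auto simp: measurable_def)
    ultimately show "indep_set (sigma_sets (space M) {f -` X \<inter> space M |X. X \<in> sets borel})
       (sigma_sets (space M) {h -` X \<inter> space M |X. X \<in> sets borel})"
      using ind unfolding indep_set_def
      by (rule_tac indep_sets_mono_sets) (auto split: bool.split)
  qed
  then have eq: "distr M borel f \<Otimes>\<^sub>M distr M borel h = distr M (borel \<Otimes>\<^sub>M borel) (\<lambda>x. (f x, h x))"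
    by (simp add: indep_var_distribution_eq)
  interpret H: prob_space "distr M borel h" by (rule prob_space_distr) (rule hM)
  have "(\<integral>\<^sup>+ \<omega>. f \<omega> * h \<omega> \<partial>M) = (\<integral>\<^sup>+ p. fst p * snd p \<partial>distr M (borel \<Otimes>\<^sub>M borel) (\<lambda>x. (f x, h x)))"
    using fM hM by (subst nn_integral_distr) auto
  also have "\<dots> = (\<integral>\<^sup>+ x. \<integral>\<^sup>+ y. x * y \<partial>distr M borel h \<partial>distr M borel f)"
    unfolding eq[symmetric] by (subst H.nn_integral_fst[symmetric]) (auto simp: split_beta')
  also have "\<dots> = (\<integral>\<^sup>+ \<omega>. f \<omega> \<partial>M) * (\<integral>\<^sup>+ \<omega>. h \<omega> \<partial>M)"
    using fM hM by (simp add: nn_integral_distr nn_integral_cmult nn_integral_multc)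
  finally show ?thesis .
qed

text \<open>Completing the square: the centred normal density times \<open>exp (c * x)\<close> is a
  constant times the normal density with mean \<open>c * \<sigma>\<^sup>2\<close>.\<close>

lemma normal_mgf:
  assumes "distributed M lborel \<xi> (normal_density 0 \<sigma>)" and \<sigma>: "\<sigma> > 0"
  shows "(\<integral>\<^sup>+ \<omega>. ennreal (exp (c * \<xi> \<omega>)) \<partial>M) = ennreal (exp (c\<^sup>2 * \<sigma>\<^sup>2 / 2))"
proof -
  have "(\<integral>\<^sup>+ \<omega>. ennreal (exp (c * \<xi> \<omega>)) \<partial>M)
      = (\<integral>\<^sup>+ x. ennreal (normal_density 0 \<sigma> x) * ennreal (exp (c * x)) \<partial>lborel)"
    using distributed_nn_integral[OF assms(1), of "\<lambda>x. ennreal (exp (c * x))"] by simp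
  also have "\<dots> = (\<integral>\<^sup>+ x. ennreal (exp (c\<^sup>2 * \<sigma>\<^sup>2 / 2)) * ennreal (normal_density (c * \<sigma>\<^sup>2) \<sigma> x) \<partial>lborel)"
  proof (intro nn_integral_cong)
    fix x
    have "- (x - 0)\<^sup>2 / (2 * \<sigma>\<^sup>2) + c * x = c\<^sup>2 * \<sigma>\<^sup>2 / 2 + - (x - c * \<sigma>\<^sup>2)\<^sup>2 / (2 * \<sigma>\<^sup>2)"
      using \<sigma> by (simp add: field_simps power2_eq_square)
    then have "normal_density 0 \<sigma> x * exp (c * x) = exp (c\<^sup>2 * \<sigma>\<^sup>2 / 2) * normal_density (c * \<sigma>\<^sup>2) \<sigma> x"
      unfolding normal_density_def by (simp add: exp_add[symmetric])
    then show "ennreal (normal_density 0 \<sigma> x) * ennreal (exp (c * x))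
        = ennreal (exp (c\<^sup>2 * \<sigma>\<^sup>2 / 2)) * ennreal (normal_density (c * \<sigma>\<^sup>2) \<sigma> x)"
      by (simp add: ennreal_mult[symmetric])
  qed
  also have "\<dots> = ennreal (exp (c\<^sup>2 * \<sigma>\<^sup>2 / 2)) * (\<integral>\<^sup>+ x. ennreal (normal_density (c * \<sigma>\<^sup>2) \<sigma> x) \<partial>lborel)"
    by (intro nn_integral_cmult) simp
  also have "(\<integral>\<^sup>+ x. ennreal (normal_density (c * \<sigma>\<^sup>2) \<sigma> x) \<partial>lborel) = 1"
    using prob_space.emeasure_space_1[OF prob_space_normal_density[OF \<sigma>, of "c * \<sigma>\<^sup>2"]]
    by (simp add: emeasure_density)
  finally show ?thesis by simp
qed

locale brownian = prob_space M for M :: "'w measure" +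
  fixes B :: "real \<Rightarrow> 'w \<Rightarrow> real"
  assumes bm: "standard_brownian_motion M B"
begin

definition path_algebra :: "'w measure" where
  "path_algebra = vimage_algebra (space M) (\<lambda>\<omega>. \<lambda>t\<in>{0..}. B t \<omega>) (\<Pi>\<^sub>M t\<in>{0..}. borel)"

lemma space_path_algebra [simp]: "space path_algebra = space M"
  by (simp add: path_algebra_def)

lemma B_measurable: "0 \<le> t \<Longrightarrow> B t \<in> borel_measurable M"
  using bm by (simp add: standard_brownian_motion_def)

lemma B_path_measurable:
  assumes "0 \<le> t" shows "B t \<in> borel_measurable path_algebra"
proof -
  have "(\<lambda>\<omega>. \<lambda>t\<in>{0..}. B t \<omega>) \<in> path_algebra \<rightarrow>\<^sub>M (\<Pi>\<^sub>M t\<in>{0..}. borel)"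
    unfolding path_algebra_def
    by (intro measurable_vimage_algebra1) (auto simp: space_PiM)
  from measurable_compose[OF this measurable_component_singleton[of t]] assms
  have "(\<lambda>\<omega>. (\<lambda>t\<in>{0..}. B t \<omega>) t) \<in> borel_measurable path_algebra" by simp
  with assms show ?thesis by simp
qed

lemma AE_continuous: "AE \<omega> in M. continuous_on {0..} (\<lambda>t. B t \<omega>)"
  using bm by (simp add: standard_brownian_motion_def)

lemma increment_mgf:
  assumes "0 \<le> s" "s < t"
  shows "(\<integral>\<^sup>+ \<omega>. ennreal (exp (c * (B t \<omega> - B s \<omega>))) \<partial>M) = ennreal (exp (c\<^sup>2 * (t - s) / 2))"
proof -
  have "distributed M lborel (\<lambda>\<omega>. B t \<omega> - B s \<omega>) (normal_density 0 (sqrt (t - s)))"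
    using bm assms unfolding standard_brownian_motion_def by blast
  from normal_mgf[OF this, of c] show ?thesis using assms by simp
qed

text \<open>Increments over distinct cells are independent, so only the number of cells enters. The
  set \<open>T\<close> is arbitrary because a path through several sticks uses cells that are not
  contiguous.\<close>

lemma grid_mgf:
  assumes \<delta>: "\<delta> > 0" and T: "finite T"
  shows "(\<integral>\<^sup>+ \<omega>. ennreal (exp (c * (\<Sum>r\<in>T. B (real (Suc r) * \<delta>) \<omega> - B (real r * \<delta>) \<omega>))) \<partial>M)
           = ennreal (exp (c\<^sup>2 * (\<delta> * card T) / 2))"
proof -
  obtain R where R: "T \<subseteq> {..<R}" using T finite_nat_iff_bounded by blast
  define \<xi> where "\<xi> r \<omega> = B (real (Suc r) * \<delta>) \<omega> - B (real r * \<delta>) \<omega>" for r \<omega>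
  have all: "\<And>(n::nat) t. 0 \<le> t 0 \<and> (\<forall>i<n. t i < t (Suc i)) \<Longrightarrow>
        indep_vars (\<lambda>_. borel) (\<lambda>i \<omega>. B (t (Suc i)) \<omega> - B (t i) \<omega>) {..<n}"
    using bm unfolding standard_brownian_motion_def by blast
  have "indep_vars (\<lambda>_. borel) \<xi> {..<R}"
    unfolding \<xi>_def using \<delta> by (intro all[of "\<lambda>r. real r * \<delta>"]) (auto simp: algebra_simps)
  then have "indep_vars (\<lambda>_. borel) \<xi> T" by (rule indep_vars_subset) fact
  then have ind: "indep_vars (\<lambda>_. borel) (\<lambda>r \<omega>. ennreal (exp (c * \<xi> r \<omega>))) T"
    by (rule indep_vars_compose2) simp
  have "(\<integral>\<^sup>+ \<omega>. ennreal (exp (c * (\<Sum>r\<in>T. \<xi> r \<omega>))) \<partial>M) = (\<integral>\<^sup>+ \<omega>. (\<Prod>r\<in>T. ennreal (exp (c * \<xi> r \<omega>))) \<partial>M)"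
    by (simp add: sum_distrib_left exp_sum[OF T] prod_ennreal)
  also have "\<dots> = (\<Prod>r\<in>T. \<integral>\<^sup>+ \<omega>. ennreal (exp (c * \<xi> r \<omega>)) \<partial>M)"
    by (rule indep_vars_nn_integral[OF T ind]) simp
  also have "\<dots> = (\<Prod>r\<in>T. ennreal (exp (c\<^sup>2 * \<delta> / 2)))"
    unfolding \<xi>_def using \<delta> by (intro prod.cong refl, subst increment_mgf) (auto simp: algebra_simps)
  also have "\<dots> = ennreal (exp (c\<^sup>2 * (\<delta> * card T) / 2))"
    by (simp add: prod_ennreal exp_of_nat_mult[symmetric] ennreal_power algebra_simps)
  finally show ?thesis unfolding \<xi>_def .
qed

text \<open>The random set \<open>S\<close> is determined by \<open>D\<close> and takes finitely
  many values. Decomposing over them leaves deterministic sets, where independence factors the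
  integral and \<open>grid_mgf\<close> evaluates it; resumming replaces the exponential by its
  conditional expectation given \<open>D\<close>.\<close>

lemma exp_grid_increments_indep:
  fixes g :: "'w \<Rightarrow> ennreal" and S :: "'w \<Rightarrow> nat set"
  assumes ind: "indep_set (sets path_algebra) (sets D)" and spD: "space D = space M"
    and g: "g \<in> borel_measurable D" and \<delta>: "\<delta> > 0"
    and S: "\<And>\<omega>. \<omega> \<in> space M \<Longrightarrow> S \<omega> \<subseteq> {..<R}" "\<And>r. {\<omega> \<in> space D. r \<in> S \<omega>} \<in> sets D"
  defines "\<xi> \<equiv> \<lambda>r \<omega>. B (real (Suc r) * \<delta>) \<omega> - B (real r * \<delta>) \<omega>"
  shows "(\<lambda>\<omega>. g \<omega> * ennreal (exp (c * (\<Sum>r\<in>S \<omega>. \<xi> r \<omega>)))) \<in> borel_measurable M"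
    and "(\<integral>\<^sup>+ \<omega>. g \<omega> * ennreal (exp (c * (\<Sum>r\<in>S \<omega>. \<xi> r \<omega>))) \<partial>M)
           = (\<integral>\<^sup>+ \<omega>. g \<omega> * ennreal (exp (c\<^sup>2 * (\<delta> * card (S \<omega>)) / 2)) \<partial>M)"
proof -
  have sub: "sets D \<subseteq> events"
    using ind unfolding indep_set_def indep_sets_def by (auto simp: bool.split UNIV_bool)
  have gM: "g \<in> borel_measurable M" using g sub spD by (auto simp: measurable_def)
  have ST: "{\<omega> \<in> space D. S \<omega> = T} \<in> sets D" if "T \<subseteq> {..<R}" for T
  proof -
    have "{\<omega> \<in> space D. S \<omega> = T} = {\<omega> \<in> space D. \<forall>r\<in>{..<R}. r \<in> S \<omega> \<longleftrightarrow> r \<in> T}"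
      using S(1) that spD by blast
    also have "\<dots> \<in> sets D"
      using S(2) by (intro sets.sets_Collect_finite_All sets.sets_Collect) auto
    finally show ?thesis .
  qed
  define h where "h T \<omega> = g \<omega> * indicator {\<omega> \<in> space D. S \<omega> = T} \<omega>" for T \<omega>
  have hD: "h T \<in> borel_measurable D" if "T \<subseteq> {..<R}" for T
    unfolding h_def using g ST[OF that] by measurable
  have hM: "h T \<in> borel_measurable M" if "T \<subseteq> {..<R}" for T
    using hD[OF that] sub spD by (auto simp: measurable_def)
  have split: "g \<omega> * \<phi> (S \<omega>) = (\<Sum>T\<in>Pow {..<R}. h T \<omega> * \<phi> T)" if "\<omega> \<in> space M" for \<omega> \<phi>
  proof -
    have "(\<Sum>T\<in>Pow {..<R}. h T \<omega> * \<phi> T) = (\<Sum>T\<in>{S \<omega>}. h T \<omega> * \<phi> T)"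
      using S(1)[OF that] by (intro sum.mono_neutral_right) (auto simp: h_def indicator_def split: if_splits)
    then show ?thesis using that spD by (simp add: h_def)
  qed
  have \<xi>P: "(\<lambda>\<omega>. ennreal (exp (c * (\<Sum>r\<in>T. \<xi> r \<omega>)))) \<in> borel_measurable path_algebra" for T
    unfolding \<xi>_def using \<delta>
    by (intro measurable_compose[OF _ measurable_ennreal] borel_measurable_exp[THEN measurable_compose[rotated]]
        borel_measurable_times borel_measurable_const borel_measurable_sum borel_measurable_diff B_path_measurable) auto
  have \<xi>M: "(\<lambda>\<omega>. ennreal (exp (c * (\<Sum>r\<in>T. \<xi> r \<omega>)))) \<in> borel_measurable M" for T
    unfolding \<xi>_def using \<delta>
    by (intro measurable_compose[OF _ measurable_ennreal] borel_measurable_exp[THEN measurable_compose[rotated]]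
        borel_measurable_times borel_measurable_const borel_measurable_sum borel_measurable_diff B_measurable) auto
  have eq: "g \<omega> * ennreal (exp (c * (\<Sum>r\<in>S \<omega>. \<xi> r \<omega>)))
      = (\<Sum>T\<in>Pow {..<R}. h T \<omega> * ennreal (exp (c * (\<Sum>r\<in>T. \<xi> r \<omega>))))" if "\<omega> \<in> space M" for \<omega>
    using split[OF that, of "\<lambda>T. ennreal (exp (c * (\<Sum>r\<in>T. \<xi> r \<omega>)))"] .
  show "(\<lambda>\<omega>. g \<omega> * ennreal (exp (c * (\<Sum>r\<in>S \<omega>. \<xi> r \<omega>)))) \<in> borel_measurable M"
    using hM \<xi>M by (subst measurable_cong[OF eq]) auto
  have "(\<integral>\<^sup>+ \<omega>. g \<omega> * ennreal (exp (c * (\<Sum>r\<in>S \<omega>. \<xi> r \<omega>))) \<partial>M)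
      = (\<Sum>T\<in>Pow {..<R}. \<integral>\<^sup>+ \<omega>. ennreal (exp (c * (\<Sum>r\<in>T. \<xi> r \<omega>))) * h T \<omega> \<partial>M)"
    using hM \<xi>M by (subst nn_integral_cong[OF eq], simp, subst nn_integral_sum) (auto simp: mult.commute)
  also have "\<dots> = (\<Sum>T\<in>Pow {..<R}. \<integral>\<^sup>+ \<omega>. h T \<omega> * ennreal (exp (c\<^sup>2 * (\<delta> * card T) / 2)) \<partial>M)"
  proof (intro sum.cong refl)
    fix T assume "T \<in> Pow {..<R}"
    then have T: "T \<subseteq> {..<R}" "finite T" by (auto intro: finite_subset)
    show "(\<integral>\<^sup>+ \<omega>. ennreal (exp (c * (\<Sum>r\<in>T. \<xi> r \<omega>))) * h T \<omega> \<partial>M)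
        = (\<integral>\<^sup>+ \<omega>. h T \<omega> * ennreal (exp (c\<^sup>2 * (\<delta> * card T) / 2)) \<partial>M)"
      using nn_integral_mult_indep_set[OF ind _ spD \<xi>P hD[OF T(1)], of T] grid_mgf[OF \<delta> T(2), of c]
      by (simp add: nn_integral_multc[OF hM[OF T(1)]] \<xi>_def mult.commute)
  qed
  also have "\<dots> = (\<integral>\<^sup>+ \<omega>. g \<omega> * ennreal (exp (c\<^sup>2 * (\<delta> * card (S \<omega>)) / 2)) \<partial>M)"
    using hM by (subst nn_integral_sum[symmetric]) (auto intro!: nn_integral_cong
        simp: split[of _ "\<lambda>T. ennreal (exp (c\<^sup>2 * (\<delta> * card T) / 2))"])
  finally show "(\<integral>\<^sup>+ \<omega>. g \<omega> * ennreal (exp (c * (\<Sum>r\<in>S \<omega>. \<xi> r \<omega>))) \<partial>M)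
           = (\<integral>\<^sup>+ \<omega>. g \<omega> * ennreal (exp (c\<^sup>2 * (\<delta> * card (S \<omega>)) / 2)) \<partial>M)" .
qed

text \<open>The value of \<open>B\<close> at a random time is not known to be measurable, as paths
  are continuous only almost surely. The integrand is therefore replaced by a measurable version
  \<open>h\<close>, a liminf of grid approximations: end points are rounded up to a dyadic grid,
  where \<open>exp_grid_increments_indep\<close> is exact, and Fatou's lemma passes to the limit,
  whence an inequality. The order conditions are asked for only where \<open>g\<close> does not
  vanish.\<close>

lemma exp_increments_le:
  fixes g :: "'w \<Rightarrow> ennreal" and p q :: "nat \<Rightarrow> 'w \<Rightarrow> real"
  assumes ind: "indep_set (sets path_algebra) (sets D)" and spD: "space D = space M"
    and g: "g \<in> borel_measurable D"
    and p: "\<And>i. p i \<in> borel_measurable D" and q: "\<And>i. q i \<in> borel_measurable D"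
    and ord: "\<And>\<omega> i. \<omega> \<in> space M \<Longrightarrow> g \<omega> \<noteq> 0 \<Longrightarrow> i < n \<Longrightarrow>
      0 \<le> p i \<omega> \<and> p i \<omega> \<le> q i \<omega> \<and> q i \<omega> \<le> b"
    and ord': "\<And>\<omega> i j. \<omega> \<in> space M \<Longrightarrow> g \<omega> \<noteq> 0 \<Longrightarrow> i < j \<Longrightarrow> j < n \<Longrightarrow> q i \<omega> \<le> p j \<omega>"
  obtains h where "h \<in> borel_measurable M"
    "AE \<omega> in M. h \<omega> = g \<omega> * ennreal (exp (c * (\<Sum>i<n. B (q i \<omega>) \<omega> - B (p i \<omega>) \<omega>)))"
    "(\<integral>\<^sup>+ \<omega>. h \<omega> \<partial>M) \<le> (\<integral>\<^sup>+ \<omega>. g \<omega> * ennreal (exp (c\<^sup>2 / 2 * (\<Sum>i<n. q i \<omega> - p i \<omega>))) \<partial>M)"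
proof -
  define \<delta> :: "nat \<Rightarrow> real" where "\<delta> k = 1 / 2 ^ k" for k
  have \<delta>: "\<delta> k > 0" for k by (simp add: \<delta>_def)
  define up where "up k t = nat \<lceil>t / \<delta> k\<rceil>" for k t
  have up_less: "r < up k t \<longleftrightarrow> real r < t / \<delta> k" for r k t
    unfolding up_def by (auto simp: less_ceiling_iff zless_nat_eq_int_zless)
  have up_bounds: "t \<le> real (up k t) * \<delta> k" "real (up k t) * \<delta> k \<le> t + \<delta> k" if "0 \<le> t" for k t
  proof -
    have c: "real (up k t) = of_int \<lceil>t / \<delta> k\<rceil>"
      unfolding up_def using \<delta>[of k] that by (simp add: of_nat_nat divide_nonneg_pos)
    have "t / \<delta> k \<le> of_int \<lceil>t / \<delta> k\<rceil>" "of_int \<lceil>t / \<delta> k\<rceil> - 1 \<le> t / \<delta> k" by linarith+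
    then have "t \<le> of_int \<lceil>t / \<delta> k\<rceil> * \<delta> k" "(of_int \<lceil>t / \<delta> k\<rceil> - 1) * \<delta> k \<le> t"
      using \<delta>[of k] by (simp_all only: pos_divide_le_eq pos_le_divide_eq)
    then show "t \<le> real (up k t) * \<delta> k" "real (up k t) * \<delta> k \<le> t + \<delta> k"
      unfolding c by (simp_all add: left_diff_distrib)
  qed
  have up_lim: "(\<lambda>k. real (up k t) * \<delta> k) \<longlonglongrightarrow> t" if "0 \<le> t" for t
  proof (rule tendsto_sandwich[of "\<lambda>_. t" _ _ "\<lambda>k. t + \<delta> k"])
    have "\<delta> \<longlonglongrightarrow> 0" unfolding \<delta>_def by real_asymp
    then show "(\<lambda>k. t + \<delta> k) \<longlonglongrightarrow> t" using tendsto_add[OF tendsto_const[of t]] by force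
  qed (use up_bounds[OF that] in auto)
  have up_mono: "up k s \<le> up k t" if "s \<le> t" for k s t
    unfolding up_def using that \<delta>[of k] by (intro nat_mono ceiling_mono divide_right_mono) auto
  \<comment> \<open>Membership is phrased by comparing \<open>r\<close> with quotients by
    \<open>\<delta> k\<close>, so that it is visibly measurable in \<open>D\<close>; the bound
    \<open>up k b\<close> keeps \<open>S\<close> finite even where \<open>g\<close>
    vanishes.\<close>
  define S where "S k \<omega> = {r. r < up k b \<and> (\<exists>i<n. \<not> real r < p i \<omega> / \<delta> k \<and> real r < q i \<omega> / \<delta> k)}" for k \<omega>
  have S_eq: "S k \<omega> = (\<Union>i<n. {up k (p i \<omega>)..<up k (q i \<omega>)})" if "\<omega> \<in> space M" "g \<omega> \<noteq> 0" for k \<omega>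
  proof -
    have "q i \<omega> \<le> b" if "i < n" for i using ord[OF \<open>\<omega> \<in> space M\<close> \<open>g \<omega> \<noteq> 0\<close> that] by simp
    then show ?thesis
      unfolding S_def using up_mono[of _ b k] by (fastforce simp: up_less[symmetric] not_less)
  qed
  have disj: "disjoint_family_on (\<lambda>i. {up k (p i \<omega>)..<up k (q i \<omega>)}) {..<n}"
    if "\<omega> \<in> space M" "g \<omega> \<noteq> 0" for k \<omega>
  proof -
    have "up k (q i \<omega>) \<le> up k (p j \<omega>)" if "i < j" "j < n" for i j
      using ord'[OF \<open>\<omega> \<in> space M\<close> \<open>g \<omega> \<noteq> 0\<close> that] by (rule up_mono)
    then have "{up k (p i \<omega>)..<up k (q i \<omega>)} \<inter> {up k (p j \<omega>)..<up k (q j \<omega>)} = {}"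
      if "i < j" "j < n" for i j using that by fastforce
    then show ?thesis unfolding disjoint_family_on_def
      by (metis Int_commute lessThan_iff linorder_neqE_nat)
  qed
  define \<xi> where "\<xi> k r \<omega> = B (real (Suc r) * \<delta> k) \<omega> - B (real r * \<delta> k) \<omega>" for k r \<omega>
  have tele: "(\<Sum>r\<in>S k \<omega>. \<xi> k r \<omega>) = (\<Sum>i<n. B (up k (q i \<omega>) * \<delta> k) \<omega> - B (up k (p i \<omega>) * \<delta> k) \<omega>)"
    if "\<omega> \<in> space M" "g \<omega> \<noteq> 0" for k \<omega>
  proof -
    have "(\<Sum>r\<in>S k \<omega>. \<xi> k r \<omega>) = (\<Sum>i<n. \<Sum>r=up k (p i \<omega>)..<up k (q i \<omega>). \<xi> k r \<omega>)"
      unfolding S_eq[OF that] using disj[OF that] by (intro sum.UNION_disjoint) (auto simp: disjoint_family_on_def)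
    also have "\<dots> = (\<Sum>i<n. B (up k (q i \<omega>) * \<delta> k) \<omega> - B (up k (p i \<omega>) * \<delta> k) \<omega>)"
    proof (intro sum.cong refl)
      fix i assume "i \<in> {..<n}"
      then have "up k (p i \<omega>) \<le> up k (q i \<omega>)" using ord[OF that, of i] by (intro up_mono) auto
      from sum_Suc_diff'[OF this, of "\<lambda>r. B (real r * \<delta> k) \<omega>"]
      show "(\<Sum>r=up k (p i \<omega>)..<up k (q i \<omega>). \<xi> k r \<omega>)
          = B (up k (q i \<omega>) * \<delta> k) \<omega> - B (up k (p i \<omega>) * \<delta> k) \<omega>"
        by (simp add: \<xi>_def)
    qed
    finally show ?thesis .
  qed
  \<comment> \<open>Rounding changes each of the \<open>n\<close> lengths by at most one cell; the
    total error \<open>n * \<delta> k\<close> vanishes in the limit.\<close>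
  have card: "\<delta> k * card (S k \<omega>) \<le> (\<Sum>i<n. q i \<omega> - p i \<omega>) + n * \<delta> k" if "\<omega> \<in> space M" "g \<omega> \<noteq> 0" for k \<omega>
  proof -
    have "card (S k \<omega>) = (\<Sum>i<n. up k (q i \<omega>) - up k (p i \<omega>))"
      unfolding S_eq[OF that] using disj[OF that]
      by (subst card_UN_disjoint) (auto simp: disjoint_family_on_def)
    then have "\<delta> k * card (S k \<omega>) = (\<Sum>i<n. \<delta> k * real (up k (q i \<omega>) - up k (p i \<omega>)))"
      by (simp add: sum_distrib_left)
    also have "\<dots> \<le> (\<Sum>i<n. (q i \<omega> - p i \<omega>) + \<delta> k)"
    proof (intro sum_mono)
      fix i assume "i \<in> {..<n}"
      then have o: "0 \<le> p i \<omega>" "p i \<omega> \<le> q i \<omega>" using ord[OF that, of i] by auto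
      have "\<delta> k * real (up k (q i \<omega>) - up k (p i \<omega>)) = up k (q i \<omega>) * \<delta> k - up k (p i \<omega>) * \<delta> k"
        using up_mono[OF o(2), of k] by (simp add: of_nat_diff algebra_simps)
      then show "\<delta> k * real (up k (q i \<omega>) - up k (p i \<omega>)) \<le> (q i \<omega> - p i \<omega>) + \<delta> k"
        using up_bounds[of "q i \<omega>" k] up_bounds[of "p i \<omega>" k] o by linarith
    qed
    finally show ?thesis by (simp add: sum.distrib)
  qed
  have Sm: "{\<omega> \<in> space D. r \<in> S k \<omega>} \<in> sets D" for r k
    unfolding S_def using p q by measurable
  have Ss: "S k \<omega> \<subseteq> {..<up k b}" for k \<omega> by (auto simp: S_def)
  define u where "u k \<omega> = g \<omega> * ennreal (exp (c * (\<Sum>r\<in>S k \<omega>. \<xi> k r \<omega>)))" for k \<omega>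
  have u_meas: "u k \<in> borel_measurable M" for k
    unfolding u_def \<xi>_def by (rule exp_grid_increments_indep(1)[OF ind spD g \<delta> Ss Sm])
  have u_int: "(\<integral>\<^sup>+ \<omega>. u k \<omega> \<partial>M)
      = (\<integral>\<^sup>+ \<omega>. g \<omega> * ennreal (exp (c\<^sup>2 * (\<delta> k * card (S k \<omega>)) / 2)) \<partial>M)" for k
    unfolding u_def \<xi>_def by (rule exp_grid_increments_indep(2)[OF ind spD g \<delta> Ss Sm])
  define G where "G \<omega> = g \<omega> * ennreal (exp (c\<^sup>2 / 2 * (\<Sum>i<n. q i \<omega> - p i \<omega>)))" for \<omega>
  have sub: "sets D \<subseteq> events"
    using ind unfolding indep_set_def indep_sets_def by (auto simp: bool.split UNIV_bool)
  have GD: "G \<in> borel_measurable D" unfolding G_def using g p q by measurable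
  have GM: "G \<in> borel_measurable M" using GD sub spD by (auto simp: measurable_def)
  have lim: "AE \<omega> in M. (\<lambda>k. u k \<omega>) \<longlonglongrightarrow> g \<omega> * ennreal (exp (c * (\<Sum>i<n. B (q i \<omega>) \<omega> - B (p i \<omega>) \<omega>)))"
    using AE_continuous AE_space
  proof eventually_elim
    case (elim \<omega>)
    show ?case
    proof (cases "g \<omega> = 0")
      case False
      have B: "(\<lambda>k. B (real (up k t) * \<delta> k) \<omega>) \<longlonglongrightarrow> B t \<omega>" if "0 \<le> t" for t
        using continuous_on_tendsto_compose[OF elim(1) up_lim[OF that]] that \<delta> by (simp add: less_imp_le)
      have "(\<lambda>k. \<Sum>i<n. B (up k (q i \<omega>) * \<delta> k) \<omega> - B (up k (p i \<omega>) * \<delta> k) \<omega>)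
          \<longlonglongrightarrow> (\<Sum>i<n. B (q i \<omega>) \<omega> - B (p i \<omega>) \<omega>)"
      proof (intro tendsto_sum tendsto_diff B)
        fix i assume "i \<in> {..<n}"
        then show "0 \<le> q i \<omega>" "0 \<le> p i \<omega>" using ord[OF elim(2) False, of i] by auto
      qed
      then have l: "(\<lambda>k. exp (c * (\<Sum>r\<in>S k \<omega>. \<xi> k r \<omega>))) \<longlonglongrightarrow> exp (c * (\<Sum>i<n. B (q i \<omega>) \<omega> - B (p i \<omega>) \<omega>))"
        unfolding tele[OF elim(2) False] by (intro tendsto_exp tendsto_mult_left)
      show ?thesis
        unfolding u_def using l
        by (cases "g \<omega> = \<top>")
           (auto intro!: tendsto_mult_ennreal tendsto_ennrealI simp: ennreal_top_mult)
    qed (simp add: u_def)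
  qed
  define h where "h \<omega> = liminf (\<lambda>k. u k \<omega>)" for \<omega>
  have hm: "h \<in> borel_measurable M" unfolding h_def by (intro borel_measurable_liminf u_meas)
  have h_eq: "AE \<omega> in M. h \<omega> = g \<omega> * ennreal (exp (c * (\<Sum>i<n. B (q i \<omega>) \<omega> - B (p i \<omega>) \<omega>)))"
    using lim unfolding h_def by eventually_elim (intro lim_imp_Liminf, auto)
  have "(\<integral>\<^sup>+ \<omega>. h \<omega> \<partial>M) \<le> liminf (\<lambda>k. \<integral>\<^sup>+ \<omega>. u k \<omega> \<partial>M)"
    unfolding h_def by (intro nn_integral_liminf u_meas)
  also have "\<dots> \<le> liminf (\<lambda>k. ennreal (exp (c\<^sup>2 / 2 * (n * \<delta> k))) * (\<integral>\<^sup>+ \<omega>. G \<omega> \<partial>M))"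
  proof (intro Liminf_mono always_eventually allI)
    fix k
    have "(\<integral>\<^sup>+ \<omega>. u k \<omega> \<partial>M) = (\<integral>\<^sup>+ \<omega>. g \<omega> * ennreal (exp (c\<^sup>2 * (\<delta> k * card (S k \<omega>)) / 2)) \<partial>M)"
      by (rule u_int)
    also have "\<dots> \<le> (\<integral>\<^sup>+ \<omega>. ennreal (exp (c\<^sup>2 / 2 * (n * \<delta> k))) * G \<omega> \<partial>M)"
    proof (intro nn_integral_mono)
      fix \<omega> assume "\<omega> \<in> space M"
      show "g \<omega> * ennreal (exp (c\<^sup>2 * (\<delta> k * card (S k \<omega>)) / 2)) \<le> ennreal (exp (c\<^sup>2 / 2 * (n * \<delta> k))) * G \<omega>"
      proof (cases "g \<omega> = 0")
        case False
        have "c\<^sup>2 / 2 * (\<delta> k * card (S k \<omega>)) \<le> c\<^sup>2 / 2 * ((\<Sum>i<n. q i \<omega> - p i \<omega>) + n * \<delta> k)"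
          by (intro mult_left_mono card[OF \<open>\<omega> \<in> space M\<close> False]) auto
        then have "exp (c\<^sup>2 * (\<delta> k * card (S k \<omega>)) / 2)
            \<le> exp (c\<^sup>2 / 2 * (n * \<delta> k)) * exp (c\<^sup>2 / 2 * (\<Sum>i<n. q i \<omega> - p i \<omega>))"
          by (simp add: exp_add[symmetric] algebra_simps)
        then show ?thesis
          unfolding G_def by (simp add: mult.left_commute ennreal_mult[symmetric] mult_left_mono)
      qed simp
    qed
    also have "\<dots> = ennreal (exp (c\<^sup>2 / 2 * (n * \<delta> k))) * (\<integral>\<^sup>+ \<omega>. G \<omega> \<partial>M)"
      by (rule nn_integral_cmult[OF GM])
    finally show "(\<integral>\<^sup>+ \<omega>. u k \<omega> \<partial>M) \<le> ennreal (exp (c\<^sup>2 / 2 * (n * \<delta> k))) * (\<integral>\<^sup>+ \<omega>. G \<omega> \<partial>M)" .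
  qed
  also have "\<dots> = (\<integral>\<^sup>+ \<omega>. G \<omega> \<partial>M)"
  proof -
    have "(\<lambda>k. exp (c\<^sup>2 / 2 * (n * \<delta> k))) \<longlonglongrightarrow> 1" unfolding \<delta>_def by real_asymp
    then have "(\<lambda>k. ennreal (exp (c\<^sup>2 / 2 * (n * \<delta> k)))) \<longlonglongrightarrow> 1"
      using tendsto_ennrealI by fastforce
    then have "(\<lambda>k. ennreal (exp (c\<^sup>2 / 2 * (n * \<delta> k))) * (\<integral>\<^sup>+ \<omega>. G \<omega> \<partial>M)) \<longlonglongrightarrow> 1 * (\<integral>\<^sup>+ \<omega>. G \<omega> \<partial>M)"
      by (rule tendsto_mult_ennreal[OF _ tendsto_const]) simp
    then show ?thesis by (intro lim_imp_Liminf) auto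
  qed
  finally show ?thesis using that[OF hm h_eq] unfolding G_def by blast
qed

section \<open>Oscillation of Brownian motion by chaining\<close>

text \<open>The \<open>R * 2 ^ r\<close> cells of mesh \<open>\<rho> / 2 ^ r\<close> cover
  \<open>[0, R * \<rho>]\<close>; their increments are the links of level \<open>r\<close> in the
  chains below.\<close>

definition incr_max :: "real \<Rightarrow> nat \<Rightarrow> nat \<Rightarrow> 'w \<Rightarrow> real" where
  "incr_max \<rho> R r \<omega> =
     (MAX i\<in>{..<R * 2 ^ r}. \<bar>B (real (Suc i) * (\<rho> / 2 ^ r)) \<omega> - B (real i * (\<rho> / 2 ^ r)) \<omega>\<bar>)"

lemma incr_max_ge:
  assumes "i < R * 2 ^ r"
  shows "\<bar>B (real (Suc i) * (\<rho> / 2 ^ r)) \<omega> - B (real i * (\<rho> / 2 ^ r)) \<omega>\<bar> \<le> incr_max \<rho> R r \<omega>"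
  unfolding incr_max_def using assms by (intro Max_ge) auto

lemma incr_max_nonneg: 
  assumes "0 < R" shows "0 \<le> incr_max \<rho> R r \<omega>"
  using incr_max_ge[of 0 R r \<rho> \<omega>] assms by simp

lemma incr_max_measurable:
  assumes "0 \<le> \<rho>" "0 < R" shows "incr_max \<rho> R r \<in> borel_measurable M"
  unfolding incr_max_def using assms
  by (intro borel_measurable_Max borel_measurable_abs borel_measurable_diff B_measurable) auto

text \<open>Let \<open>Q\<close> be the sum of the exponentials of all increments with both signs,
  and \<open>c\<close> its expectation. The tangent bound
  \<open>s * \<bar>\<xi>\<bar> \<le> ln c + Q / c\<close> holds pointwise for every increment, and
  integrating it gives \<open>(ln c + 1) / s\<close>.\<close>

lemma incr_max_expectation:
  assumes \<rho>: "0 < \<rho>" and R: "0 < R" and s: "0 < s"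
  shows "(\<integral>\<^sup>+ \<omega>. ennreal (incr_max \<rho> R r \<omega>) \<partial>M)
           \<le> ennreal ((ln (2 * real R) + r * ln 2 + s\<^sup>2 * (\<rho> / 2 ^ r) / 2 + 1) / s)"
proof -
  define \<delta> where "\<delta> = \<rho> / 2 ^ r"
  have \<delta>: "\<delta> > 0" using \<rho> by (simp add: \<delta>_def)
  define c where "c = 2 * real R * 2 ^ r * exp (s\<^sup>2 * \<delta> / 2)"
  have c: "c > 0" using R by (simp add: c_def)
  define I where "I = {..<R * 2 ^ r}"
  have "0 \<in> I" using R by (simp add: I_def)
  then have I: "finite I" "I \<noteq> {}" unfolding I_def by blast+
  define \<xi> where "\<xi> i \<omega> = B (real (Suc i) * \<delta>) \<omega> - B (real i * \<delta>) \<omega>" for i \<omega>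
  have \<xi>m: "\<xi> i \<in> borel_measurable M" for i
    unfolding \<xi>_def using \<delta> by (intro borel_measurable_diff B_measurable) auto
  have mgf: "(\<integral>\<^sup>+ \<omega>. ennreal (exp (t * \<xi> i \<omega>)) \<partial>M) = ennreal (exp (t\<^sup>2 * \<delta> / 2))" for t i
    unfolding \<xi>_def using \<delta> by (subst increment_mgf) (auto simp: algebra_simps)
  define Q where "Q \<omega> = (\<Sum>i\<in>I. exp (s * \<xi> i \<omega>) + exp (- s * \<xi> i \<omega>))" for \<omega>
  have Qm: "Q \<in> borel_measurable M" unfolding Q_def using \<xi>m by measurable
  have "(\<integral>\<^sup>+ \<omega>. ennreal (Q \<omega>) \<partial>M)
      = (\<Sum>i\<in>I. (\<integral>\<^sup>+ \<omega>. ennreal (exp (s * \<xi> i \<omega>)) \<partial>M) + (\<integral>\<^sup>+ \<omega>. ennreal (exp (- s * \<xi> i \<omega>)) \<partial>M))"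
    unfolding Q_def using \<xi>m
    by (subst sum_ennreal[symmetric], simp, subst nn_integral_sum) 
       (auto simp: nn_integral_add)
  also have "\<dots> = (\<Sum>i\<in>I. ennreal (2 * exp (s\<^sup>2 * \<delta> / 2)))"
    unfolding mgf by (intro sum.cong) (auto simp: ennreal_plus[symmetric] simp del: ennreal_plus)
  also have "\<dots> = ennreal c"
    by (simp add: I_def c_def ennreal_of_nat_eq_real_of_nat ennreal_mult[symmetric] mult_ac)
  finally have EQ: "(\<integral>\<^sup>+ \<omega>. ennreal (Q \<omega>) \<partial>M) = ennreal c" .
  have Q0: "0 \<le> Q \<omega>" for \<omega> unfolding Q_def by (intro sum_nonneg) (simp add: add_nonneg_nonneg)
  have bound: "incr_max \<rho> R r \<omega> \<le> (ln c + Q \<omega> / c) / s" for \<omega>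
  proof -
    have "\<bar>\<xi> i \<omega>\<bar> \<le> (ln c + Q \<omega> / c) / s" if "i \<in> I" for i
    proof -
      have "exp (s * \<bar>\<xi> i \<omega>\<bar>) \<le> exp (s * \<xi> i \<omega>) + exp (- s * \<xi> i \<omega>)"
        by (cases "0 \<le> \<xi> i \<omega>") auto
      also have "\<dots> \<le> Q \<omega>"
        unfolding Q_def using that I by (intro member_le_sum) (auto simp: add_nonneg_nonneg)
      finally have 1: "exp (s * \<bar>\<xi> i \<omega>\<bar>) \<le> Q \<omega>" .
      have "1 + (s * \<bar>\<xi> i \<omega>\<bar> - ln c) \<le> exp (s * \<bar>\<xi> i \<omega>\<bar> - ln c)" by (rule exp_ge_add_one_self)
      also have "\<dots> \<le> Q \<omega> / c" using 1 c by (simp add: exp_diff divide_right_mono)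
      finally show ?thesis using s by (simp add: field_simps)
    qed
    then show ?thesis
      unfolding incr_max_def \<delta>_def[symmetric] \<xi>_def[symmetric] I_def[symmetric] using I by simp
  qed
  have lnc: "ln c = ln (2 * real R) + r * ln 2 + s\<^sup>2 * \<delta> / 2"
    using R by (simp add: c_def ln_mult ln_realpow)
  have lnc0: "0 \<le> ln c"
    unfolding lnc using R \<delta> by (intro add_nonneg_nonneg) (auto intro!: ln_ge_zero)
  have "(\<integral>\<^sup>+ \<omega>. ennreal (incr_max \<rho> R r \<omega>) \<partial>M) \<le> (\<integral>\<^sup>+ \<omega>. ennreal (ln c / s) + ennreal (1 / (c * s)) * ennreal (Q \<omega>) \<partial>M)"
  proof (intro nn_integral_mono)
    fix \<omega>
    have "ennreal (incr_max \<rho> R r \<omega>) \<le> ennreal (ln c / s + 1 / (c * s) * Q \<omega>)"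
      using bound[of \<omega>] by (intro ennreal_leI) (simp add: add_divide_distrib)
    then show "ennreal (incr_max \<rho> R r \<omega>) \<le> ennreal (ln c / s) + ennreal (1 / (c * s)) * ennreal (Q \<omega>)"
      using lnc0 s c Q0 by (simp add: ennreal_plus ennreal_mult'[symmetric])
  qed
  also have "\<dots> = ennreal (ln c / s) + ennreal (1 / (c * s)) * ennreal c"
    using Qm by (simp add: nn_integral_add nn_integral_cmult EQ emeasure_space_1)
  also have "\<dots> = ennreal ((ln c + 1) / s)"
    using lnc0 s c by (simp add: ennreal_mult[symmetric] ennreal_plus[symmetric] add_divide_distrib del: ennreal_plus)
  finally show ?thesis unfolding lnc \<delta>_def .
qed

text \<open>As a sum in \<open>ennreal\<close> it is measurable without any question of convergence;
  its finiteness is later drawn from its expectation.\<close>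

definition osc :: "real \<Rightarrow> nat \<Rightarrow> 'w \<Rightarrow> ennreal" where
  "osc \<rho> R \<omega> = (\<Sum>r. ennreal (incr_max \<rho> R r \<omega>))"

lemma osc_measurable:
  assumes "0 \<le> \<rho>" "0 < R" shows "osc \<rho> R \<in> borel_measurable M"
  unfolding osc_def using incr_max_measurable[OF assms] by measurable

definition osc_const :: real where
  "osc_const = (\<Sum>r. sqrt (1 / 2) ^ r * (1 + real r))"

lemma osc_const: "summable (\<lambda>r. sqrt (1 / 2) ^ r * (1 + real r))" "0 \<le> osc_const"
proof -
  have *: "sqrt (1 / 2) < 1" by simp
  show 1: "summable (\<lambda>r. sqrt (1 / 2) ^ r * (1 + real r))"
    using geometric_deriv_sums[of "sqrt (1/2)"] by (auto simp: sums_iff mult.commute add.commute)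
  show "0 \<le> osc_const" unfolding osc_const_def using 1 by (intro suminf_nonneg) auto
qed

lemma osc_expectation:
  assumes \<rho>: "0 < \<rho>" and R: "0 < R" and m: "0 < m"
  shows "(\<integral>\<^sup>+ \<omega>. osc \<rho> R \<omega> \<partial>M) \<le> ennreal (osc_const * (ln (2 * real R) + m * \<rho> / 2 + 1) / sqrt m)"
proof -
  define \<kappa> where "\<kappa> = ln (2 * real R) + m * \<rho> / 2 + 1"
  have \<kappa>: "1 \<le> \<kappa>" unfolding \<kappa>_def using R \<rho> m by (auto intro!: add_nonneg_nonneg ln_ge_zero)
  have "(\<integral>\<^sup>+ \<omega>. osc \<rho> R \<omega> \<partial>M) = (\<Sum>r. \<integral>\<^sup>+ \<omega>. ennreal (incr_max \<rho> R r \<omega>) \<partial>M)"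
    unfolding osc_def using incr_max_measurable \<rho> R by (intro nn_integral_suminf) auto
  also have "\<dots> \<le> (\<Sum>r. ennreal (\<kappa> / sqrt m * (sqrt (1 / 2) ^ r * (1 + real r))))"
  proof (intro suminf_le summableI)
    fix r
    \<comment> \<open>With \<open>s\<^sup>2 = m * 2 ^ r\<close> the variance term is the same at all
      levels, while the factor \<open>1 / s\<close> supplies the geometric decay
      \<open>sqrt (1 / 2) ^ r\<close>.\<close>
    define s where "s = sqrt (m * 2 ^ r)"
    have s: "0 < s" "s\<^sup>2 = m * 2 ^ r" using m by (simp_all add: s_def)
    have "(\<integral>\<^sup>+ \<omega>. ennreal (incr_max \<rho> R r \<omega>) \<partial>M)
        \<le> ennreal ((ln (2 * real R) + r * ln 2 + s\<^sup>2 * (\<rho> / 2 ^ r) / 2 + 1) / s)"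
      by (rule incr_max_expectation[OF \<rho> R s(1)])
    also have "\<dots> \<le> ennreal (\<kappa> / sqrt m * (sqrt (1 / 2) ^ r * (1 + real r)))"
    proof (rule ennreal_leI)
      have "s\<^sup>2 * (\<rho> / 2 ^ r) / 2 = m * \<rho> / 2" using s by simp
      then have "ln (2 * real R) + r * ln 2 + s\<^sup>2 * (\<rho> / 2 ^ r) / 2 + 1 = \<kappa> + r * ln 2" by (simp add: \<kappa>_def)
      also have "\<dots> \<le> \<kappa> + r * \<kappa>" using \<kappa> ln_less_self[of 2] ln_2_less_1 by (intro add_mono mult_left_mono) auto
      also have "\<dots> = \<kappa> * (1 + real r)" by (simp add: algebra_simps)
      finally have "(ln (2 * real R) + r * ln 2 + s\<^sup>2 * (\<rho> / 2 ^ r) / 2 + 1) / s \<le> \<kappa> * (1 + real r) / s"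
        using s by (intro divide_right_mono) auto
      also have "\<dots> = \<kappa> / sqrt m * (sqrt (1 / 2) ^ r * (1 + real r))"
        by (simp add: s_def real_sqrt_mult real_sqrt_power real_sqrt_divide power_divide)
      finally show "(ln (2 * real R) + r * ln 2 + s\<^sup>2 * (\<rho> / 2 ^ r) / 2 + 1) / s
          \<le> \<kappa> / sqrt m * (sqrt (1 / 2) ^ r * (1 + real r))" .
    qed
    finally show "(\<integral>\<^sup>+ \<omega>. ennreal (incr_max \<rho> R r \<omega>) \<partial>M)
        \<le> ennreal (\<kappa> / sqrt m * (sqrt (1 / 2) ^ r * (1 + real r)))" .
  qed
  also have "\<dots> = ennreal (\<kappa> / sqrt m * osc_const)"
    unfolding osc_const_def suminf_mult[OF osc_const(1), symmetric]
    using summable_mult[OF osc_const(1)] \<kappa> m by (intro suminf_ennreal2) auto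
  finally show ?thesis by (simp add: \<kappa>_def mult.commute)
qed

text \<open>Each point is joined to its grid point of mesh \<open>\<rho>\<close> by a dyadic chain
  with at most one link per level, so a chain costs at most \<open>osc\<close>; between the two grid
  points lie at most \<open>J\<close> cells. Continuity identifies the limit of the chain with the
  value at the point.\<close>

lemma osc_bound:
  assumes cont: "continuous_on {0..} (\<lambda>t. B t \<omega>)" and \<rho>: "0 < \<rho>" and R: "0 < R"
    and fin: "osc \<rho> R \<omega> < \<top>"
    and uv: "0 \<le> u" "u \<le> R * \<rho>" "0 \<le> v" "v \<le> R * \<rho>" "\<bar>u - v\<bar> \<le> real J * \<rho>"
  shows "\<bar>B u \<omega> - B v \<omega>\<bar> \<le> real (J + 3) * enn2real (osc \<rho> R \<omega>)"
proof -
  define H where "H = enn2real (osc \<rho> R \<omega>)"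
  have nn: "0 \<le> incr_max \<rho> R r \<omega>" for r by (rule incr_max_nonneg[OF R])
  have sm: "summable (\<lambda>r. incr_max \<rho> R r \<omega>)"
    using fin nn unfolding osc_def by (intro summable_suminf_not_top) auto
  have H_eq: "H = (\<Sum>r. incr_max \<rho> R r \<omega>)"
    unfolding H_def osc_def using sm nn by (subst suminf_ennreal2) (auto intro!: enn2real_ennreal suminf_nonneg)
  have part: "(\<Sum>r\<in>A. incr_max \<rho> R r \<omega>) \<le> H" if "finite A" for A
    unfolding H_eq using sm nn that by (intro sum_le_suminf) auto
  define b where "b t = B t \<omega>" for t
  define a where "a r x = nat \<lfloor>x / (\<rho> / 2 ^ r)\<rfloor>" for r :: nat and x
  define X where "X r x = real (a r x) * (\<rho> / 2 ^ r)" for r x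
  have near: "\<bar>b x - b (X 0 x)\<bar> \<le> H" and le: "a 0 x \<le> R" and X0: "X 0 x \<le> x" "x < X 0 x + \<rho>"
    if x: "0 \<le> x" "x \<le> R * \<rho>" for x
  proof -
    have fl: "X r x \<le> x \<and> x < X r x + \<rho> / 2 ^ r" for r
    proof -
      define d where "d = \<rho> / 2 ^ r"
      have d: "d > 0" using \<rho> by (simp add: d_def)
      have "0 \<le> x / d" using x d by simp
      then have "real (a r x) = of_int \<lfloor>x / d\<rfloor>"
        unfolding a_def d_def[symmetric] by (intro of_nat_nat) simp
      moreover have "of_int \<lfloor>x / d\<rfloor> \<le> x / d" "x / d < of_int \<lfloor>x / d\<rfloor> + 1" by linarith+
      ultimately have "real (a r x) \<le> x / d" "x / d < real (a r x) + 1" by simp_all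
      then have "real (a r x) * d \<le> x" "x < (real (a r x) + 1) * d"
        using d by (simp_all only: pos_le_divide_eq pos_divide_less_eq)
      then show ?thesis by (simp add: X_def d_def[symmetric] distrib_right)
    qed
    then show "X 0 x \<le> x" "x < X 0 x + \<rho>" using fl[of 0] by simp_all
    have aR: "a r x \<le> R * 2 ^ r" for r
    proof -
      have "x / (\<rho> / 2 ^ r) \<le> R * 2 ^ r" using x \<rho> by (simp add: field_simps)
      then have "\<lfloor>x / (\<rho> / 2 ^ r)\<rfloor> \<le> \<lfloor>real (R * 2 ^ r)\<rfloor>" by (intro floor_mono) simp
      then show ?thesis unfolding a_def by (simp add: nat_le_iff del: of_nat_mult of_nat_power)
    qed
    then show "a 0 x \<le> R" by (metis mult.right_neutral power_0)
    have step: "\<bar>b (X (Suc r) x) - b (X r x)\<bar> \<le> incr_max \<rho> R (Suc r) \<omega>" for r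
    proof -
      define y where "y = x / (\<rho> / 2 ^ r)"
      have y: "x / (\<rho> / 2 ^ Suc r) = 2 * y" "0 \<le> y" using x \<rho> by (simp_all add: y_def)
      \<comment> \<open>Halving the mesh doubles the index \<open>a r x\<close> and possibly adds
        one. In the first case the grid point does not move; in the second the link is the cell
        \<open>2 * a r x\<close> of level \<open>Suc r\<close>.\<close>
      have "\<lfloor>2 * y\<rfloor> = 2 * \<lfloor>y\<rfloor> \<or> \<lfloor>2 * y\<rfloor> = 2 * \<lfloor>y\<rfloor> + 1" by linarith
      then have "a (Suc r) x = 2 * a r x \<or> a (Suc r) x = Suc (2 * a r x)"
        unfolding a_def y(1) y_def[symmetric] using y(2) by (auto simp: nat_mult_distrib nat_add_distrib)
      then show ?thesis
      proof
        assume "a (Suc r) x = 2 * a r x"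
        then have "X (Suc r) x = X r x" by (simp add: X_def)
        then show ?thesis using nn by simp
      next
        assume e: "a (Suc r) x = Suc (2 * a r x)"
        then have "2 * a r x < R * 2 ^ Suc r" using aR[of "Suc r"] by linarith
        from incr_max_ge[OF this, of \<rho> \<omega>] show ?thesis
          unfolding X_def e b_def by simp
      qed
    qed
    have tele: "\<bar>b (X n x) - b (X 0 x)\<bar> \<le> (\<Sum>r<n. incr_max \<rho> R (Suc r) \<omega>)" for n
    proof (induction n)
      case (Suc n) then show ?case using step[of n] by simp
    qed simp
    have "(\<Sum>r<n. incr_max \<rho> R (Suc r) \<omega>) \<le> H" for n
      using part[of "Suc ` {..<n}"] by (simp add: sum.reindex)
    then have bd: "\<bar>b (X n x) - b (X 0 x)\<bar> \<le> H" for n using tele order_trans by blast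
    have "(\<lambda>r. X r x) \<longlonglongrightarrow> x"
    proof (rule tendsto_sandwich[of "\<lambda>r. x - \<rho> / 2 ^ r" _ _ "\<lambda>_. x"])
      have "(\<lambda>r. \<rho> / 2 ^ r) \<longlonglongrightarrow> 0" by real_asymp
      then show "(\<lambda>r. x - \<rho> / 2 ^ r) \<longlonglongrightarrow> x" using tendsto_diff[OF tendsto_const[of x]] by force
    qed (use fl in \<open>auto intro!: always_eventually simp: less_imp_le diff_le_eq\<close>)
    then have "(\<lambda>r. b (X r x)) \<longlonglongrightarrow> b x"
      unfolding b_def using continuous_on_tendsto_compose[OF cont, of "\<lambda>r. X r x" x] x \<rho> by (simp add: X_def)
    then have "(\<lambda>r. \<bar>b (X r x) - b (X 0 x)\<bar>) \<longlonglongrightarrow> \<bar>b x - b (X 0 x)\<bar>" by (intro tendsto_intros)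
    then show "\<bar>b x - b (X 0 x)\<bar> \<le> H" using bd by (intro LIMSEQ_le_const2) auto
  qed
  have H0: "0 \<le> H" by (simp add: H_def)
  have coarse: "\<bar>b (real j * \<rho>) - b (real i * \<rho>)\<bar> \<le> real (j - i) * H" if "i \<le> j" "j \<le> R" for i j
    using that
  proof (induction j rule: dec_induct)
    case (step j)
    have "\<bar>b (real (Suc j) * \<rho>) - b (real j * \<rho>)\<bar> \<le> incr_max \<rho> R 0 \<omega>"
      using incr_max_ge[of j R 0 \<rho> \<omega>] step by (simp add: b_def)
    also have "\<dots> \<le> H" using part[of "{0}"] by simp
    finally show ?case using step by (simp add: Suc_diff_le algebra_simps)
  qed simp
  have *: "\<bar>b u - b v\<bar> \<le> real (J + 3) * H"
    if "0 \<le> u" "u \<le> R * \<rho>" "v \<le> R * \<rho>" "v - u \<le> real J * \<rho>" "u \<le> v" for u v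
  proof -
    have v: "0 \<le> v" using that by simp
    have "u / (\<rho> / 2 ^ 0) \<le> v / (\<rho> / 2 ^ 0)" using that \<rho> by (simp add: divide_right_mono)
    then have au: "a 0 u \<le> a 0 v" unfolding a_def by (intro nat_mono floor_mono)
    have "X 0 v < X 0 u + (real J + 1) * \<rho>" 
      using X0[of u] X0[of v] that v by (simp add: distrib_right)
    then have "real (a 0 v) < real (a 0 u) + real J + 1"
      using \<rho> by (simp add: X_def distrib_right[symmetric] add.assoc)
    then have "a 0 v - a 0 u \<le> J" using au by linarith
    then have "\<bar>b (X 0 v) - b (X 0 u)\<bar> \<le> real J * H"
      using coarse[OF au le[of v]] that v H0 unfolding X_def
      by (smt (verit) div_by_1 mult_right_mono of_nat_mono power_0)
    then show ?thesis using near[of u] near[of v] that v H0 by (simp add: distrib_right)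
  qed
  show ?thesis
    using *[of u v] *[of v u] uv unfolding b_def H_def by (cases "u \<le> v") (auto simp: abs_minus_commute)
qed

end

subsection \<open>The random measure\<close>

lemma image_ereal_borel: 
  assumes "A \<in> sets borel" shows "ereal ` A \<in> sets borel"
proof -
  have "ereal ` A = {x \<in> space borel. real_of_ereal x \<in> A \<and> x \<noteq> \<infinity> \<and> x \<noteq> -\<infinity>}" (is "_ = ?R")
  proof (intro set_eqI)
    show "x \<in> ereal ` A \<longleftrightarrow> x \<in> ?R" for x by (cases x) auto
  qed
  also have "\<dots> \<in> sets borel" using assms by measurable
  finally show ?thesis .
qed

text \<open>For \<open>\<theta> = 0\<close> the point mass at infinity lies outside the image and
  the right-hand side is zero too, so one formula covers both kinds of atoms.\<close>

lemma ext_exponential_atLeastAtMost_0: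
  assumes "0 \<le> \<theta>" "0 \<le> l"
  shows "emeasure (ext_exponential \<theta>) (ereal ` {0..l}) = ennreal (1 - exp (- \<theta> * l))"
proof (cases "\<theta> = 0")
  case True
  moreover have "\<infinity> \<notin> ereal ` {0..l}" by auto
  ultimately show ?thesis using image_ereal_borel[of "{0..l}"] by (simp add: ext_exponential_def)
next
  case False
  with assms have \<theta>: "0 < \<theta>" by simp
  interpret E: prob_space "density lborel (exponential_density \<theta>)"
    by (rule prob_space_exponential_density[OF \<theta>])
  have d: "distributed (density lborel (exponential_density \<theta>)) lborel (\<lambda>x. x) (exponential_density \<theta>)"
    unfolding distributed_def by (simp add: distr_id2)
  have "emeasure (ext_exponential \<theta>) (ereal ` {0..l}) = emeasure (density lborel (exponential_density \<theta>)) {0..l}"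
  proof -
    have "ereal -` ereal ` {0..l} = {0..l}" by (rule inj_vimage_image_eq) (simp add: inj_def)
    then show ?thesis
      using \<theta> image_ereal_borel[of "{0..l}"] by (simp add: ext_exponential_def emeasure_distr)
  qed
  also have "\<dots> = emeasure (density lborel (exponential_density \<theta>)) {..l}"
    by (simp add: emeasure_density) (auto intro!: nn_integral_cong simp: exponential_density_def indicator_def)
  also have "\<dots> = ennreal (1 - exp (- \<theta> * l))"
    using E.exponential_distributedD_le[OF d assms(2) \<theta>]
    by (simp add: E.emeasure_eq_measure atMost_def mult.commute)
  finally show ?thesis .
qed

locale icrt_space = prob_space M for M :: "'w measure" +
  fixes \<theta> :: "nat \<Rightarrow> real" and X :: "nat \<Rightarrow> 'w \<Rightarrow> ereal" and Y Z :: "nat \<Rightarrow> 'w \<Rightarrow> real"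
  assumes \<theta>_nonneg: "\<And>i. 0 \<le> \<theta> i" and \<theta>_sums: "(\<lambda>i. (\<theta> i)\<^sup>2) sums 1"
    and data: "icrt_data M \<theta> X Y Z"
begin

definition mu :: "'w \<Rightarrow> real measure" where "mu \<omega> = icrt_mu \<theta> (\<lambda>i. X i \<omega>)"

lemma data_facts:
  shows X_indep: "indep_vars (\<lambda>_. borel) X {1..}"
    and X_distr: "\<And>i. 1 \<le> i \<Longrightarrow> distr M borel (X i) = ext_exponential (\<theta> i)"
    and Y_meas: "\<And>i. Y i \<in> borel_measurable M" and Z_meas: "\<And>i. Z i \<in> borel_measurable M"
    and Z_0: "AE \<omega> in M. Z 0 \<omega> = 0"
    and Y_points: "cond_poisson_points M (measure_algebra M mu) Y (\<lambda>\<omega> l. measure (mu \<omega>) {0..l})"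
    and Z_laws: "cond_indep_laws M (measure_points_algebra M mu Y) Z
         (\<lambda>i \<omega>. uniform_measure (mu \<omega>) {0..Y i \<omega>})"
  using data unfolding icrt_data_def Let_def mu_def[abs_def] by blast+

lemma X_meas: "1 \<le> i \<Longrightarrow> X i \<in> borel_measurable M"
  using X_indep unfolding indep_vars_def by auto

lemma X_event:
  assumes "1 \<le> i" "A \<in> sets borel" shows "{\<omega> \<in> space M. X i \<omega> \<in> ereal ` A} \<in> events"
proof -
  have "{\<omega> \<in> space M. X i \<omega> \<in> ereal ` A} = X i -` (ereal ` A) \<inter> space M" by blast
  then show ?thesis using measurable_sets[OF X_meas[OF assms(1)] image_ereal_borel[OF assms(2)]] by simp
qed

lemma sets_mu [simp, measurable_cong]: "sets (mu \<omega>) = sets borel"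
  by (simp add: mu_def)

lemma space_mu [simp]: "space (mu \<omega>) = UNIV"
  by (simp add: mu_def icrt_mu_def)

lemma mu_meas_of_X:
  assumes X: "\<And>i. 1 \<le> i \<Longrightarrow> X i \<in> borel_measurable N" and A: "A \<in> sets borel"
  shows "(\<lambda>\<omega>. emeasure (mu \<omega>) A) \<in> borel_measurable N"
proof -
  have "(\<lambda>\<omega>. indicator (ereal ` A) (X (Suc i) \<omega>) :: ennreal) \<in> borel_measurable N" for i
    using image_ereal_borel[OF A] by (intro measurable_compose[OF X borel_measurable_indicator]) auto
  then show ?thesis unfolding mu_def emeasure_icrt_mu[OF A] by simp
qed

lemma mu_meas: "A \<in> sets borel \<Longrightarrow> (\<lambda>\<omega>. emeasure (mu \<omega>) A) \<in> borel_measurable M"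
  by (rule mu_meas_of_X[OF X_meas])

section \<open>Mean mass, finiteness and measurability\<close>

definition mean :: "real \<Rightarrow> real" where
  "mean l = (LINT \<omega>|M. measure (mu \<omega>) {0..l})"

lemma X_prob:
  assumes "0 \<le> l"
  shows "emeasure M {\<omega> \<in> space M. X (Suc i) \<omega> \<in> ereal ` {0..l}} = ennreal (1 - exp (- \<theta> (Suc i) * l))"
proof -
  have "emeasure M {\<omega> \<in> space M. X (Suc i) \<omega> \<in> ereal ` {0..l}}
      = emeasure (distr M borel (X (Suc i))) (ereal ` {0..l})"
    using image_ereal_borel[of "{0..l}"] X_meas
    by (subst emeasure_distr) (auto intro!: arg_cong[where f = "emeasure M"])
  then show ?thesis
    using X_distr[of "Suc i"] ext_exponential_atLeastAtMost_0[OF \<theta>_nonneg assms] by simp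
qed

lemma summable_\<theta>: "summable (\<lambda>i. (\<theta> (Suc i))\<^sup>2)" and suminf_\<theta>: "(\<theta> 0)\<^sup>2 + (\<Sum>i. (\<theta> (Suc i))\<^sup>2) = 1"
proof -
  have s: "summable (\<lambda>i. (\<theta> i)\<^sup>2)" using \<theta>_sums by (simp add: sums_iff)
  then show "summable (\<lambda>i. (\<theta> (Suc i))\<^sup>2)" by (subst summable_Suc_iff)
  show "(\<theta> 0)\<^sup>2 + (\<Sum>i. (\<theta> (Suc i))\<^sup>2) = 1"
    using suminf_split_head[OF s] \<theta>_sums by (simp add: sums_iff)
qed

text \<open>The expected contribution of the atom at \<open>X (Suc i)\<close> to the mass of
  \<open>[0, l]\<close>.\<close>

definition mean_coeff :: "real \<Rightarrow> nat \<Rightarrow> real" where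
  "mean_coeff l i = \<theta> (Suc i) * (1 - exp (- \<theta> (Suc i) * l))"

text \<open>The sum of the \<open>\<theta> i\<close> may diverge;
  \<open>1 - exp (- x) \<le> x\<close> gains a second factor \<open>\<theta> (Suc i)\<close>, so
  that square summability suffices.\<close>

lemma mean_coeff:
  assumes "0 \<le> l"
  shows "0 \<le> mean_coeff l i" "mean_coeff l i \<le> (\<theta> (Suc i))\<^sup>2 * l" "summable (mean_coeff l)"
proof -
  have t: "0 \<le> \<theta> (Suc i) * l" for i using \<theta>_nonneg[of "Suc i"] assms by simp
  have *: "0 \<le> mean_coeff l i" for i
  proof -
    have "exp (- \<theta> (Suc i) * l) \<le> 1"
      using t[of i] by (simp only: exp_le_one_iff mult_minus_left neg_le_0_iff_le)
    then have "0 \<le> 1 - exp (- \<theta> (Suc i) * l)" by linarith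
    then show ?thesis
      unfolding mean_coeff_def by (intro mult_nonneg_nonneg \<theta>_nonneg)
  qed
  have **: "mean_coeff l i \<le> (\<theta> (Suc i))\<^sup>2 * l" for i
  proof -
    have "1 - exp (- \<theta> (Suc i) * l) \<le> \<theta> (Suc i) * l"
      using exp_ge_add_one_self[of "- \<theta> (Suc i) * l"] by simp
    from mult_left_mono[OF this \<theta>_nonneg[of "Suc i"]]
    show ?thesis by (simp add: mean_coeff_def power2_eq_square mult.assoc)
  qed
  show "0 \<le> mean_coeff l i" "mean_coeff l i \<le> (\<theta> (Suc i))\<^sup>2 * l" by (rule * **)+
  show "summable (mean_coeff l)"
  proof (rule summable_comparison_test')
    show "summable (\<lambda>i. (\<theta> (Suc i))\<^sup>2 * l)" by (rule summable_mult2[OF summable_\<theta>])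
    show "norm (mean_coeff l i) \<le> (\<theta> (Suc i))\<^sup>2 * l" if "0 \<le> i" for i
      using *[of i] **[of i] by simp
  qed
qed

lemma nn_mean:
  assumes "0 \<le> l"
  shows "(\<integral>\<^sup>+ \<omega>. emeasure (mu \<omega>) {0..l} \<partial>M) = ennreal ((\<theta> 0)\<^sup>2 * l + (\<Sum>i. mean_coeff l i))"
proof -
  have m: "(\<lambda>\<omega>. indicator (ereal ` {0..l}) (X (Suc i) \<omega>) :: ennreal) \<in> borel_measurable M" for i
    using image_ereal_borel[of "{0..l}"] by (intro measurable_compose[OF X_meas borel_measurable_indicator]) auto
  have i: "(\<integral>\<^sup>+ \<omega>. indicator (ereal ` {0..l}) (X (Suc i) \<omega>) \<partial>M) = ennreal (1 - exp (- \<theta> (Suc i) * l))" for i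
  proof -
    have "(\<integral>\<^sup>+ \<omega>. indicator (ereal ` {0..l}) (X (Suc i) \<omega>) \<partial>M)
        = (\<integral>\<^sup>+ \<omega>. indicator {\<omega> \<in> space M. X (Suc i) \<omega> \<in> ereal ` {0..l}} \<omega> \<partial>M)"
      by (intro nn_integral_cong) (auto simp: indicator_def)
    also have "\<dots> = emeasure M {\<omega> \<in> space M. X (Suc i) \<omega> \<in> ereal ` {0..l}}"
      by (intro nn_integral_indicator X_event) auto
    finally show ?thesis using X_prob[OF assms] by simp
  qed
  have "(\<integral>\<^sup>+ \<omega>. emeasure (mu \<omega>) {0..l} \<partial>M)
      = ennreal ((\<theta> 0)\<^sup>2 * l) + (\<Sum>i. ennreal (\<theta> (Suc i)) * ennreal (1 - exp (- \<theta> (Suc i) * l)))"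
    unfolding mu_def using assms m
    by (simp add: emeasure_icrt_mu nn_integral_add nn_integral_suminf nn_integral_cmult i ennreal_mult[symmetric]
        emeasure_space_1)
  also have "(\<Sum>i. ennreal (\<theta> (Suc i)) * ennreal (1 - exp (- \<theta> (Suc i) * l))) = (\<Sum>i. ennreal (mean_coeff l i))"
    using \<theta>_nonneg assms by (simp add: mean_coeff_def ennreal_mult[symmetric])
  also have "\<dots> = ennreal (\<Sum>i. mean_coeff l i)"
    using mean_coeff[OF assms] by (intro suminf_ennreal2) auto
  finally show ?thesis using assms mean_coeff[OF assms] by (simp add: ennreal_plus suminf_nonneg)
qed

lemma mean_bound:
  assumes "0 \<le> l" shows "(\<theta> 0)\<^sup>2 * l + (\<Sum>i. mean_coeff l i) \<le> l"
proof -
  have "(\<Sum>i. mean_coeff l i) \<le> (\<Sum>i. (\<theta> (Suc i))\<^sup>2 * l)"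
    using mean_coeff[OF assms] summable_\<theta> by (intro suminf_le summable_mult2) auto
  also have "\<dots> = (\<Sum>i. (\<theta> (Suc i))\<^sup>2) * l" by (rule suminf_mult2[OF summable_\<theta>, symmetric])
  finally have "(\<theta> 0)\<^sup>2 * l + (\<Sum>i. mean_coeff l i) \<le> ((\<theta> 0)\<^sup>2 + (\<Sum>i. (\<theta> (Suc i))\<^sup>2)) * l"
    by (simp only: distrib_right add_left_mono)
  then show ?thesis by (simp only: suminf_\<theta> mult_1)
qed

lemma AE_finite: "AE \<omega> in M. \<forall>n::nat. emeasure (mu \<omega>) {0..real n} < \<infinity>"
  unfolding AE_all_countable
proof
  fix n :: nat
  have "AE \<omega> in M. emeasure (mu \<omega>) {0..real n} \<noteq> \<infinity>"
    using nn_mean[of "real n"] by (intro nn_integral_noteq_infinite mu_meas) auto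
  then show "AE \<omega> in M. emeasure (mu \<omega>) {0..real n} < \<infinity>" by (simp add: less_top)
qed

text \<open>Integer end points control all bounded intervals by monotonicity, and being countably
  many they keep this event in every sigma-algebra that sees the masses.\<close>

definition good :: "'w set" where
  "good = {\<omega> \<in> space M. \<forall>n::nat. emeasure (mu \<omega>) {0..real n} < \<infinity>}"

text \<open>
  \<open>nu\<close> is a version of \<open>mu\<close> that is finite on bounded sets everywhere; this makes the masses of random
  intervals measurable with respect to the sigma-algebras generated by \<open>mu\<close>.
\<close>

definition nu :: "'w \<Rightarrow> real measure" where
  "nu \<omega> = (if \<omega> \<in> good then mu \<omega> else null_measure borel)"

definition W :: "'w \<Rightarrow> real \<Rightarrow> real" where "W \<omega> l = measure (nu \<omega>) {0..l}"

lemma AE_good: "AE \<omega> in M. \<omega> \<in> good"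
  using AE_finite AE_space unfolding good_def by eventually_elim auto

lemma sets_nu [simp, measurable_cong]: "sets (nu \<omega>) = sets borel"
  by (simp add: nu_def)

lemma space_nu [simp]: "space (nu \<omega>) = UNIV"
  by (simp add: nu_def)

lemma nu_finite: "emeasure (nu \<omega>) ({0..l} \<inter> A) < \<infinity>"
proof (cases "\<omega> \<in> good")
  case True
  obtain n where "l \<le> real n" using real_arch_simple by blast
  then have "emeasure (mu \<omega>) ({0..l} \<inter> A) \<le> emeasure (mu \<omega>) {0..real n}"
    by (intro emeasure_mono) auto
  also have "\<dots> < \<infinity>" using True by (simp add: good_def)
  finally show ?thesis using True by (simp add: nu_def)
qed (simp add: nu_def)

lemma emeasure_nu: "emeasure (nu \<omega>) {0..l} = ennreal (W \<omega> l)"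
  using nu_finite[of \<omega> l UNIV] by (simp add: W_def emeasure_eq_ennreal_measure)

lemma W_nonneg: "0 \<le> W \<omega> l" by (simp add: W_def)

lemma W_mono: "l \<le> l' \<Longrightarrow> W \<omega> l \<le> W \<omega> l'"
  using emeasure_mono[of "{0..l}" "{0..l'}" "nu \<omega>"] W_nonneg by (simp add: emeasure_nu)

lemma nu_Ioc:
  assumes "0 \<le> l" "l \<le> l'" shows "emeasure (nu \<omega>) {l<..l'} = ennreal (W \<omega> l' - W \<omega> l)"
proof -
  have "emeasure (nu \<omega>) ({0..l'} - {0..l}) = emeasure (nu \<omega>) {0..l'} - emeasure (nu \<omega>) {0..l}"
    using assms by (intro emeasure_Diff) (auto simp: emeasure_nu)
  moreover have "{0..l'} - {0..l} = {l<..l'}" using assms by auto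
  ultimately show ?thesis using W_nonneg by (simp add: emeasure_nu ennreal_minus)
qed

text \<open>A common interface for \<open>M\<close> and for the sigma-algebras generated by
  \<open>mu\<close>, by \<open>mu\<close> with the cut points, and by all the data; measurability of
  masses is proved once for all of them.\<close>

definition sees_mu :: "'w measure \<Rightarrow> bool" where
  "sees_mu N \<longleftrightarrow> space N = space M \<and> (\<forall>A\<in>sets borel. (\<lambda>\<omega>. emeasure (mu \<omega>) A) \<in> borel_measurable N)"

lemma sees_mu_M: "sees_mu M"
  by (simp add: sees_mu_def mu_meas)

lemma good_sets:
  assumes "sees_mu N" shows "good \<in> sets N"
proof -
  have "(\<lambda>\<omega>. emeasure (mu \<omega>) {0..real n}) \<in> borel_measurable N" for n :: nat
    using assms by (simp add: sees_mu_def)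
  then have "{\<omega> \<in> space N. \<forall>n::nat. emeasure (mu \<omega>) {0..real n} < \<infinity>} \<in> sets N" by measurable
  then show ?thesis using assms by (simp add: sees_mu_def good_def)
qed

lemma nu_meas:
  assumes N: "sees_mu N" and A: "A \<in> sets borel"
  shows "(\<lambda>\<omega>. emeasure (nu \<omega>) A) \<in> borel_measurable N"
proof -
  have "(\<lambda>\<omega>. if \<omega> \<in> good then emeasure (mu \<omega>) A else 0) \<in> borel_measurable N"
  proof (intro measurable_If_set borel_measurable_const)
    show "(\<lambda>\<omega>. emeasure (mu \<omega>) A) \<in> borel_measurable N" using N A by (simp add: sees_mu_def)
    show "good \<inter> space N \<in> sets N" by (rule sets.Int[OF good_sets[OF N] sets.top])
  qed
  moreover have "emeasure (nu \<omega>) A = (if \<omega> \<in> good then emeasure (mu \<omega>) A else 0)" for \<omega>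
    by (simp add: nu_def)
  ultimately show ?thesis by simp
qed

text \<open>Rounding the end point up to dyadic numbers leaves countably many values, for which
  \<open>nu_meas\<close> applies. The rounded intervals shrink to the given one, and continuity from
  above uses that \<open>nu\<close> is finite on bounded sets. Negative \<open>V\<close> gives the
  empty interval.\<close>

lemma nu_random_meas:
  assumes N: "sees_mu N" and A: "A \<in> sets borel" and V: "V \<in> borel_measurable N"
  shows "(\<lambda>\<omega>. emeasure (nu \<omega>) ({0..V \<omega>} \<inter> A)) \<in> borel_measurable N"
proof -
  define D where "D k \<omega> = nat \<lceil>2 ^ k * V \<omega>\<rceil>" for k :: nat and \<omega>
  define F where "F k \<omega> = emeasure (nu \<omega>) ({0..real (D k \<omega>) / 2 ^ k} \<inter> A)" for k \<omega>
  have "D k \<in> N \<rightarrow>\<^sub>M count_space UNIV" for k unfolding D_def using V by measurable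
  then have Fm: "F k \<in> borel_measurable N" for k
    unfolding F_def by (rule measurable_compose_countable[rotated]) (intro nu_meas[OF N], use A in simp)
  have lim: "(\<lambda>k. F k \<omega>) \<longlonglongrightarrow> emeasure (nu \<omega>) ({0..V \<omega>} \<inter> A)" if "0 \<le> V \<omega>" for \<omega>
  proof (rule tendsto_sandwich[of "\<lambda>_. emeasure (nu \<omega>) ({0..V \<omega>} \<inter> A)" _ _
        "\<lambda>k. emeasure (nu \<omega>) ({0..V \<omega> + 1 / 2 ^ k} \<inter> A)"])
    have b: "V \<omega> \<le> real (D k \<omega>) / 2 ^ k \<and> real (D k \<omega>) / 2 ^ k \<le> V \<omega> + 1 / 2 ^ k" for k
    proof -
      have "real (D k \<omega>) = of_int \<lceil>2 ^ k * V \<omega>\<rceil>" unfolding D_def using that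
        by (intro of_nat_nat) (simp add: less_le_trans[of "-1" 0])
      then have "2 ^ k * V \<omega> \<le> real (D k \<omega>)" "real (D k \<omega>) \<le> 2 ^ k * V \<omega> + 1" by linarith+
      then show ?thesis by (simp add: field_simps)
    qed
    have "{0..V \<omega>} \<inter> A \<subseteq> {0..real (D k \<omega>) / 2 ^ k} \<inter> A" for k using b[of k] by auto
    then show "\<forall>\<^sub>F k in sequentially. emeasure (nu \<omega>) ({0..V \<omega>} \<inter> A) \<le> F k \<omega>"
      unfolding F_def using A by (intro always_eventually allI emeasure_mono) simp_all
    have "{0..real (D k \<omega>) / 2 ^ k} \<inter> A \<subseteq> {0..V \<omega> + 1 / 2 ^ k} \<inter> A" for k using b[of k] by auto
    then show "\<forall>\<^sub>F k in sequentially. F k \<omega> \<le> emeasure (nu \<omega>) ({0..V \<omega> + 1 / 2 ^ k} \<inter> A)"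
      unfolding F_def using A by (intro always_eventually allI emeasure_mono) simp_all
    have "(\<lambda>k. emeasure (nu \<omega>) ({0..V \<omega> + 1 / 2 ^ k} \<inter> A))
        \<longlonglongrightarrow> emeasure (nu \<omega>) (\<Inter>k::nat. {0..V \<omega> + 1 / 2 ^ k} \<inter> A)"
    proof (rule Lim_emeasure_decseq)
      show "decseq (\<lambda>k. {0..V \<omega> + 1 / 2 ^ k} \<inter> A)"
        by (intro decseq_SucI) (auto simp: field_simps intro: order_trans)
    qed (use A nu_finite in \<open>auto simp: less_top\<close>)
    moreover have "(\<Inter>k::nat. {0..V \<omega> + 1 / 2 ^ k} \<inter> A) = {0..V \<omega>} \<inter> A"
    proof (intro set_eqI iffI)
      fix x assume x: "x \<in> (\<Inter>k::nat. {0..V \<omega> + 1 / 2 ^ k} \<inter> A)"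
      have "(\<lambda>k::nat. V \<omega> + 1 / 2 ^ k) \<longlonglongrightarrow> V \<omega>" by real_asymp
      then have "x \<le> V \<omega>" using x by (intro LIMSEQ_le_const) auto
      then show "x \<in> {0..V \<omega>} \<inter> A" using x by auto
    qed (auto intro: order_trans)
    ultimately show "(\<lambda>k. emeasure (nu \<omega>) ({0..V \<omega> + 1 / 2 ^ k} \<inter> A))
        \<longlonglongrightarrow> emeasure (nu \<omega>) ({0..V \<omega>} \<inter> A)" by simp
  qed simp
  have "(\<lambda>\<omega>. if 0 \<le> V \<omega> then F k \<omega> else 0) \<in> borel_measurable N" for k
    using Fm V by measurable
  note meas = this
  show ?thesis
  proof (rule borel_measurable_LIMSEQ_order[OF _ meas])
    show "(\<lambda>k. if 0 \<le> V \<omega> then F k \<omega> else 0) \<longlonglongrightarrow> emeasure (nu \<omega>) ({0..V \<omega>} \<inter> A)" for \<omega>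
      using lim[of \<omega>] by (cases "0 \<le> V \<omega>") simp_all
  qed
qed

lemma W_random_meas:
  assumes "sees_mu N" "V \<in> borel_measurable N"
  shows "(\<lambda>\<omega>. W \<omega> (V \<omega>)) \<in> borel_measurable N"
  using nu_random_meas[OF assms(1) _ assms(2), of UNIV]
  by (simp add: W_def measure_def)

lemma W_meas: "sees_mu N \<Longrightarrow> (\<lambda>\<omega>. W \<omega> l) \<in> borel_measurable N"
  by (rule W_random_meas) auto

lemma nn_W: "0 \<le> l \<Longrightarrow> (\<integral>\<^sup>+ \<omega>. ennreal (W \<omega> l) \<partial>M) = ennreal ((\<theta> 0)\<^sup>2 * l + (\<Sum>i. mean_coeff l i))"
  unfolding nn_mean[symmetric] emeasure_nu[symmetric]
  by (intro nn_integral_cong_AE eventually_mono[OF AE_good]) (simp add: nu_def)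

lemma mean_eq: 
  assumes "0 \<le> l" shows "mean l = (\<theta> 0)\<^sup>2 * l + (\<Sum>i. mean_coeff l i)"
proof -
  have nn: "0 \<le> (\<theta> 0)\<^sup>2 * l + (\<Sum>i. mean_coeff l i)"
    using assms mean_coeff[OF assms] by (auto intro!: add_nonneg_nonneg suminf_nonneg)
  have "mean l = (LINT \<omega>|M. W \<omega> l)"
    unfolding mean_def W_def using AE_good mu_meas W_meas[OF sees_mu_M] 
    by (intro integral_cong_AE) (auto simp: nu_def measure_def W_def elim!: eventually_mono)
  also have "\<dots> = enn2real (\<integral>\<^sup>+ \<omega>. ennreal (W \<omega> l) \<partial>M)"
    by (intro integral_eq_nn_integral W_meas sees_mu_M) (simp add: W_nonneg)
  finally show ?thesis using nn by (simp add: nn_W[OF assms])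
qed

lemma W_expectation: "0 \<le> l \<Longrightarrow> (\<integral>\<^sup>+ \<omega>. ennreal (W \<omega> l) \<partial>M) = ennreal (mean l)"
  by (simp add: nn_W mean_eq)

lemma mean_le: "0 \<le> l \<Longrightarrow> mean l \<le> l"
  by (simp add: mean_eq mean_bound)

lemma mean_mono:
  assumes "0 \<le> l" "l \<le> l'" shows "mean l \<le> mean l'"
proof -
  have "mean_coeff l i \<le> mean_coeff l' i" for i
    unfolding mean_coeff_def using \<theta>_nonneg[of "Suc i"] assms
    by (intro mult_left_mono diff_left_mono) (auto intro: mult_left_mono)
  then show ?thesis
    using assms mean_coeff by (simp add: mean_eq) (intro add_mono mult_left_mono suminf_le; auto)
qed

text \<open>If the drift vanishes, the squares of the remaining \<open>\<theta> i\<close> sum to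
  one, so some atom has positive weight and positive probability of lying in
  \<open>[0, l]\<close>.\<close>

lemma mean_pos:
  assumes "0 < l" shows "0 < mean l"
proof (cases "\<theta> 0 = 0")
  case False
  then show ?thesis using assms mean_coeff[of l] by (auto simp: mean_eq intro!: add_pos_nonneg suminf_nonneg)
next
  case True
  then have "(\<Sum>i. (\<theta> (Suc i))\<^sup>2) = 1" using suminf_\<theta> by simp
  then have "(\<lambda>i. (\<theta> (Suc i))\<^sup>2) \<noteq> (\<lambda>i. 0)" by force
  then obtain i where "\<theta> (Suc i) \<noteq> 0" by (auto simp: fun_eq_iff)
  then have "0 < mean_coeff l i" unfolding mean_coeff_def using \<theta>_nonneg[of "Suc i"] assms
    by (auto intro!: mult_pos_pos)
  then show ?thesis using assms mean_coeff[of l] True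
    by (simp add: mean_eq) (intro suminf_pos2[of _ i]; auto)
qed

section \<open>Concentration of the mass\<close>

text \<open>Finitely many atoms together with the drift carry \<open>3 / 4\<close> of the mean, so
  falling below half of it forces a deviation by \<open>mean l / 4\<close> in Hoeffding's
  inequality. The squared ranges sum to at most \<open>2\<close>, because the squares of the
  \<open>\<theta> i\<close> sum to at most one.\<close>

lemma W_lower_tail:
  assumes l: "0 < l"
  shows "prob {\<omega> \<in> space M. W \<omega> l < mean l / 2} \<le> exp (- (mean l)\<^sup>2 / 16)"
proof -
  have l0: "0 \<le> l" using l by simp
  have m: "0 < mean l" using mean_pos[OF l] .
  have "(\<lambda>n. (\<theta> 0)\<^sup>2 * l + (\<Sum>i<n. mean_coeff l i)) \<longlonglongrightarrow> mean l"
    unfolding mean_eq[OF l0] by (intro tendsto_intros summable_LIMSEQ mean_coeff l0)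
  then have "\<forall>\<^sub>F n in sequentially. 3 / 4 * mean l < (\<theta> 0)\<^sup>2 * l + (\<Sum>i<n. mean_coeff l i)"
    using m by (intro order_tendstoD) auto
  then obtain n0 where n0: "\<forall>n\<ge>n0. 3 / 4 * mean l < (\<theta> 0)\<^sup>2 * l + (\<Sum>i<n. mean_coeff l i)"
    unfolding eventually_sequentially by blast
  define n where "n = Suc n0"
  have n: "0 < n" "3 / 4 * mean l < (\<theta> 0)\<^sup>2 * l + (\<Sum>i<n. mean_coeff l i)"
    using n0 by (auto simp: n_def simp del: sum.lessThan_Suc)
  have n': "3 / 4 * mean l < (\<theta> 0)\<^sup>2 * l + (\<Sum>i=1..n. mean_coeff l (i - 1))"
    using n by (simp add: sum.atLeast1_atMost_eq)
  define \<eta> where "\<eta> i \<omega> = \<theta> i * indicat_real (ereal ` {0..l}) (X i \<omega>)" for i \<omega>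
  have "indep_vars (\<lambda>_. borel) X {1..n}" by (rule indep_vars_subset[OF X_indep]) auto
  then have ind: "indep_vars (\<lambda>_. borel) \<eta> {1..n}"
    unfolding \<eta>_def using image_ereal_borel[of "{0..l}"] by (rule_tac indep_vars_compose2) auto
  have E: "expectation (\<eta> i) = mean_coeff l (i - 1)" if "i \<in> {1..n}" for i
  proof -
    have i: "i = Suc (i - 1)" using that by auto
    have Xs: "{\<omega> \<in> space M. X i \<omega> \<in> ereal ` {0..l}} \<in> events"
      using that by (intro X_event) auto
    have "expectation (\<eta> i) = expectation (\<lambda>\<omega>. \<theta> i * indicat_real {\<omega> \<in> space M. X i \<omega> \<in> ereal ` {0..l}} \<omega>)"
      unfolding \<eta>_def by (intro Bochner_Integration.integral_cong) (auto simp: indicator_def)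
    also have "\<dots> = \<theta> i * prob {\<omega> \<in> space M. X i \<omega> \<in> ereal ` {0..l}}"
      using Xs by simp
    also have "prob {\<omega> \<in> space M. X i \<omega> \<in> ereal ` {0..l}} = 1 - exp (- \<theta> i * l)"
      using X_prob[OF l0, of "i - 1"] \<theta>_nonneg[of i] l0 i by (simp add: emeasure_eq_measure)
    finally show ?thesis using i by (simp add: mean_coeff_def)
  qed
  \<comment> \<open>The natural range is \<open>\<theta> i\<close>. The term \<open>1 / n\<close>
    adds one in total to the sum of squares and keeps it positive even if all these
    \<open>\<theta> i\<close> vanish, as the Hoeffding bound divides by it.\<close>
  define bd where "bd i = sqrt ((\<theta> i)\<^sup>2 + 1 / n)" for i
  have bd: "\<theta> i \<le> bd i" for i
    unfolding bd_def by (rule real_le_rsqrt) simp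
  interpret H: Hoeffding_ineq M "{1..n}" \<eta> "\<lambda>_. 0" bd "\<Sum>i=1..n. expectation (\<eta> i)"
  proof unfold_locales
    show "AE \<omega> in M. \<eta> i \<omega> \<in> {0..bd i}" for i
      using bd[of i] \<theta>_nonneg[of i] by (auto simp: \<eta>_def indicator_def)
    show "indep_vars (\<lambda>_. borel) \<eta> {1..n}" by (rule ind)
  qed auto
  have bsum: "0 < (\<Sum>i=1..n. (bd i - 0)\<^sup>2)" "(\<Sum>i=1..n. (bd i - 0)\<^sup>2) \<le> 2"
  proof -
    have e: "(\<Sum>i=1..n. (bd i - 0)\<^sup>2) = (\<Sum>i=1..n. (\<theta> i)\<^sup>2) + 1"
      using n by (simp add: bd_def sum.distrib)
    show "0 < (\<Sum>i=1..n. (bd i - 0)\<^sup>2)" unfolding e by (intro add_nonneg_pos sum_nonneg) auto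
    have "(\<Sum>i=1..n. (\<theta> i)\<^sup>2) = (\<Sum>i<n. (\<theta> (Suc i))\<^sup>2)" by (simp add: sum.atLeast1_atMost_eq)
    also have "\<dots> \<le> (\<Sum>i. (\<theta> (Suc i))\<^sup>2)" by (intro sum_le_suminf summable_\<theta>) auto
    also have "\<dots> \<le> 1" using suminf_\<theta> zero_le_power2[of "\<theta> 0"] by linarith
    finally show "(\<Sum>i=1..n. (bd i - 0)\<^sup>2) \<le> 2" unfolding e by simp
  qed
  have low: "(\<theta> 0)\<^sup>2 * l + (\<Sum>i=1..n. \<eta> i \<omega>) \<le> W \<omega> l" if "\<omega> \<in> good" for \<omega>
  proof -
    have "ennreal ((\<theta> 0)\<^sup>2 * l + (\<Sum>i=1..n. \<eta> i \<omega>))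
        = ennreal ((\<theta> 0)\<^sup>2) * ennreal l + (\<Sum>i<n. ennreal (\<theta> (Suc i)) * indicator (ereal ` {0..l}) (X (Suc i) \<omega>))"
    proof -
      have nn: "0 \<le> \<eta> (Suc i) \<omega>" for i using \<theta>_nonneg[of "Suc i"] by (simp add: \<eta>_def)
      have "ennreal (\<eta> (Suc i) \<omega>) = ennreal (\<theta> (Suc i)) * indicator (ereal ` {0..l}) (X (Suc i) \<omega>)" for i
        unfolding \<eta>_def by (simp split: split_indicator)
      then have "(\<Sum>i<n. ennreal (\<theta> (Suc i)) * indicator (ereal ` {0..l}) (X (Suc i) \<omega>)) = ennreal (\<Sum>i<n. \<eta> (Suc i) \<omega>)"
        using nn by (simp add: sum_ennreal[symmetric])
      moreover have "(\<Sum>i=1..n. \<eta> i \<omega>) = (\<Sum>i<n. \<eta> (Suc i) \<omega>)" by (simp add: sum.atLeast1_atMost_eq)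
      ultimately show ?thesis
        using l0 nn by (simp add: ennreal_mult[symmetric] sum_nonneg)
    qed
    also have "\<dots> \<le> emeasure (mu \<omega>) {0..l}"
    proof -
      have "emeasure (mu \<omega>) {0..l} = ennreal ((\<theta> 0)\<^sup>2) * ennreal l
          + (\<Sum>i. ennreal (\<theta> (Suc i)) * indicator (ereal ` {0..l}) (X (Suc i) \<omega>))"
        using l0 by (simp add: mu_def emeasure_icrt_mu)
      then show ?thesis by (simp only:) (intro add_left_mono sum_le_suminf; simp)
    qed
    also have "\<dots> = ennreal (W \<omega> l)" using that emeasure_nu[of \<omega> l] by (simp add: nu_def)
    finally show ?thesis using W_nonneg by simp
  qed
  have "prob {\<omega> \<in> space M. W \<omega> l < mean l / 2}
      \<le> prob {\<omega> \<in> space M. (\<Sum>i=1..n. \<eta> i \<omega>) \<le> (\<Sum>i=1..n. expectation (\<eta> i)) - mean l / 4}"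
  proof (rule finite_measure_mono_AE)
    show "AE \<omega> in M. \<omega> \<in> {\<omega> \<in> space M. W \<omega> l < mean l / 2} \<longrightarrow>
        \<omega> \<in> {\<omega> \<in> space M. (\<Sum>i=1..n. \<eta> i \<omega>) \<le> (\<Sum>i=1..n. expectation (\<eta> i)) - mean l / 4}"
      using AE_good
    proof eventually_elim
      case (elim \<omega>)
      have "(\<Sum>i=1..n. expectation (\<eta> i)) = (\<Sum>i=1..n. mean_coeff l (i - 1))"
        by (intro sum.cong refl E)
      then show ?case using low[OF elim] n' by auto
    qed
    show "{\<omega> \<in> space M. (\<Sum>i=1..n. \<eta> i \<omega>) \<le> (\<Sum>i=1..n. expectation (\<eta> i)) - mean l / 4} \<in> events"
      using H.random_variable by (intro borel_measurable_le[THEN asm_rl, of "\<lambda>\<omega>. \<Sum>i=1..n. \<eta> i \<omega>" M "\<lambda>_. (\<Sum>i=1..n. expectation (\<eta> i)) - mean l / 4"] borel_measurable_sum) auto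
  qed
  also have "\<dots> \<le> exp (- 2 * (mean l / 4)\<^sup>2 / (\<Sum>i=1..n. (bd i - 0)\<^sup>2))"
    using m by (intro H.Hoeffding_ineq_le bsum) auto
  also have "\<dots> \<le> exp (- (mean l)\<^sup>2 / 16)"
  proof -
    have "2 * (mean l / 4)\<^sup>2 / 2 \<le> 2 * (mean l / 4)\<^sup>2 / (\<Sum>i=1..n. (bd i - 0)\<^sup>2)"
      using bsum by (intro divide_left_mono) auto
    then show ?thesis by (simp add: power_divide)
  qed
  finally show ?thesis .
qed

end

subsection \<open>The cut points\<close>

text \<open>\<open>real_cond_exp\<close> is a difference of two nonnegative conditional
  expectations. For an indicator the second vanishes and the first is at most one, so
  \<open>cond_prob\<close> can be tested against every nonnegative \<open>N\<close>-measurable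
  weight, integrable or not.\<close>

lemma (in prob_space) nn_integral_cond_prob:
  assumes sub: "subalgebra M N" and E: "E \<in> events" and f: "f \<in> borel_measurable N"
  shows "(\<integral>\<^sup>+ \<omega>. f \<omega> * indicator E \<omega> \<partial>M) = (\<integral>\<^sup>+ \<omega>. f \<omega> * ennreal (cond_prob M N E \<omega>) \<partial>M)"
proof -
  interpret S: finite_measure_subalgebra M N by unfold_locales (rule sub)
  have m: "(\<lambda>\<omega>. ennreal (indicator E \<omega>)) \<in> borel_measurable M" using E by simp
  have z: "AE \<omega> in M. 0 = nn_cond_exp M N (\<lambda>\<omega>. 0) \<omega>"
    by (rule S.nn_cond_exp_F_meas) simp
  have "AE \<omega> in M. nn_cond_exp M N (\<lambda>\<omega>. ennreal (indicator E \<omega>)) \<omega> \<le> nn_cond_exp M N (\<lambda>\<omega>. 1) \<omega>"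
    using m by (intro S.nn_cond_exp_mono) (auto split: split_indicator)
  moreover have "AE \<omega> in M. 1 = nn_cond_exp M N (\<lambda>\<omega>. 1) \<omega>"
    by (rule S.nn_cond_exp_F_meas) simp
  ultimately have eq: "AE \<omega> in M. nn_cond_exp M N (\<lambda>\<omega>. ennreal (indicator E \<omega>)) \<omega> = ennreal (cond_prob M N E \<omega>)"
    using z
  proof eventually_elim
    case (elim \<omega>)
    have n: "(\<lambda>\<omega>. ennreal (- indicator E \<omega>)) = (\<lambda>\<omega>. 0)"
      by (auto simp: fun_eq_iff ennreal_neg split: split_indicator)
    have "nn_cond_exp M N (\<lambda>\<omega>. ennreal (indicator E \<omega>)) \<omega> \<le> 1" using elim by simp
    then have "nn_cond_exp M N (\<lambda>\<omega>. ennreal (indicator E \<omega>)) \<omega> < \<top>"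
      by (rule le_less_trans) simp
    then show ?case
      using elim(3) unfolding cond_prob_def real_cond_exp_def n by simp
  qed
  have "(\<integral>\<^sup>+ \<omega>. f \<omega> * indicator E \<omega> \<partial>M) = (\<integral>\<^sup>+ \<omega>. f \<omega> * ennreal (indicator E \<omega>) \<partial>M)"
    by (intro nn_integral_cong) (simp split: split_indicator)
  also have "\<dots> = (\<integral>\<^sup>+ \<omega>. f \<omega> * nn_cond_exp M N (\<lambda>\<omega>. ennreal (indicator E \<omega>)) \<omega> \<partial>M)"
    by (rule S.nn_cond_exp_intg[OF f m, symmetric])
  also have "\<dots> = (\<integral>\<^sup>+ \<omega>. f \<omega> * ennreal (cond_prob M N E \<omega>) \<partial>M)"
    by (intro nn_integral_cong_AE eventually_mono[OF eq]) simp
  finally show ?thesis .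
qed

lemma subalgebra_vimage:
  assumes "f \<in> M \<rightarrow>\<^sub>M N" shows "subalgebra M (vimage_algebra (space M) f N)"
proof -
  have "f \<in> space M \<rightarrow> space N" using assms by (rule measurable_space[THEN funcsetI])
  then show ?thesis
    unfolding subalgebra_def using assms by (auto simp: sets_vimage_algebra2)
qed

text \<open>Total mass and mean of the Poisson weights; the second series is the first one shifted
  by one index.\<close>

lemma poisson_sums:
  fixes x :: real
  shows "(\<lambda>k. x ^ k / fact k * exp (- x)) sums 1" "(\<lambda>k. real k * (x ^ k / fact k * exp (- x))) sums x"
proof -
  have e: "(\<lambda>k. x ^ k / fact k) sums exp x"
    using exp_converges[of x] by (simp add: divide_inverse mult.commute)
  from sums_mult2[OF this, of "exp (- x)"] show "(\<lambda>k. x ^ k / fact k * exp (- x)) sums 1"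
    by (simp add: exp_minus)
  have "(\<lambda>k. real (Suc k) * (x ^ Suc k / fact (Suc k) * exp (- x))) = (\<lambda>k. x * exp (- x) * (x ^ k / fact k))"
    by (auto simp: fun_eq_iff field_simps simp del: of_nat_Suc)
  moreover have "(\<lambda>k. x * exp (- x) * (x ^ k / fact k)) sums (x * exp (- x) * exp x)"
    by (rule sums_mult[OF e])
  ultimately have "(\<lambda>k. real (Suc k) * (x ^ Suc k / fact (Suc k) * exp (- x))) sums x"
    by (simp add: exp_minus mult.assoc)
  moreover define f where "f k = real k * (x ^ k / fact k * exp (- x))" for k
  ultimately have "(\<lambda>k. f (Suc k)) sums x" by simp
  moreover have "f 0 = 0" by (simp add: f_def)
  ultimately have "f sums x" using sums_Suc_iff[of f x] by simp
  then show "(\<lambda>k. real k * (x ^ k / fact k * exp (- x))) sums x" by (simp add: f_def[abs_def])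
qed

context icrt_space
begin

lemma subalgebra_measure: "subalgebra M (measure_algebra M mu)"
  unfolding measure_algebra_def by (intro subalgebra_vimage measurable_restrict mu_meas)

lemma sees_mu_measure: "sees_mu (measure_algebra M mu)"
  unfolding sees_mu_def
proof (intro conjI ballI)
  show sp: "space (measure_algebra M mu) = space M" by (simp add: measure_algebra_def)
  fix A :: "real set" assume A: "A \<in> sets borel"
  have "(\<lambda>\<omega>. \<lambda>A\<in>sets borel. emeasure (mu \<omega>) A) \<in> measure_algebra M mu \<rightarrow>\<^sub>M (\<Pi>\<^sub>M A\<in>sets borel. borel)"
    unfolding measure_algebra_def by (rule measurable_vimage_algebra1) (auto simp: space_PiM)
  from measurable_compose[OF this measurable_component_singleton[OF A]] A
  show "(\<lambda>\<omega>. emeasure (mu \<omega>) A) \<in> borel_measurable (measure_algebra M mu)" by simp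
qed

lemma subalgebra_points: "subalgebra M (measure_points_algebra M mu Y)"
  unfolding measure_points_algebra_def
  by (intro subalgebra_vimage measurable_Pair measurable_restrict mu_meas Y_meas)

lemma points_algebra:
  shows sees_mu_points: "sees_mu (measure_points_algebra M mu Y)"
    and Y_points_meas: "\<And>i. 1 \<le> i \<Longrightarrow> Y i \<in> borel_measurable (measure_points_algebra M mu Y)"
proof -
  let ?F = "measure_points_algebra M mu Y"
  have sp: "space ?F = space M" by (simp add: measure_points_algebra_def)
  have m: "(\<lambda>\<omega>. (\<lambda>A\<in>sets borel. emeasure (mu \<omega>) A, \<lambda>i\<in>{1..}. Y i \<omega>))
      \<in> ?F \<rightarrow>\<^sub>M (\<Pi>\<^sub>M A\<in>sets borel. borel) \<Otimes>\<^sub>M (\<Pi>\<^sub>M i\<in>{1..}. borel)"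
    unfolding measure_points_algebra_def
    by (rule measurable_vimage_algebra1) (auto simp: space_PiM space_pair_measure)
  from measurable_compose[OF m measurable_fst] measurable_compose[OF m measurable_snd]
  have m1: "(\<lambda>\<omega>. \<lambda>A\<in>sets borel. emeasure (mu \<omega>) A) \<in> ?F \<rightarrow>\<^sub>M (\<Pi>\<^sub>M A\<in>sets borel. borel)"
    and m2: "(\<lambda>\<omega>. \<lambda>i\<in>{1..}. Y i \<omega>) \<in> ?F \<rightarrow>\<^sub>M (\<Pi>\<^sub>M i\<in>{1..}. borel)"
    by simp_all
  show "sees_mu ?F"
    unfolding sees_mu_def
  proof (intro conjI ballI sp)
    fix A :: "real set" assume A: "A \<in> sets borel"
    from measurable_compose[OF m1 measurable_component_singleton[OF A]] A
    show "(\<lambda>\<omega>. emeasure (mu \<omega>) A) \<in> borel_measurable ?F" by simp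
  qed
  show "Y i \<in> borel_measurable ?F" if "1 \<le> i" for i
    using measurable_compose[OF m2 measurable_component_singleton[of i]] that by simp
qed

definition no_points :: "real set \<Rightarrow> 'w set" where
  "no_points A = {\<omega> \<in> space M. \<forall>i\<ge>1. Y i \<omega> \<notin> A}"

lemma no_points_sets:
  assumes "space N = space M" "\<And>i. 1 \<le> i \<Longrightarrow> Y i \<in> borel_measurable N" "A \<in> sets borel"
  shows "no_points A \<in> sets N"
proof -
  have "no_points A = space N - (\<Union>i\<in>{1..}. Y i -` A \<inter> space N)"
    using assms(1) by (auto simp: no_points_def)
  also have "\<dots> \<in> sets N"
    using measurable_sets[OF assms(2,3)] by (intro sets.compl_sets sets.countable_UN') auto
  finally show ?thesis .
qed

text \<open>Stated with \<open>mu\<close>, as in the hypothesis on the cut points; on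
  \<open>good\<close> it agrees with the integral of the monotone function \<open>W\<close>.\<close>

definition intensity :: "real set \<Rightarrow> 'w \<Rightarrow> real" where
  "intensity A \<omega> = (LINT l:A|lborel. measure (mu \<omega>) {0..l})"

lemma W_borel: "(\<lambda>l. W \<omega> l) \<in> borel_measurable borel"
  by (intro borel_measurable_mono monoI W_mono)

text \<open>\<open>W\<close> is monotone, so it lies between its values at the ends. Open intervals
  serve for voids, closed ones for counting points.\<close>

lemma intensity_good:
  assumes "\<omega> \<in> good" "0 \<le> s" "s \<le> t" and A: "A \<in> {{s<..<t}, {s..t}}"
  shows "W \<omega> s * (t - s) \<le> intensity A \<omega>" "intensity A \<omega> \<le> W \<omega> t * (t - s)"
proof -
  have Am: "A \<in> sets borel" "emeasure lborel A = ennreal (t - s)" using A assms by auto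
  have Ab: "l \<in> A \<Longrightarrow> s \<le> l \<and> l \<le> t" for l using A by auto
  have fin: "emeasure lborel A < \<infinity>" using Am by simp
  have int: "set_integrable lborel A (W \<omega>)"
    unfolding set_integrable_def using W_borel[of \<omega>] Am fin
    by (intro integrableI_bounded_set_indicator[where B = "W \<omega> t"])
       (auto intro!: AE_I2 simp: W_nonneg dest!: Ab intro: W_mono)
  have intc: "set_integrable lborel A (\<lambda>_. c)" for c :: real
    unfolding set_integrable_def using Am fin by simp
  have e: "intensity A \<omega> = (LINT l:A|lborel. W \<omega> l)"
    using assms(1) by (simp add: intensity_def W_def nu_def)
  have c: "(LINT l:A|lborel. c) = c * (t - s)" for c :: real
    unfolding set_lebesgue_integral_def using Am fin assms by (simp add: measure_def)
  show "W \<omega> s * (t - s) \<le> intensity A \<omega>" "intensity A \<omega> \<le> W \<omega> t * (t - s)"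
    unfolding e c[symmetric] using int intc
    by (auto intro!: set_integral_mono W_mono dest: Ab)
qed

text \<open>The Poisson hypothesis for a single set, in the form used later: tested against weights
  that depend on \<open>mu\<close> alone.\<close>

lemma points_count:
  fixes k :: nat
  assumes A: "A \<in> sets borel" "A \<subseteq> {0..}" "bounded A" and f: "f \<in> borel_measurable (measure_algebra M mu)"
  defines "E \<equiv> {\<omega> \<in> space M. finite {i. 1 \<le> i \<and> Y i \<omega> \<in> A} \<and> card {i. 1 \<le> i \<and> Y i \<omega> \<in> A} = k}"
  shows "E \<in> events"
    and "AE \<omega> in M. cond_prob M (measure_algebra M mu) E \<omega>
           = intensity A \<omega> ^ k / fact k * exp (- intensity A \<omega>)"
    and "(\<integral>\<^sup>+ \<omega>. f \<omega> * indicator E \<omega> \<partial>M)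
           = (\<integral>\<^sup>+ \<omega>. f \<omega> * ennreal (intensity A \<omega> ^ k / fact k * exp (- intensity A \<omega>)) \<partial>M)"
proof -
  have Yb: "{\<omega> \<in> space M. 1 \<le> i \<and> Y i \<omega> \<in> A} \<in> events" for i
    using Y_meas[of i] A(1) by measurable
  show E: "E \<in> events"
  proof -
    \<comment> \<open>Equality of a sum of indicators in \<open>ennreal\<close> with
      \<open>k\<close> encodes finiteness and cardinality at once, and is visibly
      measurable.\<close>
    have count: "finite T \<and> card T = k \<longleftrightarrow> (\<Sum>i. indicator T i) = (of_nat k :: ennreal)" for T :: "nat set"
    proof -
      have "(\<Sum>i. indicator T i) = emeasure (count_space UNIV) T"
        by (simp add: nn_integral_count_space_nat[symmetric])
      then show ?thesis by (cases "finite T") (auto simp: emeasure_count_space of_nat_eq_iff)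
    qed
    have "E = {\<omega> \<in> space M. (\<Sum>i. indicator {\<omega> \<in> space M. 1 \<le> i \<and> Y i \<omega> \<in> A} \<omega>) = (of_nat k :: ennreal)}"
    proof -
      have "(\<Sum>i. indicator {i. 1 \<le> i \<and> Y i \<omega> \<in> A} i)
          = (\<Sum>i. indicator {\<omega> \<in> space M. 1 \<le> i \<and> Y i \<omega> \<in> A} \<omega> :: ennreal)" if "\<omega> \<in> space M" for \<omega>
        using that by (intro arg_cong[where f = suminf] ext) (simp split: split_indicator)
      then show ?thesis unfolding E_def count by auto
    qed
    also have "\<dots> \<in> events"
      using Yb by measurable
    finally show ?thesis .
  qed
  have "(\<forall>j<1. A \<in> sets borel \<and> A \<subseteq> {0..} \<and> bounded A) \<and> disjoint_family_on (\<lambda>_. A) {..<1::nat}"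
    using A by (simp add: disjoint_family_on_def)
  with Y_points[unfolded cond_poisson_points_def]
  have "AE \<omega> in M. cond_prob M (measure_algebra M mu)
      {\<omega>' \<in> space M. \<forall>j<1::nat. finite {i. 1 \<le> i \<and> Y i \<omega>' \<in> A} \<and> card {i. 1 \<le> i \<and> Y i \<omega>' \<in> A} = k} \<omega>
      = (\<Prod>j<1::nat. (LINT l:A|lborel. measure (mu \<omega>) {0..l}) ^ k / fact k
                       * exp (- (LINT l:A|lborel. measure (mu \<omega>) {0..l})))"
    by (elim conjE allE[of _ "1::nat"] allE[of _ "\<lambda>_. A"] allE[of _ "\<lambda>_. k"]) blast
  then show ae: "AE \<omega> in M. cond_prob M (measure_algebra M mu) E \<omega>
      = intensity A \<omega> ^ k / fact k * exp (- intensity A \<omega>)"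
    unfolding E_def intensity_def by simp
  show "(\<integral>\<^sup>+ \<omega>. f \<omega> * indicator E \<omega> \<partial>M)
           = (\<integral>\<^sup>+ \<omega>. f \<omega> * ennreal (intensity A \<omega> ^ k / fact k * exp (- intensity A \<omega>)) \<partial>M)"
    unfolding nn_integral_cond_prob[OF subalgebra_measure E f]
    by (intro nn_integral_cong_AE eventually_mono[OF ae]) simp
qed

text \<open>Given \<open>mu\<close>, a void has probability \<open>exp\<close> of minus the
  intensity, and by monotonicity of \<open>W\<close> the intensity is at least
  \<open>c * (t - s)\<close> wherever the weight is nonzero.\<close>

lemma void_bound:
  assumes f: "f \<in> borel_measurable (measure_algebra M mu)"
    and st: "0 \<le> s" "s \<le> t" and c: "\<And>\<omega>. \<omega> \<in> space M \<Longrightarrow> f \<omega> \<noteq> 0 \<Longrightarrow> c \<le> W \<omega> s"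
  shows "(\<integral>\<^sup>+ \<omega>. f \<omega> * indicator (no_points {s<..<t}) \<omega> \<partial>M) \<le> ennreal (exp (- c * (t - s))) * (\<integral>\<^sup>+ \<omega>. f \<omega> \<partial>M)"
proof -
  let ?A = "{s<..<t}"
  have sub: "?A \<subseteq> {0..}" using st by auto
  have "{\<omega> \<in> space M. finite {i. 1 \<le> i \<and> Y i \<omega> \<in> ?A} \<and> card {i. 1 \<le> i \<and> Y i \<omega> \<in> ?A} = 0} = no_points ?A"
  proof -
    have "finite T \<and> card T = 0 \<longleftrightarrow> (\<forall>i. i \<notin> T)" for T :: "nat set" by auto
    then show ?thesis by (auto simp: no_points_def)
  qed
  then have "(\<integral>\<^sup>+ \<omega>. f \<omega> * indicator (no_points ?A) \<omega> \<partial>M) = (\<integral>\<^sup>+ \<omega>. f \<omega> * ennreal (exp (- intensity ?A \<omega>)) \<partial>M)"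
    using points_count(3)[of ?A f 0] sub f by simp
  also have "\<dots> \<le> (\<integral>\<^sup>+ \<omega>. ennreal (exp (- c * (t - s))) * f \<omega> \<partial>M)"
  proof (intro nn_integral_mono_AE)
    show "AE \<omega> in M. f \<omega> * ennreal (exp (- intensity ?A \<omega>)) \<le> ennreal (exp (- c * (t - s))) * f \<omega>"
      using AE_good AE_space
    proof eventually_elim
      case (elim \<omega>)
      show ?case
      proof (cases "f \<omega> = 0")
        case False
        have "c * (t - s) \<le> W \<omega> s * (t - s)" using c[OF elim(2) False] st by (intro mult_right_mono) auto
        also have "\<dots> \<le> intensity ?A \<omega>" using elim(1) st by (intro intensity_good) auto
        finally have "ennreal (exp (- intensity ?A \<omega>)) \<le> ennreal (exp (- c * (t - s)))" by (intro ennreal_leI) simp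
        then show ?thesis by (subst mult.commute) (intro mult_right_mono, auto)
      qed simp
    qed
  qed
  also have "\<dots> = ennreal (exp (- c * (t - s))) * (\<integral>\<^sup>+ \<omega>. f \<omega> \<partial>M)"
    by (intro nn_integral_cmult measurable_from_subalg[OF subalgebra_measure f])
  finally show ?thesis .
qed

lemma mean_nonneg: "0 \<le> l \<Longrightarrow> 0 \<le> mean l"
  using mean_mono[of 0 l] mean_coeff[of 0] by (simp add: mean_eq mean_coeff_def)

text \<open>The conditional probabilities of exactly \<open>k\<close> points sum to one over
  \<open>k\<close>, which leaves no room for infinitely many points. The mean of the Poisson weights
  is the intensity of \<open>[0, t]\<close>, at most \<open>t * W \<omega> t\<close>.\<close>

lemma points_finite:
  fixes t :: real
  assumes t: "0 \<le> t"
  shows "AE \<omega> in M. finite {i. 1 \<le> i \<and> Y i \<omega> \<in> {0..t}}"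
    and "(\<integral>\<^sup>+ \<omega>. emeasure (count_space UNIV) {i. 1 \<le> i \<and> Y i \<omega> \<in> {0..t}} \<partial>M) \<le> ennreal (t * mean t)"
proof -
  let ?A = "{0..t}"
  define S where "S \<omega> = {i. 1 \<le> i \<and> Y i \<omega> \<in> ?A}" for \<omega>
  define E where "E k = {\<omega> \<in> space M. finite (S \<omega>) \<and> card (S \<omega>) = k}" for k
  have Em: "E k \<in> events" for k
    unfolding E_def S_def by (rule points_count(1)[of ?A "\<lambda>_. 1"]) auto
  define q where "q k \<omega> = ennreal (cond_prob M (measure_algebra M mu) (E k) \<omega>)" for k \<omega>
  have qm: "q k \<in> borel_measurable M" for k
    unfolding q_def cond_prob_def by measurable
  have EP: "emeasure M (E k) = (\<integral>\<^sup>+ \<omega>. q k \<omega> \<partial>M)" for k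
    using nn_integral_cond_prob[OF subalgebra_measure Em, of "\<lambda>_. 1" k] Em[of k] by (simp add: q_def)
  have "AE \<omega> in M. \<forall>k. cond_prob M (measure_algebra M mu) (E k) \<omega>
      = intensity ?A \<omega> ^ k / fact k * exp (- intensity ?A \<omega>)"
    unfolding AE_all_countable E_def S_def by (intro allI points_count(2)[of ?A "\<lambda>_. 1"]) auto
  then have sums: "AE \<omega> in M. (\<Sum>k. q k \<omega>) = 1 \<and> (\<Sum>k. of_nat k * q k \<omega>) \<le> ennreal (W \<omega> t * t)"
    using AE_good
  proof eventually_elim
    case (elim \<omega>)
    have "0 \<le> W \<omega> 0 * (t - 0)" using t W_nonneg by simp
    also have "\<dots> \<le> intensity ?A \<omega>" using elim t by (intro intensity_good) auto
    finally have pos: "0 \<le> intensity ?A \<omega>" .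
    have q: "q k \<omega> = ennreal (intensity ?A \<omega> ^ k / fact k * exp (- intensity ?A \<omega>))" for k
      using elim by (simp add: q_def)
    have "(\<Sum>k. q k \<omega>) = ennreal 1"
      unfolding q using pos poisson_sums(1)[of "intensity ?A \<omega>"]
      by (intro sums_unique[symmetric] sums_ennreal[THEN iffD2]) auto
    moreover have "(\<Sum>k. of_nat k * q k \<omega>) = ennreal (intensity ?A \<omega>)"
    proof -
      have "of_nat k * q k \<omega> = ennreal (real k * (intensity ?A \<omega> ^ k / fact k * exp (- intensity ?A \<omega>)))" for k
        unfolding q using pos by (subst ennreal_mult) (auto simp: ennreal_of_nat_eq_real_of_nat)
      then show ?thesis
        using pos poisson_sums(2)[of "intensity ?A \<omega>"]
        by (simp only:) (intro sums_unique[symmetric] sums_ennreal[THEN iffD2]; simp)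
    qed
    moreover have "intensity ?A \<omega> \<le> W \<omega> t * (t - 0)" using elim t by (intro intensity_good) auto
    ultimately show ?case by (auto intro: ennreal_leI)
  qed
  have disj: "disjoint_family E" by (auto simp: disjoint_family_on_def E_def)
  have "emeasure M (\<Union>k. E k) = (\<Sum>k. emeasure M (E k))"
    using Em disj by (intro suminf_emeasure[symmetric]) auto
  also have "\<dots> = (\<integral>\<^sup>+ \<omega>. (\<Sum>k. q k \<omega>) \<partial>M)"
    unfolding EP by (rule nn_integral_suminf[OF qm, symmetric])
  also have "\<dots> = (\<integral>\<^sup>+ \<omega>. 1 \<partial>M)"
    using sums by (intro nn_integral_cong_AE) (auto elim: eventually_mono)
  also have "\<dots> = 1" by (simp add: emeasure_space_1)
  finally have "AE \<omega> in M. \<omega> \<in> (\<Union>k. E k)"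
    using Em by (intro AE_prob_1) (simp add: emeasure_eq_measure)
  then show fin: "AE \<omega> in M. finite {i. 1 \<le> i \<and> Y i \<omega> \<in> {0..t}}"
    by eventually_elim (auto simp: E_def S_def)
  have "(\<integral>\<^sup>+ \<omega>. emeasure (count_space UNIV) (S \<omega>) \<partial>M) = (\<integral>\<^sup>+ \<omega>. (\<Sum>k. of_nat k * indicator (E k) \<omega>) \<partial>M)"
  proof (intro nn_integral_cong_AE)
    show "AE \<omega> in M. emeasure (count_space UNIV) (S \<omega>) = (\<Sum>k. of_nat k * indicator (E k) \<omega>)"
      using fin AE_space
    proof eventually_elim
      case (elim \<omega>)
      have "(\<Sum>k. of_nat k * indicator (E k) \<omega> :: ennreal) = (\<Sum>k\<in>{card (S \<omega>)}. of_nat k * indicator (E k) \<omega>)"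
        by (intro suminf_finite) (auto simp: E_def)
      also have "\<dots> = of_nat (card (S \<omega>))" using elim by (simp add: E_def S_def)
      finally show ?case using elim by (simp add: emeasure_count_space_finite S_def)
    qed
  qed
  also have "\<dots> = (\<Sum>k. of_nat k * emeasure M (E k))"
    using Em by (subst nn_integral_suminf) (auto simp: nn_integral_cmult)
  also have "\<dots> = (\<integral>\<^sup>+ \<omega>. (\<Sum>k. of_nat k * q k \<omega>) \<partial>M)"
    unfolding EP using qm by (subst nn_integral_suminf) (auto simp: nn_integral_cmult)
  also have "\<dots> \<le> (\<integral>\<^sup>+ \<omega>. ennreal (W \<omega> t * t) \<partial>M)"
    using sums by (intro nn_integral_mono_AE) (auto elim: eventually_mono)
  also have "\<dots> = (\<integral>\<^sup>+ \<omega>. ennreal (W \<omega> t) \<partial>M) * ennreal t"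
    using t W_nonneg W_meas[OF sees_mu_M, of t] by (subst nn_integral_multc[symmetric]) (auto simp: ennreal_mult)
  also have "\<dots> = ennreal (t * mean t)"
    using t mean_nonneg[OF t] by (simp add: W_expectation ennreal_mult[symmetric] mult.commute)
  finally show "(\<integral>\<^sup>+ \<omega>. emeasure (count_space UNIV) {i. 1 \<le> i \<and> Y i \<omega> \<in> {0..t}} \<partial>M) \<le> ennreal (t * mean t)"
    by (simp add: S_def)
qed

text \<open>A strictly increasing sequence staying below some \<open>u\<close> would put infinitely
  many points into a bounded interval.\<close>

lemma AE_points:
  "AE \<omega> in M. Y 0 \<omega> = 0 \<and> strict_mono (\<lambda>i. Y i \<omega>) \<and> (\<forall>u. \<exists>n. u \<le> Y n \<omega>)"
proof -
  have "AE \<omega> in M. \<forall>n::nat. finite {i. 1 \<le> i \<and> Y i \<omega> \<in> {0..real n}}"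
    unfolding AE_all_countable by (intro allI points_finite(1)) simp
  moreover have "AE \<omega> in M. Y 0 \<omega> = 0 \<and> strict_mono (\<lambda>i. Y i \<omega>)"
    using Y_points unfolding cond_poisson_points_def by (rule conjunct1)
  ultimately show ?thesis
  proof eventually_elim
    case (elim \<omega>)
    have "\<exists>n. u \<le> Y n \<omega>" for u
    proof (rule ccontr)
      assume "\<not> (\<exists>n. u \<le> Y n \<omega>)"
      then have lt: "Y n \<omega> < u" for n by (simp add: not_le)
      obtain m where m: "u \<le> real m" using real_arch_simple by blast
      have "0 \<le> Y i \<omega>" for i using elim by (metis le0 strict_mono_less_eq)
      then have "{1..} \<subseteq> {i. 1 \<le> i \<and> Y i \<omega> \<in> {0..real m}}"
        using less_le_trans[OF lt m] by (auto intro: less_imp_le)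
      then have "finite {1::nat..}" using elim finite_subset by blast
      then show False using infinite_Ici by blast
    qed
    then show ?case using elim by blast
  qed
qed

end

subsection \<open>The glue points\<close>

lemma exit_len_measurable:
  fixes y z :: "'w \<Rightarrow> nat \<Rightarrow> real"
  assumes y: "\<And>k. (\<lambda>\<omega>. y \<omega> k) \<in> borel_measurable N" and z: "\<And>k. k < n \<Longrightarrow> (\<lambda>\<omega>. z \<omega> k) \<in> borel_measurable N"
    and U: "U \<in> borel_measurable N"
  shows "(\<lambda>\<omega>. exit_len (y \<omega>) (z \<omega>) a n (U \<omega>) i) \<in> borel_measurable N"
  using z U
proof (induction n arbitrary: U)
  case (Suc n)
  have m1: "(\<lambda>\<omega>. exit_len (y \<omega>) (z \<omega>) a n (U \<omega>) i) \<in> borel_measurable N"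
    and m2: "(\<lambda>\<omega>. exit_len (y \<omega>) (z \<omega>) a n (z \<omega> n) i) \<in> borel_measurable N"
    using Suc by auto
  note [measurable] = m1 m2 y Suc.prems(2)
  show ?case unfolding exit_len.simps by measurable
qed simp

lemma path_len_measurable:
  fixes y z :: "'w \<Rightarrow> nat \<Rightarrow> real"
  assumes "\<And>k. (\<lambda>\<omega>. y \<omega> k) \<in> borel_measurable N" "\<And>k. k < n \<Longrightarrow> (\<lambda>\<omega>. z \<omega> k) \<in> borel_measurable N"
    and "U \<in> borel_measurable N"
  shows "(\<lambda>\<omega>. path_len (y \<omega>) (z \<omega>) a n (U \<omega>)) \<in> borel_measurable N"
  unfolding path_len_def by (intro borel_measurable_sum exit_len_measurable assms)

context icrt_space
begin

text \<open>As \<open>Y 0\<close> and \<open>Z 0\<close> vanish only almost surely, they are replaced by \<open>0\<close>.\<close>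

definition yy :: "'w \<Rightarrow> nat \<Rightarrow> real" where "yy \<omega> i = (if i = 0 then 0 else Y i \<omega>)"
definition zz :: "'w \<Rightarrow> nat \<Rightarrow> real" where "zz \<omega> i = (if i = 0 then 0 else Z i \<omega>)"

abbreviation FP :: "'w measure" where "FP \<equiv> measure_points_algebra M mu Y"

lemma space_FP [simp]: "space FP = space M"
  by (simp add: measure_points_algebra_def)

lemma yy_FP: "(\<lambda>\<omega>. yy \<omega> i) \<in> borel_measurable FP"
  unfolding yy_def using Y_points_meas[of i] by (cases "i = 0") auto

text \<open>Built from \<open>nu\<close> and \<open>yy\<close>, it is \<open>FP\<close>-measurable
  without exceptional sets. Where the mass of the interval is zero, the quotient
  \<open>0 / 0\<close> is zero, so in general it is only a subprobability.\<close>

definition glue_law :: "nat \<Rightarrow> 'w \<Rightarrow> real measure" where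
  "glue_law i \<omega> = uniform_measure (nu \<omega>) {0..yy \<omega> i}"

lemma sets_glue_law [simp, measurable_cong]: "sets (glue_law i \<omega>) = sets borel"
  by (simp add: glue_law_def)

lemma emeasure_glue_law:
  assumes "A \<in> sets borel"
  shows "emeasure (glue_law i \<omega>) A = emeasure (nu \<omega>) ({0..yy \<omega> i} \<inter> A) / ennreal (W \<omega> (yy \<omega> i))"
  unfolding glue_law_def using assms by (subst emeasure_uniform_measure) (auto simp: emeasure_nu)

lemma glue_law_meas:
  assumes "A \<in> sets borel" shows "(\<lambda>\<omega>. emeasure (glue_law i \<omega>) A) \<in> borel_measurable FP"
  unfolding emeasure_glue_law[OF assms]
  using nu_random_meas[OF sees_mu_points assms yy_FP] W_random_meas[OF sees_mu_points yy_FP]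
  by measurable

lemma glue_law_le_1: "emeasure (glue_law i \<omega>) A \<le> 1"
proof (cases "A \<in> sets borel")
  case True
  have "emeasure (nu \<omega>) ({0..yy \<omega> i} \<inter> A) \<le> ennreal (W \<omega> (yy \<omega> i))"
    unfolding emeasure_nu[symmetric] using True by (intro emeasure_mono) auto
  then have "emeasure (glue_law i \<omega>) A \<le> ennreal (W \<omega> (yy \<omega> i)) / ennreal (W \<omega> (yy \<omega> i))"
    unfolding emeasure_glue_law[OF True] by (intro divide_right_mono_ennreal)
  also have "\<dots> \<le> 1"
    by (cases "W \<omega> (yy \<omega> i) = 0") (auto simp: ennreal_divide_self W_nonneg less_le)
  finally show ?thesis .
qed (simp add: emeasure_notin_sets)

lemma subprob_glue_law: "subprob_space (glue_law i \<omega>)"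
proof
  show "emeasure (glue_law i \<omega>) (space (glue_law i \<omega>)) \<le> 1" by (rule glue_law_le_1)
  show "space (glue_law i \<omega>) \<noteq> {}" by (simp add: glue_law_def)
qed

section \<open>The law of a glue point given the cut points and the earlier glue points\<close>

text \<open>An intersection-stable generator of the information in \<open>mu\<close>, the cut points
  and the glue points before \<open>i\<close>.\<close>

definition past_sets :: "nat \<Rightarrow> 'w set set" where
  "past_sets i = {F \<inter> {\<omega> \<in> space M. \<forall>k\<in>{1..<i}. Z k \<omega> \<in> C k} |F C. F \<in> sets FP \<and> (\<forall>k. C k \<in> sets borel)}"

definition past :: "nat \<Rightarrow> 'w measure" where
  "past i = sigma (space M) (past_sets i)"

lemma past_sets_events: "past_sets i \<subseteq> events"
proof
  fix G assume "G \<in> past_sets i"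
  then obtain F C where G: "G = F \<inter> {\<omega> \<in> space M. \<forall>k\<in>{1..<i}. Z k \<omega> \<in> C k}"
    and F: "F \<in> sets FP" and C: "\<And>k. C k \<in> sets borel" by (auto simp: past_sets_def)
  have "{\<omega> \<in> space M. \<forall>k\<in>{1..<i}. Z k \<omega> \<in> C k} \<in> events"
    using Z_meas C by (intro sets.sets_Collect_finite_All) (auto intro: measurable_sets_Collect)
  moreover have "F \<in> events" using F subalgebra_points by (auto simp: subalgebra_def)
  ultimately show "G \<in> events" unfolding G by (intro sets.Int)
qed

lemma past_sets_Pow: "past_sets i \<subseteq> Pow (space M)"
  using past_sets_events sets.space_closed by blast

lemma space_past [simp]: "space (past i) = space M"
  unfolding past_def using past_sets_Pow by (rule space_measure_of)

lemma sets_past: "sets (past i) = sigma_sets (space M) (past_sets i)"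
  unfolding past_def using past_sets_Pow by (rule sets_measure_of)

lemma subalgebra_past: "subalgebra M (past i)"
  unfolding subalgebra_def sets_past using past_sets_events by (auto intro!: sets.sigma_sets_subset)

lemma past_setsI:
  assumes "F \<in> sets FP" "\<And>k. C k \<in> sets borel"
  shows "F \<inter> {\<omega> \<in> space M. \<forall>k\<in>{1..<i}. Z k \<omega> \<in> C k} \<in> past_sets i"
  using assms unfolding past_sets_def by blast

lemma FP_past: "sets FP \<subseteq> sets (past i)"
proof
  fix F assume F: "F \<in> sets FP"
  then have "F \<subseteq> space M" using sets.sets_into_space[OF F] by simp
  then have "F = F \<inter> {\<omega> \<in> space M. \<forall>k\<in>{1..<i}. Z k \<omega> \<in> UNIV}" by auto
  also have "\<dots> \<in> past_sets i" by (rule past_setsI[OF F]) simp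
  finally show "F \<in> sets (past i)" unfolding sets_past by (rule sigma_sets.Basic)
qed

lemma FP_past_measurable: "f \<in> borel_measurable FP \<Longrightarrow> f \<in> borel_measurable (past i)"
  using FP_past by (auto simp: measurable_def)

lemma Z_past:
  assumes "1 \<le> k" "k < i" shows "Z k \<in> borel_measurable (past i)"
proof (rule measurableI)
  fix A :: "real set" assume A: "A \<in> sets borel"
  have "Z k -` A \<inter> space (past i) = space M \<inter> {\<omega> \<in> space M. \<forall>j\<in>{1..<i}. Z j \<omega> \<in> (if j = k then A else UNIV)}"
    using assms by auto
  also have "\<dots> \<in> past_sets i"
    using A sets.top[of FP] by (intro past_setsI) auto
  finally show "Z k -` A \<inter> space (past i) \<in> sets (past i)" unfolding sets_past by (rule sigma_sets.Basic)
qed simp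

lemma zz_past: "k < i \<Longrightarrow> (\<lambda>\<omega>. zz \<omega> k) \<in> borel_measurable (past i)"
  unfolding zz_def using Z_past[of k i] by (cases "k = 0") auto

lemma glue_law_kernel: "glue_law i \<in> past j \<rightarrow>\<^sub>M subprob_algebra borel"
  by (rule measurable_subprob_algebra) (auto simp: subprob_glue_law glue_law_meas intro: FP_past_measurable)

lemma Z_cond:
  assumes f: "f \<in> borel_measurable FP" and C: "\<And>k. C k \<in> sets borel"
  shows "(\<integral>\<^sup>+ \<omega>. f \<omega> * indicator {\<omega> \<in> space M. \<forall>k\<in>{1..n}. Z k \<omega> \<in> C k} \<omega> \<partial>M)
       = (\<integral>\<^sup>+ \<omega>. f \<omega> * (\<Prod>k\<in>{1..n}. emeasure (glue_law k \<omega>) (C k)) \<partial>M)"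
proof -
  let ?E = "{\<omega> \<in> space M. \<forall>k\<in>{1..n}. Z k \<omega> \<in> C k}"
  have E: "?E \<in> events"
    using Z_meas C by (intro sets.sets_Collect_finite_All) (auto intro: measurable_sets_Collect)
  have "AE \<omega> in M. cond_prob M FP ?E \<omega> = (\<Prod>k\<in>{1..n}. measure (uniform_measure (mu \<omega>) {0..Y k \<omega>}) (C k))"
    using Z_laws C unfolding cond_indep_laws_def by blast
  then have ae: "AE \<omega> in M. ennreal (cond_prob M FP ?E \<omega>) = (\<Prod>k\<in>{1..n}. emeasure (glue_law k \<omega>) (C k))"
    using AE_good
  proof eventually_elim
    case (elim \<omega>)
    have "ennreal (cond_prob M FP ?E \<omega>) = (\<Prod>k\<in>{1..n}. ennreal (measure (glue_law k \<omega>) (C k)))"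
      unfolding elim(1) using elim(2)
      by (subst prod_ennreal) (auto intro!: arg_cong[where f = ennreal] prod.cong simp: glue_law_def nu_def yy_def)
    also have "\<dots> = (\<Prod>k\<in>{1..n}. emeasure (glue_law k \<omega>) (C k))"
    proof (intro prod.cong refl)
      fix k
      interpret subprob_space "glue_law k \<omega>" by (rule subprob_glue_law)
      show "ennreal (measure (glue_law k \<omega>) (C k)) = emeasure (glue_law k \<omega>) (C k)"
        by (simp add: emeasure_eq_measure)
    qed
    finally show ?case .
  qed
  show ?thesis
    unfolding nn_integral_cond_prob[OF subalgebra_points E f]
    by (intro nn_integral_cong_AE eventually_mono[OF ae]) simp
qed

text \<open>The hypothesis gives product formulas for the glue points up to \<open>i\<close> and up
  to \<open>i - 1\<close>. The factor belonging to \<open>Z i\<close> is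
  \<open>FP\<close>-measurable, so it can be moved into the weight, after which the second formula
  undoes the remaining product.\<close>

lemma Z_rectangle:
  assumes i: "1 \<le> i" and G: "G \<in> past_sets i" and A: "A \<in> sets borel"
  shows "emeasure M (G \<inter> {\<omega> \<in> space M. Z i \<omega> \<in> A}) = (\<integral>\<^sup>+ \<omega>. indicator G \<omega> * emeasure (glue_law i \<omega>) A \<partial>M)"
proof -
  obtain F C where G_eq: "G = F \<inter> {\<omega> \<in> space M. \<forall>k\<in>{1..<i}. Z k \<omega> \<in> C k}"
    and F: "F \<in> sets FP" and C: "\<And>k. C k \<in> sets borel" using G by (auto simp: past_sets_def)
  define C' where "C' k = (if k = i then A else C k)" for k
  have C': "C' k \<in> sets borel" for k using C A by (simp add: C'_def)
  have i': "{1..i} = insert i {1..<i}" "{1..i - 1} = {1..<i}" using i by auto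
  have Gi: "G \<inter> {\<omega> \<in> space M. Z i \<omega> \<in> A} = F \<inter> {\<omega> \<in> space M. \<forall>k\<in>{1..i}. Z k \<omega> \<in> C' k}"
    unfolding G_eq i'(1) by (auto simp: C'_def)
  have ev: "G \<inter> {\<omega> \<in> space M. Z i \<omega> \<in> A} \<in> events"
    using G past_sets_events A Z_meas[of i] by (intro sets.Int) (auto intro: measurable_sets_Collect)
  have Fi: "(indicator F :: 'w \<Rightarrow> ennreal) \<in> borel_measurable FP" using F by simp
  have "emeasure M (G \<inter> {\<omega> \<in> space M. Z i \<omega> \<in> A})
      = (\<integral>\<^sup>+ \<omega>. indicator (G \<inter> {\<omega> \<in> space M. Z i \<omega> \<in> A}) \<omega> \<partial>M)"
    by (rule nn_integral_indicator[OF ev, symmetric])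
  also have "\<dots> = (\<integral>\<^sup>+ \<omega>. indicator F \<omega> * indicator {\<omega> \<in> space M. \<forall>k\<in>{1..i}. Z k \<omega> \<in> C' k} \<omega> \<partial>M)"
    unfolding Gi by (intro nn_integral_cong) (simp only: indicator_inter_arith)
  also have "\<dots> = (\<integral>\<^sup>+ \<omega>. indicator F \<omega> * (\<Prod>k\<in>{1..i}. emeasure (glue_law k \<omega>) (C' k)) \<partial>M)"
    by (rule Z_cond[OF Fi C'])
  also have "\<dots> = (\<integral>\<^sup>+ \<omega>. (indicator F \<omega> * emeasure (glue_law i \<omega>) A) * (\<Prod>k\<in>{1..i-1}. emeasure (glue_law k \<omega>) (C k)) \<partial>M)"
    unfolding i' by (intro nn_integral_cong) (auto simp: C'_def mult.assoc intro!: arg_cong2[where f = "(*)"] prod.cong)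
  also have "\<dots> = (\<integral>\<^sup>+ \<omega>. (indicator F \<omega> * emeasure (glue_law i \<omega>) A)
        * indicator {\<omega> \<in> space M. \<forall>k\<in>{1..i-1}. Z k \<omega> \<in> C k} \<omega> \<partial>M)"
    using Fi glue_law_meas[OF A, of i] by (intro Z_cond[symmetric] C borel_measurable_times_ennreal)
  also have "\<dots> = (\<integral>\<^sup>+ \<omega>. indicator G \<omega> * emeasure (glue_law i \<omega>) A \<partial>M)"
    unfolding G_eq i' by (intro nn_integral_cong) (auto simp: indicator_def)
  finally show ?thesis .
qed

lemma Int_stable_past_sets: "Int_stable (past_sets i)"
proof (rule Int_stableI)
  fix G G' assume "G \<in> past_sets i" "G' \<in> past_sets i"
  then obtain F C F' C' where
    G: "G = F \<inter> {\<omega> \<in> space M. \<forall>k\<in>{1..<i}. Z k \<omega> \<in> C k}" "F \<in> sets FP" "\<And>k. C k \<in> sets borel" and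
    G': "G' = F' \<inter> {\<omega> \<in> space M. \<forall>k\<in>{1..<i}. Z k \<omega> \<in> C' k}" "F' \<in> sets FP" "\<And>k. C' k \<in> sets borel"
    unfolding past_sets_def by blast
  have "G \<inter> G' = (F \<inter> F') \<inter> {\<omega> \<in> space M. \<forall>k\<in>{1..<i}. Z k \<omega> \<in> C k \<inter> C' k}"
    unfolding G(1) G'(1) by blast
  also have "\<dots> \<in> past_sets i" using G G' by (intro past_setsI sets.Int)
  finally show "G \<inter> G' \<in> past_sets i" .
qed

lemma space_past_sets: "space M \<in> past_sets i"
  using past_setsI[of "space M" "\<lambda>_. UNIV" i] sets.top[of FP] by simp

text \<open>Both sides integrate over laws of a pair, which agree on rectangles by
  \<open>Z_rectangle\<close> and hence everywhere. The integrand may thus depend jointly on the past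
  and on \<open>Z i\<close>, as random intervals require.\<close>

lemma Z_kernel:
  assumes i: "1 \<le> i" and \<phi>: "\<phi> \<in> borel_measurable (past i \<Otimes>\<^sub>M borel)"
  shows "(\<integral>\<^sup>+ \<omega>. \<phi> (\<omega>, Z i \<omega>) \<partial>M) = (\<integral>\<^sup>+ \<omega>. \<integral>\<^sup>+ x. \<phi> (\<omega>, x) \<partial>glue_law i \<omega> \<partial>M)"
proof -
  let ?P = "past i \<Otimes>\<^sub>M (borel :: real measure)"
  let ?R = "restr_to_subalg M (past i)"
  \<comment> \<open>The point mass at \<open>\<omega>\<close> times the glue law, so that
    \<open>M \<bind> K\<close> is the law of a pair whose second component is drawn given the
    past.\<close>
  define K where "K \<omega> = distr (glue_law i \<omega>) ?P (Pair \<omega>)" for \<omega>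
  have idm: "(\<lambda>\<omega>. \<omega>) \<in> M \<rightarrow>\<^sub>M past i"
    using subalgebra_past by (auto simp: measurable_def subalgebra_def sets.sets_into_space Int_absorb2)
  have K: "K \<in> past i \<rightarrow>\<^sub>M subprob_algebra ?P"
    unfolding K_def by (rule measurable_distr2[OF _ glue_law_kernel]) simp
  have KR: "K \<in> ?R \<rightarrow>\<^sub>M subprob_algebra ?P"
    using K by (simp add: measurable_def space_restr_to_subalg sets_restr_to_subalg[OF subalgebra_past])
  have KM: "K \<in> M \<rightarrow>\<^sub>M subprob_algebra ?P" by (rule measurable_compose[OF idm K])
  have pairm: "(\<lambda>\<omega>. (\<omega>, Z i \<omega>)) \<in> M \<rightarrow>\<^sub>M ?P" using idm Z_meas[of i] by (rule measurable_Pair)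
  have Km: "Pair \<omega> \<in> glue_law i \<omega> \<rightarrow>\<^sub>M ?P" if "\<omega> \<in> space M" for \<omega>
  proof -
    have "Pair \<omega> \<in> borel \<rightarrow>\<^sub>M ?P" using that by (intro measurable_Pair1') simp
    then show ?thesis using measurable_cong_sets[OF sets_glue_law refl] by blast
  qed
  let ?E = "{a \<times> b |a b. a \<in> past_sets i \<and> b \<in> sets (borel :: real measure)}"
  have gen: "sets ?P = sigma_sets (space M \<times> UNIV) ?E"
  proof -
    have "sets ?P = sets (sigma (space (past i) \<times> space (borel :: real measure)) ?E)"
    proof (rule sets_pair_eq)
      show "past_sets i \<subseteq> Pow (space (past i))" using past_sets_Pow by simp
      show "sets (past i) = sigma_sets (space (past i)) (past_sets i)" by (simp add: sets_past)
      show "{space M} \<subseteq> past_sets i" using space_past_sets by simp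
      show "{UNIV} \<subseteq> sets (borel :: real measure)" by simp
      show "sets borel = sigma_sets (space borel) (sets (borel :: real measure))"
        by (simp only: sets.sigma_sets_eq)
    qed auto
    also have "\<dots> = sigma_sets (space M \<times> UNIV) ?E"
      using past_sets_Pow by (subst sets_measure_of) auto
    finally show ?thesis .
  qed
  have rect: "a \<times> b \<in> sets ?P" if "a \<in> past_sets i" "b \<in> sets borel" for a and b :: "real set"
    unfolding gen using that by (intro sigma_sets.Basic) blast
  have eq: "distr M ?P (\<lambda>\<omega>. (\<omega>, Z i \<omega>)) = M \<bind> K"
  proof (rule measure_eqI_generator_eq[where E = ?E and \<Omega> = "space M \<times> UNIV" and A = "\<lambda>_. space M \<times> UNIV"])
    show "Int_stable ?E"
    proof (rule Int_stableI)
      fix u v assume "u \<in> ?E" "v \<in> ?E"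
      then obtain a b a' b' where "u = a \<times> b" "v = a' \<times> b'" "a \<in> past_sets i" "a' \<in> past_sets i"
        "b \<in> sets borel" "b' \<in> sets borel" by blast
      then show "u \<inter> v \<in> ?E"
        using Int_stable_past_sets[of i] unfolding Int_stable_def Times_Int_Times by blast
    qed
    show "?E \<subseteq> Pow (space M \<times> UNIV)" using past_sets_Pow by blast
    show "sets (distr M ?P (\<lambda>\<omega>. (\<omega>, Z i \<omega>))) = sigma_sets (space M \<times> UNIV) ?E" by (simp add: gen)
    show "sets (M \<bind> K) = sigma_sets (space M \<times> UNIV) ?E"
      by (subst sets_bind[OF sets_kernel[OF KM]]) (auto simp: gen not_empty)
    have "space M \<times> (UNIV :: real set) \<in> ?E"
      by (rule CollectI, rule exI[of _ "space M"], rule exI[of _ UNIV]) (simp add: space_past_sets)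
    then show "range (\<lambda>_::nat. space M \<times> UNIV) \<subseteq> ?E" by blast
    show "emeasure (distr M ?P (\<lambda>\<omega>. (\<omega>, Z i \<omega>))) (space M \<times> UNIV) \<noteq> \<infinity>"
      using prob_space.emeasure_le_1[OF prob_space_distr[OF pairm], of "space M \<times> UNIV"]
      by (auto simp: top_unique)
    fix u assume "u \<in> ?E"
    then obtain a b where u: "u = a \<times> b" "a \<in> past_sets i" "b \<in> sets borel" by blast
    have am: "a \<subseteq> space M" using u past_sets_Pow by blast
    have "emeasure (distr M ?P (\<lambda>\<omega>. (\<omega>, Z i \<omega>))) u = emeasure M (a \<inter> {\<omega> \<in> space M. Z i \<omega> \<in> b})"
      using u rect am by (subst emeasure_distr[OF pairm]) (auto intro!: arg_cong[where f = "emeasure M"])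
    also have "\<dots> = (\<integral>\<^sup>+ \<omega>. indicator a \<omega> * emeasure (glue_law i \<omega>) b \<partial>M)"
      by (rule Z_rectangle[OF i u(2,3)])
    also have "\<dots> = (\<integral>\<^sup>+ \<omega>. emeasure (K \<omega>) u \<partial>M)"
    proof (intro nn_integral_cong)
      fix \<omega> assume \<omega>: "\<omega> \<in> space M"
      have "Pair \<omega> -` u \<inter> space (glue_law i \<omega>) = (if \<omega> \<in> a then b else {})"
        unfolding u by (auto simp: glue_law_def)
      then show "indicator a \<omega> * emeasure (glue_law i \<omega>) b = emeasure (K \<omega>) u"
        unfolding K_def using u rect by (subst emeasure_distr[OF Km[OF \<omega>]]) auto
    qed
    also have "\<dots> = emeasure (M \<bind> K) u"
      using u rect by (intro emeasure_bind[symmetric, OF _ KM]) (auto simp: not_empty)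
    finally show "emeasure (distr M ?P (\<lambda>\<omega>. (\<omega>, Z i \<omega>))) u = emeasure (M \<bind> K) u" .
  qed auto
  have "(\<integral>\<^sup>+ \<omega>. \<phi> (\<omega>, Z i \<omega>) \<partial>M) = (\<integral>\<^sup>+ p. \<phi> p \<partial>distr M ?P (\<lambda>\<omega>. (\<omega>, Z i \<omega>)))"
    using \<phi> by (subst nn_integral_distr[OF pairm]) auto
  also have "\<dots> = (\<integral>\<^sup>+ \<omega>. \<integral>\<^sup>+ p. \<phi> p \<partial>K \<omega> \<partial>M)"
    unfolding eq by (rule nn_integral_bind[OF \<phi> KM])
  also have "\<dots> = (\<integral>\<^sup>+ \<omega>. \<integral>\<^sup>+ x. \<phi> (\<omega>, x) \<partial>glue_law i \<omega> \<partial>M)"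
    unfolding K_def using \<phi> by (intro nn_integral_cong, subst nn_integral_distr[OF Km]) auto
  finally show ?thesis .
qed

lemma Z_interval:
  assumes i: "1 \<le> i" and R: "R \<in> borel_measurable (past i)"
    and U: "U \<in> borel_measurable (past i)" and V: "V \<in> borel_measurable (past i)"
  shows "(\<integral>\<^sup>+ \<omega>. R \<omega> * indicator {U \<omega><..V \<omega>} (Z i \<omega>) \<partial>M)
           = (\<integral>\<^sup>+ \<omega>. R \<omega> * emeasure (glue_law i \<omega>) {U \<omega><..V \<omega>} \<partial>M)"
proof -
  define \<phi> :: "'w \<times> real \<Rightarrow> ennreal" where
    "\<phi> p = R (fst p) * (if U (fst p) < snd p \<and> snd p \<le> V (fst p) then 1 else 0)" for p
  have \<phi>: "\<phi> \<in> borel_measurable (past i \<Otimes>\<^sub>M borel)"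
    unfolding \<phi>_def
    using measurable_compose[OF measurable_fst R] measurable_compose[OF measurable_fst U]
      measurable_compose[OF measurable_fst V]
    by measurable
  have e: "\<phi> (\<omega>, x) = R \<omega> * indicator {U \<omega><..V \<omega>} x" for \<omega> x
    by (simp add: \<phi>_def indicator_def)
  have "(\<integral>\<^sup>+ x. \<phi> (\<omega>, x) \<partial>glue_law i \<omega>) = R \<omega> * emeasure (glue_law i \<omega>) {U \<omega><..V \<omega>}" for \<omega>
    unfolding e by (subst nn_integral_cmult) auto
  then show ?thesis using Z_kernel[OF i \<phi>] by (simp add: e)
qed

lemma AE_Z_bounds: "AE \<omega> in M. \<forall>i\<ge>1. 0 \<le> Z i \<omega> \<and> Z i \<omega> \<le> yy \<omega> i"
proof -
  have "AE \<omega> in M. 0 \<le> Z i \<omega> \<and> Z i \<omega> \<le> yy \<omega> i" if i: "1 \<le> i" for i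
  proof -
    define \<phi> :: "'w \<times> real \<Rightarrow> ennreal" where
      "\<phi> p = (if 0 \<le> snd p \<and> snd p \<le> yy (fst p) i then 0 else 1)" for p
    have y: "(\<lambda>\<omega>. yy \<omega> i) \<in> borel_measurable (past i)" by (intro FP_past_measurable yy_FP)
    have \<phi>: "\<phi> \<in> borel_measurable (past i \<Otimes>\<^sub>M borel)"
      unfolding \<phi>_def using measurable_compose[OF measurable_fst y] by measurable
    have "(\<integral>\<^sup>+ x. \<phi> (\<omega>, x) \<partial>glue_law i \<omega>) = 0" for \<omega>
    proof -
      have "(\<integral>\<^sup>+ x. \<phi> (\<omega>, x) \<partial>glue_law i \<omega>) = (\<integral>\<^sup>+ x. indicator (- {0..yy \<omega> i}) x \<partial>glue_law i \<omega>)"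
        by (intro nn_integral_cong) (auto simp: \<phi>_def indicator_def)
      also have "\<dots> = emeasure (glue_law i \<omega>) (- {0..yy \<omega> i})" by (intro nn_integral_indicator) simp
      also have "\<dots> = 0" by (subst emeasure_glue_law) auto
      finally show ?thesis .
    qed
    then have "(\<integral>\<^sup>+ \<omega>. \<phi> (\<omega>, Z i \<omega>) \<partial>M) = 0" using Z_kernel[OF i \<phi>] by simp
    moreover have "(\<lambda>\<omega>. \<phi> (\<omega>, Z i \<omega>)) \<in> borel_measurable M"
    proof -
      have "(\<lambda>\<omega>. yy \<omega> i) \<in> borel_measurable M"
        using Y_meas[of i] by (cases "i = 0") (simp_all add: yy_def)
      then show ?thesis unfolding \<phi>_def using Z_meas[of i] by simp
    qed
    ultimately have "AE \<omega> in M. \<phi> (\<omega>, Z i \<omega>) = 0" by (simp add: nn_integral_0_iff_AE)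
    then show ?thesis by eventually_elim (auto simp: \<phi>_def split: if_splits)
  qed
  then show ?thesis unfolding AE_all_countable by (intro allI) (auto elim: eventually_mono)
qed

lemma AE_tree: "AE \<omega> in M. stick_tree (yy \<omega>) (zz \<omega>)"
  using AE_points AE_Z_bounds
proof eventually_elim
  case (elim \<omega>)
  have yy: "yy \<omega> = (\<lambda>i. Y i \<omega>)" using elim(1) by (auto simp: yy_def fun_eq_iff)
  show ?case
  proof
    show "strict_mono (yy \<omega>)" "\<exists>n. u \<le> yy \<omega> n" for u using elim(1) by (auto simp: yy)
    show "yy \<omega> 0 = 0" "zz \<omega> 0 = 0" by (simp_all add: yy_def zz_def)
    show "0 \<le> zz \<omega> i \<and> zz \<omega> i \<le> yy \<omega> i" for i using elim(2) by (cases "i = 0") (auto simp: zz_def yy_def)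
  qed
qed

lemma AE_yy_eq: "AE \<omega> in M. yy \<omega> = (\<lambda>i. Y i \<omega>) \<and> zz \<omega> = (\<lambda>i. Z i \<omega>)"
  using AE_points Z_0 by eventually_elim (auto simp: yy_def zz_def fun_eq_iff)

end

subsection \<open>Distances to a subtree\<close>

context stick_tree
begin

lemma path_len_stable:
  assumes "u \<le> y n" shows "path_len y z a (n + k) u = path_len y z a n u"
proof (induction k)
  case (Suc k)
  have "y n \<le> y (n + k)" by (simp add: y_le)
  with assms have "u \<le> y (n + k)" by linarith
  with Suc show ?case by (simp add: path_len_Suc)
qed simp

lemma path_len_eq_0:
  assumes "0 \<le> u" "u \<le> y n" "u \<le> a" shows "path_len y z a n u = 0"
  using assms
proof (induction n)
  case (Suc n) then show ?case by (auto simp: path_len_Suc)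
qed (simp add: path_len_def)

text \<open>The glue point lies on an earlier stick \<open>j\<close>; descending from it uses at
  most the whole part of that stick beyond \<open>a\<close> and continues from the base of stick
  \<open>j\<close>. Replacing the position in the stick by its end makes the recursion depend only
  on which stick is hit.\<close>

lemma path_len_step:
  assumes "0 \<le> a" "a < z i"
  obtains j where "j < i" "max a (y j) < z i" "z i \<le> max a (y (Suc j))"
    "path_len y z a i (z i) \<le> (max a (y (Suc j)) - max a (y j)) + (if y j \<le> a then 0 else path_len y z a j (z j))"
proof -
  have "0 \<le> z i" using z_le by blast
  obtain j where j: "y j < z i" "z i \<le> y (Suc j)"
    by (rule stick_cases[OF \<open>0 \<le> z i\<close>]) (use assms in auto)
  have "j < i"
  proof (rule ccontr)
    assume "\<not> j < i"
    then have "y i \<le> y j" by (simp add: y_le)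
    then show False using j z_le[of i] by linarith
  qed
  then obtain k where "i = Suc j + k" using less_iff_Suc_add by auto
  then have "path_len y z a i (z i) = path_len y z a (Suc j) (z i)"
    using path_len_stable[OF j(2)] by simp
  also have "\<dots> = max 0 (z i - max a (y j)) + (if y j \<le> a then 0 else path_len y z a j (z j))"
    using j by (simp add: path_len_Suc)
  also have "\<dots> \<le> (max a (y (Suc j)) - max a (y j)) + (if y j \<le> a then 0 else path_len y z a j (z j))"
    using j y_le[of j "Suc j"] by auto
  finally show ?thesis using \<open>j < i\<close> j assms by (intro that[of j]) auto
qed

end

context icrt_space
begin

definition yh :: "real \<Rightarrow> nat \<Rightarrow> 'w \<Rightarrow> real" where
  "yh a j \<omega> = max a (yy \<omega> j)"

text \<open>The distance from the base of stick \<open>j\<close>, identified with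
  \<open>zz \<omega> j\<close>, to the subtree \<open>[0, a]\<close>; it is zero if the stick starts
  inside the subtree.\<close>

definition root_len :: "real \<Rightarrow> nat \<Rightarrow> 'w \<Rightarrow> real" where
  "root_len a j \<omega> = (if yy \<omega> j \<le> a then 0 else path_len (yy \<omega>) (zz \<omega>) a j (zz \<omega> j))"

definition stick_exp :: "real \<Rightarrow> real \<Rightarrow> nat \<Rightarrow> 'w \<Rightarrow> real" where
  "stick_exp \<kappa> a j \<omega> = exp (\<kappa> * (yh a (Suc j) \<omega> - yh a j \<omega>))"

text \<open>The solution of a discrete Gronwall recursion: one factor per stick, with the relative
  mass of the stick weighted by the exponential of its length.\<close>

definition growth :: "real \<Rightarrow> real \<Rightarrow> nat \<Rightarrow> 'w \<Rightarrow> real" where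
  "growth \<kappa> a i \<omega> = (\<Prod>j<i. 1 + stick_exp \<kappa> a j \<omega> * ((W \<omega> (yh a (Suc j) \<omega>) - W \<omega> (yh a j \<omega>)) / W \<omega> (yh a j \<omega>)))"

lemma yh_FP: "yh a j \<in> borel_measurable FP"
  unfolding yh_def using yy_FP[of j] by measurable

lemma stick_exp_FP: "stick_exp \<kappa> a j \<in> borel_measurable FP"
  unfolding stick_exp_def using yh_FP by measurable

lemma W_yh_FP: "(\<lambda>\<omega>. W \<omega> (yh a j \<omega>)) \<in> borel_measurable FP"
  by (rule W_random_meas[OF sees_mu_points yh_FP])

lemma growth_FP: "growth \<kappa> a i \<in> borel_measurable FP"
  unfolding growth_def using W_yh_FP stick_exp_FP by measurable

lemma root_len_meas:
  assumes "\<And>k. (\<lambda>\<omega>. yy \<omega> k) \<in> borel_measurable N" "\<And>k. k \<le> j \<Longrightarrow> (\<lambda>\<omega>. zz \<omega> k) \<in> borel_measurable N"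
  shows "root_len a j \<in> borel_measurable N"
proof -
  have [measurable]: "(\<lambda>\<omega>. path_len (yy \<omega>) (zz \<omega>) a j (zz \<omega> j)) \<in> borel_measurable N"
    using assms by (intro path_len_measurable) auto
  show ?thesis unfolding root_len_def using assms(1)[of j] by measurable
qed

lemma root_len_past: "j < i \<Longrightarrow> root_len a j \<in> borel_measurable (past i)"
  by (intro root_len_meas FP_past_measurable yy_FP zz_past) auto

text \<open>Case distinction on the stick hit by \<open>Z i\<close>. All intervals are open on the
  left, so that they are disjoint; \<open>-1\<close> lets the lowest one contain
  \<open>0\<close>.\<close>

lemma exp_root_len_step:
  assumes "stick_tree (yy \<omega>) (zz \<omega>)" and a: "0 \<le> a" and \<kappa>: "0 \<le> \<kappa>" and i: "1 \<le> i"
  shows "ennreal (exp (\<kappa> * root_len a i \<omega>)) \<le> (if yy \<omega> i \<le> a then 1 else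
           indicator {-1<..a} (Z i \<omega>)
           + (\<Sum>j<i. indicator {yh a j \<omega><..yh a (Suc j) \<omega>} (Z i \<omega>)
                * ennreal (stick_exp \<kappa> a j \<omega> * exp (\<kappa> * root_len a j \<omega>))))"
proof (cases "yy \<omega> i \<le> a")
  case True
  then show ?thesis by (simp add: root_len_def)
next
  case False
  interpret stick_tree "yy \<omega>" "zz \<omega>" by fact
  have zi: "zz \<omega> i = Z i \<omega>" using i by (simp add: zz_def)
  have z: "0 \<le> Z i \<omega>" "Z i \<omega> \<le> yy \<omega> i" using z_le[of i] zi by auto
  show ?thesis
  proof (cases "Z i \<omega> \<le> a")
    case True
    then have "root_len a i \<omega> = 0"
      using path_len_eq_0[of "Z i \<omega>" i a] z zi by (simp add: root_len_def)
    then show ?thesis using False True z by (simp add: indicator_def)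
  next
    case gt: False
    then obtain j where j: "j < i" "max a (yy \<omega> j) < Z i \<omega>" "Z i \<omega> \<le> max a (yy \<omega> (Suc j))"
      and le: "path_len (yy \<omega>) (zz \<omega>) a i (Z i \<omega>) \<le> (max a (yy \<omega> (Suc j)) - max a (yy \<omega> j)) + root_len a j \<omega>"
      using path_len_step[of a i] a zi unfolding root_len_def by (metis not_le)
    have "\<kappa> * root_len a i \<omega> \<le> \<kappa> * (yh a (Suc j) \<omega> - yh a j \<omega>) + \<kappa> * root_len a j \<omega>"
      unfolding distrib_left[symmetric] using le False zi \<kappa> by (intro mult_left_mono) (auto simp: root_len_def yh_def)
    then have "ennreal (exp (\<kappa> * root_len a i \<omega>)) \<le> ennreal (stick_exp \<kappa> a j \<omega> * exp (\<kappa> * root_len a j \<omega>))"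
      by (intro ennreal_leI) (simp add: stick_exp_def exp_add[symmetric])
    also have "\<dots> = indicator {yh a j \<omega><..yh a (Suc j) \<omega>} (Z i \<omega>) * ennreal (stick_exp \<kappa> a j \<omega> * exp (\<kappa> * root_len a j \<omega>))"
      using j by (simp add: yh_def)
    also have "\<dots> \<le> (\<Sum>j<i. indicator {yh a j \<omega><..yh a (Suc j) \<omega>} (Z i \<omega>)
                * ennreal (stick_exp \<kappa> a j \<omega> * exp (\<kappa> * root_len a j \<omega>)))"
      using j by (intro member_le_sum) auto
    finally show ?thesis using False by (auto intro: add_increasing)
  qed
qed

lemma growth_Suc_diff:
  "growth \<kappa> a (Suc j) \<omega> - growth \<kappa> a j \<omega>
     = stick_exp \<kappa> a j \<omega> * (W \<omega> (yh a (Suc j) \<omega>) - W \<omega> (yh a j \<omega>)) * (growth \<kappa> a j \<omega> / W \<omega> (yh a j \<omega>))"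
  by (simp add: growth_def algebra_simps)

text \<open>A discrete Duhamel formula: by \<open>growth_Suc_diff\<close> the sum telescopes down to
  the empty product.\<close>

lemma growth_eq_sum:
  "1 + (\<Sum>j<i. stick_exp \<kappa> a j \<omega> * (W \<omega> (yh a (Suc j) \<omega>) - W \<omega> (yh a j \<omega>)) * (growth \<kappa> a j \<omega> / W \<omega> (yh a j \<omega>)))
     = growth \<kappa> a i \<omega>"
  using sum_lessThan_telescope[of "\<lambda>j. growth \<kappa> a j \<omega>" i]
  unfolding growth_Suc_diff by (simp add: growth_def[of _ _ 0])

lemma growth_ge_1:
  assumes "stick_tree (yy \<omega>) (zz \<omega>)" shows "1 \<le> growth \<kappa> a i \<omega>"
proof -
  interpret stick_tree "yy \<omega>" "zz \<omega>" by fact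
  have "0 \<le> stick_exp \<kappa> a j \<omega> * ((W \<omega> (yh a (Suc j) \<omega>) - W \<omega> (yh a j \<omega>)) / W \<omega> (yh a j \<omega>))" for j
    using y_le[of j "Suc j"] W_nonneg W_mono[of "yh a j \<omega>" "yh a (Suc j) \<omega>" \<omega>]
    by (intro mult_nonneg_nonneg divide_nonneg_nonneg) (auto simp: stick_exp_def yh_def)
  then show ?thesis unfolding growth_def by (intro prod_ge_1) simp
qed

text \<open>
  Conditionally on \<open>mu\<close> and the cut points, the expectation of the exponential of the distance from
  a glue point to \<open>[0, a]\<close> satisfies a linear recursion, which is solved by a product over the sticks.
\<close>

lemma exp_root_len_bound:
  assumes f: "f \<in> borel_measurable FP" and a: "0 \<le> a" and \<kappa>: "0 \<le> \<kappa>"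
    and pos: "\<And>\<omega>. \<omega> \<in> space M \<Longrightarrow> f \<omega> \<noteq> 0 \<Longrightarrow> 0 < W \<omega> a"
  shows "(\<integral>\<^sup>+ \<omega>. f \<omega> * ennreal (exp (\<kappa> * root_len a i \<omega>)) \<partial>M)
           \<le> (\<integral>\<^sup>+ \<omega>. f \<omega> * ennreal (growth \<kappa> a i \<omega> * (W \<omega> a / W \<omega> (yh a i \<omega>))) \<partial>M)"
  using f pos
proof (induction i arbitrary: f rule: less_induct)
  case (less i)
  note f = less.prems(1) and pos = less.prems(2)
  show ?case
  proof (cases "i = 0")
    case True
    have "f \<omega> * ennreal (exp (\<kappa> * root_len a 0 \<omega>)) \<le> f \<omega> * ennreal (growth \<kappa> a 0 \<omega> * (W \<omega> a / W \<omega> (yh a 0 \<omega>)))"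
      if "\<omega> \<in> space M" for \<omega>
    proof (cases "f \<omega> = 0")
      case False
      then show ?thesis using pos[OF that] a by (simp add: root_len_def yy_def growth_def yh_def)
    qed simp
    then show ?thesis unfolding True by (intro nn_integral_mono)
  next
    case False
    then have i: "1 \<le> i" by simp
    \<comment> \<open>A stick that starts inside \<open>[0, a]\<close> has nothing to estimate;
      \<open>D\<close> keeps the weight of the other case.\<close>
    define D0 where "D0 \<omega> = (if yy \<omega> i \<le> a then f \<omega> else 0)" for \<omega>
    define D where "D \<omega> = (if yy \<omega> i \<le> a then 0 else f \<omega>)" for \<omega>
    note [measurable] = f yy_FP stick_exp_FP yh_FP glue_law_meas
    have D0m: "D0 \<in> borel_measurable FP" and Dm: "D \<in> borel_measurable FP"
      unfolding D0_def D_def by measurable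
    note toM = measurable_from_subalg[OF subalgebra_points]
    note topast = FP_past_measurable[of _ i]
    note pastM = measurable_from_subalg[OF subalgebra_past[of i]]
    have root: "root_len a j \<in> borel_measurable (past i)" if "j < i" for j
      by (rule root_len_past[OF that])
    \<comment> \<open>Random intervals are handled by \<open>nu_random_meas\<close> when they start
      at zero, so the half-open one is written as a difference. The inner minimum keeps the
      inclusion valid also off the almost sure event on which \<open>yh\<close> increases.\<close>
    have interval: "(\<lambda>\<omega>. emeasure (glue_law i \<omega>) {yh a j \<omega><..yh a (Suc j) \<omega>}) \<in> borel_measurable FP" for j
    proof -
      have "emeasure (glue_law i \<omega>) {yh a j \<omega><..yh a (Suc j) \<omega>}
          = emeasure (nu \<omega>) ({0..yy \<omega> i} \<inter> {yh a j \<omega><..yh a (Suc j) \<omega>}) / ennreal (W \<omega> (yy \<omega> i))" for \<omega>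
        by (rule emeasure_glue_law) simp
      moreover have "{0..yy \<omega> i} \<inter> {yh a j \<omega><..yh a (Suc j) \<omega>} 
          = ({0..min (yy \<omega> i) (yh a (Suc j) \<omega>)} \<inter> UNIV) - ({0..min (yy \<omega> i) (min (yh a j \<omega>) (yh a (Suc j) \<omega>))} \<inter> UNIV)" for \<omega>
        using a by (auto simp: yh_def)
      moreover have "emeasure (nu \<omega>) (({0..min (yy \<omega> i) (yh a (Suc j) \<omega>)} \<inter> UNIV)
            - ({0..min (yy \<omega> i) (min (yh a j \<omega>) (yh a (Suc j) \<omega>))} \<inter> UNIV))
          = emeasure (nu \<omega>) ({0..min (yy \<omega> i) (yh a (Suc j) \<omega>)} \<inter> UNIV)
            - emeasure (nu \<omega>) ({0..min (yy \<omega> i) (min (yh a j \<omega>) (yh a (Suc j) \<omega>))} \<inter> UNIV)" for \<omega>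
        using nu_finite[of \<omega> _ UNIV] by (intro emeasure_Diff) (auto simp: less_top)
      ultimately show ?thesis
        using nu_random_meas[OF sees_mu_points, of UNIV] W_random_meas[OF sees_mu_points yy_FP] by simp
    qed
    define T where "T j \<omega> = D \<omega> * ennreal (stick_exp \<kappa> a j \<omega>) * ennreal (exp (\<kappa> * root_len a j \<omega>))" for j \<omega>
    have Tm: "T j \<in> borel_measurable (past i)" if "j < i" for j
      unfolding T_def using topast[OF Dm] topast[OF stick_exp_FP] root[OF that] by measurable
    have "(\<integral>\<^sup>+ \<omega>. f \<omega> * ennreal (exp (\<kappa> * root_len a i \<omega>)) \<partial>M)
        \<le> (\<integral>\<^sup>+ \<omega>. D0 \<omega> + (D \<omega> * indicator {-1<..a} (Z i \<omega>)
             + (\<Sum>j<i. T j \<omega> * indicator {yh a j \<omega><..yh a (Suc j) \<omega>} (Z i \<omega>))) \<partial>M)"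
    proof (intro nn_integral_mono_AE eventually_mono[OF AE_tree])
      fix \<omega> assume st: "stick_tree (yy \<omega>) (zz \<omega>)"
      have "f \<omega> * ennreal (exp (\<kappa> * root_len a i \<omega>)) \<le> f \<omega> * (if yy \<omega> i \<le> a then 1 else
           indicator {-1<..a} (Z i \<omega>)
           + (\<Sum>j<i. indicator {yh a j \<omega><..yh a (Suc j) \<omega>} (Z i \<omega>)
                * ennreal (stick_exp \<kappa> a j \<omega> * exp (\<kappa> * root_len a j \<omega>))))"
        by (intro mult_left_mono exp_root_len_step[OF st a \<kappa> i]) simp
      also have "\<dots> = D0 \<omega> + (D \<omega> * indicator {-1<..a} (Z i \<omega>)
             + (\<Sum>j<i. T j \<omega> * indicator {yh a j \<omega><..yh a (Suc j) \<omega>} (Z i \<omega>)))"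
        by (simp add: D0_def D_def T_def distrib_left sum_distrib_left ennreal_mult stick_exp_def mult_ac)
      finally show "f \<omega> * ennreal (exp (\<kappa> * root_len a i \<omega>)) \<le> D0 \<omega> + (D \<omega> * indicator {-1<..a} (Z i \<omega>)
             + (\<Sum>j<i. T j \<omega> * indicator {yh a j \<omega><..yh a (Suc j) \<omega>} (Z i \<omega>)))" .
    qed
    also have "\<dots> = (\<integral>\<^sup>+ \<omega>. D0 \<omega> \<partial>M) + ((\<integral>\<^sup>+ \<omega>. D \<omega> * indicator {-1<..a} (Z i \<omega>) \<partial>M)
             + (\<Sum>j<i. \<integral>\<^sup>+ \<omega>. T j \<omega> * indicator {yh a j \<omega><..yh a (Suc j) \<omega>} (Z i \<omega>) \<partial>M))"
    proof -
      have [measurable]: "Z i \<in> borel_measurable M" "D0 \<in> borel_measurable M" "D \<in> borel_measurable M"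
        using Z_meas toM D0m Dm by auto
      have [measurable]: "yh a j \<in> borel_measurable M" for j by (rule toM[OF yh_FP])
      have 1: "(\<lambda>\<omega>. D \<omega> * indicator {-1<..a} (Z i \<omega>)) \<in> borel_measurable M" by measurable
      have 2: "(\<lambda>\<omega>. T j \<omega> * indicator {yh a j \<omega><..yh a (Suc j) \<omega>} (Z i \<omega>)) \<in> borel_measurable M" if "j < i" for j
      proof -
        have [measurable]: "T j \<in> borel_measurable M" by (rule pastM[OF Tm[OF that]])
        have "(\<lambda>\<omega>. T j \<omega> * (if yh a j \<omega> < Z i \<omega> \<and> Z i \<omega> \<le> yh a (Suc j) \<omega> then 1 else 0)) \<in> borel_measurable M"
          by measurable
        then show ?thesis by (simp add: indicator_def of_bool_def)
      qed
      show ?thesis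
        using 1 2 by (subst nn_integral_add, measurable, subst nn_integral_add, measurable, subst nn_integral_sum) auto
    qed
    also have "(\<integral>\<^sup>+ \<omega>. D \<omega> * indicator {-1<..a} (Z i \<omega>) \<partial>M) = (\<integral>\<^sup>+ \<omega>. D \<omega> * emeasure (glue_law i \<omega>) {-1<..a} \<partial>M)"
      using Z_interval[OF i topast[OF Dm], of "\<lambda>_. -1" "\<lambda>_. a"] by simp
    also have "(\<Sum>j<i. \<integral>\<^sup>+ \<omega>. T j \<omega> * indicator {yh a j \<omega><..yh a (Suc j) \<omega>} (Z i \<omega>) \<partial>M)
        \<le> (\<Sum>j<i. \<integral>\<^sup>+ \<omega>. D \<omega> * ennreal (stick_exp \<kappa> a j \<omega>) * emeasure (glue_law i \<omega>) {yh a j \<omega><..yh a (Suc j) \<omega>}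
             * ennreal (growth \<kappa> a j \<omega> * (W \<omega> a / W \<omega> (yh a j \<omega>))) \<partial>M)"
    proof (intro sum_mono)
      fix j assume "j \<in> {..<i}"
      then have j: "j < i" by simp
      have "(\<integral>\<^sup>+ \<omega>. T j \<omega> * indicator {yh a j \<omega><..yh a (Suc j) \<omega>} (Z i \<omega>) \<partial>M)
          = (\<integral>\<^sup>+ \<omega>. T j \<omega> * emeasure (glue_law i \<omega>) {yh a j \<omega><..yh a (Suc j) \<omega>} \<partial>M)"
        by (rule Z_interval[OF i Tm[OF j] topast[OF yh_FP] topast[OF yh_FP]])
      also have "\<dots> = (\<integral>\<^sup>+ \<omega>. (D \<omega> * ennreal (stick_exp \<kappa> a j \<omega>) * emeasure (glue_law i \<omega>) {yh a j \<omega><..yh a (Suc j) \<omega>})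
          * ennreal (exp (\<kappa> * root_len a j \<omega>)) \<partial>M)"
        by (simp add: T_def mult_ac)
      \<comment> \<open>The exponential of the stick and the probability of hitting it depend on
        \<open>mu\<close> and the cut points only, so they join the weight in the induction
        hypothesis. This is why the bound is stated for every \<open>f\<close>.\<close>
      also have "\<dots> \<le> (\<integral>\<^sup>+ \<omega>. (D \<omega> * ennreal (stick_exp \<kappa> a j \<omega>) * emeasure (glue_law i \<omega>) {yh a j \<omega><..yh a (Suc j) \<omega>})
             * ennreal (growth \<kappa> a j \<omega> * (W \<omega> a / W \<omega> (yh a j \<omega>))) \<partial>M)"
        using Dm stick_exp_FP[of \<kappa> a j] interval[of j] pos
        by (intro less.IH j) (auto simp: D_def split: if_splits)
      finally show "(\<integral>\<^sup>+ \<omega>. T j \<omega> * indicator {yh a j \<omega><..yh a (Suc j) \<omega>} (Z i \<omega>) \<partial>M)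
        \<le> (\<integral>\<^sup>+ \<omega>. D \<omega> * ennreal (stick_exp \<kappa> a j \<omega>) * emeasure (glue_law i \<omega>) {yh a j \<omega><..yh a (Suc j) \<omega>}
             * ennreal (growth \<kappa> a j \<omega> * (W \<omega> a / W \<omega> (yh a j \<omega>))) \<partial>M)" .
    qed
    also have "(\<integral>\<^sup>+ \<omega>. D0 \<omega> \<partial>M) + ((\<integral>\<^sup>+ \<omega>. D \<omega> * emeasure (glue_law i \<omega>) {-1<..a} \<partial>M)
        + (\<Sum>j<i. \<integral>\<^sup>+ \<omega>. D \<omega> * ennreal (stick_exp \<kappa> a j \<omega>) * emeasure (glue_law i \<omega>) {yh a j \<omega><..yh a (Suc j) \<omega>}
             * ennreal (growth \<kappa> a j \<omega> * (W \<omega> a / W \<omega> (yh a j \<omega>))) \<partial>M))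
      = (\<integral>\<^sup>+ \<omega>. D0 \<omega> + (D \<omega> * emeasure (glue_law i \<omega>) {-1<..a}
        + (\<Sum>j<i. D \<omega> * ennreal (stick_exp \<kappa> a j \<omega>) * emeasure (glue_law i \<omega>) {yh a j \<omega><..yh a (Suc j) \<omega>}
             * ennreal (growth \<kappa> a j \<omega> * (W \<omega> a / W \<omega> (yh a j \<omega>))))) \<partial>M)"
    proof -
      have [measurable]: "D0 \<in> borel_measurable M" "D \<in> borel_measurable M"
        "(\<lambda>\<omega>. emeasure (glue_law i \<omega>) {-1<..a}) \<in> borel_measurable M" "(\<lambda>\<omega>. W \<omega> a) \<in> borel_measurable M"
        using toM[OF D0m] toM[OF Dm] toM[OF glue_law_meas[of "{-1<..a}" i]] W_meas[OF sees_mu_M] by auto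
      have [measurable]: "stick_exp \<kappa> a j \<in> borel_measurable M" "growth \<kappa> a j \<in> borel_measurable M"
         "(\<lambda>\<omega>. W \<omega> (yh a j \<omega>)) \<in> borel_measurable M"
        "(\<lambda>\<omega>. emeasure (glue_law i \<omega>) {yh a j \<omega><..yh a (Suc j) \<omega>}) \<in> borel_measurable M" for j
        using toM[OF stick_exp_FP] toM[OF growth_FP] toM[OF W_yh_FP] toM[OF interval] by auto
      show ?thesis
        by (simp add: nn_integral_add nn_integral_sum)
    qed
    also have "\<dots> \<le> (\<integral>\<^sup>+ \<omega>. f \<omega> * ennreal (growth \<kappa> a i \<omega> * (W \<omega> a / W \<omega> (yh a i \<omega>))) \<partial>M)"
    proof (intro nn_integral_mono_AE, use AE_tree AE_space in eventually_elim)
      fix \<omega> assume st: "stick_tree (yy \<omega>) (zz \<omega>)" and \<omega>: "\<omega> \<in> space M"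
      interpret stick_tree "yy \<omega>" "zz \<omega>" by fact
      have g1: "1 \<le> growth \<kappa> a j \<omega>" for j by (rule growth_ge_1[OF st])
      show "D0 \<omega> + (D \<omega> * emeasure (glue_law i \<omega>) {-1<..a}
        + (\<Sum>j<i. D \<omega> * ennreal (stick_exp \<kappa> a j \<omega>) * emeasure (glue_law i \<omega>) {yh a j \<omega><..yh a (Suc j) \<omega>}
             * ennreal (growth \<kappa> a j \<omega> * (W \<omega> a / W \<omega> (yh a j \<omega>)))))
        \<le> f \<omega> * ennreal (growth \<kappa> a i \<omega> * (W \<omega> a / W \<omega> (yh a i \<omega>)))"
      proof (cases "f \<omega> = 0")
        case True
        then show ?thesis by (simp add: D0_def D_def)
      next
        case False
        then have Wa: "0 < W \<omega> a" using pos[OF \<omega>] by simp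
        show ?thesis
        proof (cases "yy \<omega> i \<le> a")
          case True
          then have "1 \<le> growth \<kappa> a i \<omega> * (W \<omega> a / W \<omega> (yh a i \<omega>))"
            using g1[of i] Wa by (simp add: yh_def max_def)
          then have "f \<omega> * 1 \<le> f \<omega> * ennreal (growth \<kappa> a i \<omega> * (W \<omega> a / W \<omega> (yh a i \<omega>)))"
            by (intro mult_left_mono) auto
          then show ?thesis using True by (simp add: D0_def D_def)
        next
          case gt: False
          define w where "w = W \<omega> (yy \<omega> i)"
          have w: "0 < w" using W_mono[of a "yy \<omega> i" \<omega>] Wa gt by (simp add: w_def)
          have yhi: "yh a i \<omega> = yy \<omega> i" using gt by (simp add: yh_def)
          have p0: "emeasure (glue_law i \<omega>) {-1<..a} = ennreal (W \<omega> a / w)"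
          proof -
            have "{0..yy \<omega> i} \<inter> {-1<..a} = {0..a}" using gt by auto
            then show ?thesis
              using w W_nonneg by (simp add: emeasure_glue_law emeasure_nu w_def[symmetric] divide_ennreal)
          qed
          have pj: "emeasure (glue_law i \<omega>) {yh a j \<omega><..yh a (Suc j) \<omega>}
              = ennreal ((W \<omega> (yh a (Suc j) \<omega>) - W \<omega> (yh a j \<omega>)) / w)" if "j < i" for j
          proof -
            have "yy \<omega> (Suc j) \<le> yy \<omega> i" using y_le[of "Suc j" i] that by simp
            then have le: "yh a (Suc j) \<omega> \<le> yy \<omega> i" using gt by (simp add: yh_def)
            have mono: "0 \<le> yh a j \<omega>" "yh a j \<omega> \<le> yh a (Suc j) \<omega>" using a y_le[of j "Suc j"] by (auto simp: yh_def)
            have "{0..yy \<omega> i} \<inter> {yh a j \<omega><..yh a (Suc j) \<omega>} = {yh a j \<omega><..yh a (Suc j) \<omega>}"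
              using le mono by auto
            then show ?thesis
              using w mono W_mono[OF mono(2), of \<omega>]
              by (simp add: emeasure_glue_law nu_Ioc w_def[symmetric] divide_ennreal)
          qed
          have wj: "0 \<le> W \<omega> (yh a (Suc j) \<omega>) - W \<omega> (yh a j \<omega>)" for j
            using W_mono[of "yh a j \<omega>" "yh a (Suc j) \<omega>" \<omega>] y_le[of j "Suc j"] by (auto simp: yh_def)
          define e where "e j = stick_exp \<kappa> a j \<omega> * (W \<omega> (yh a (Suc j) \<omega>) - W \<omega> (yh a j \<omega>)) * (growth \<kappa> a j \<omega> / W \<omega> (yh a j \<omega>))" for j
          have e0: "0 \<le> e j" for j
            unfolding e_def using wj[of j] g1[of j] W_nonneg[of \<omega> "yh a j \<omega>"] by (simp add: stick_exp_def)
          have summand: "ennreal (stick_exp \<kappa> a j \<omega>) * emeasure (glue_law i \<omega>) {yh a j \<omega><..yh a (Suc j) \<omega>}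
             * ennreal (growth \<kappa> a j \<omega> * (W \<omega> a / W \<omega> (yh a j \<omega>))) = ennreal (W \<omega> a / w * e j)" if "j < i" for j
            unfolding pj[OF that] e_def using wj[of j] g1[of j] W_nonneg[of \<omega> "yh a j \<omega>"] w Wa
            by (simp add: ennreal_mult[symmetric] stick_exp_def)
          \<comment> \<open>Every induction bound carries
            \<open>W \<omega> a / W \<omega> (yh a j \<omega>)\<close>, so
            \<open>W \<omega> a / w\<close> factors out, and \<open>growth_eq_sum\<close> evaluates
            what remains exactly.\<close>
          have "ennreal (W \<omega> a / w) + (\<Sum>j<i. ennreal (W \<omega> a / w * e j)) = ennreal (W \<omega> a / w + (\<Sum>j<i. W \<omega> a / w * e j))"
            using Wa w e0 by (subst sum_ennreal) (auto simp: ennreal_plus sum_nonneg)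
          also have "W \<omega> a / w + (\<Sum>j<i. W \<omega> a / w * e j) = W \<omega> a / w * (1 + (\<Sum>j<i. e j))"
            by (simp add: distrib_left sum_distrib_left)
          also have "\<dots> = growth \<kappa> a i \<omega> * (W \<omega> a / W \<omega> (yh a i \<omega>))"
            unfolding e_def growth_eq_sum by (simp add: yhi w_def)
          finally have "ennreal (W \<omega> a / w) + (\<Sum>j<i. ennreal (W \<omega> a / w * e j))
            = ennreal (growth \<kappa> a i \<omega> * (W \<omega> a / W \<omega> (yh a i \<omega>)))" .
          moreover have "D0 \<omega> + (D \<omega> * emeasure (glue_law i \<omega>) {-1<..a}
              + (\<Sum>j<i. D \<omega> * ennreal (stick_exp \<kappa> a j \<omega>) * emeasure (glue_law i \<omega>) {yh a j \<omega><..yh a (Suc j) \<omega>}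
             * ennreal (growth \<kappa> a j \<omega> * (W \<omega> a / W \<omega> (yh a j \<omega>)))))
             = f \<omega> * (ennreal (W \<omega> a / w) + (\<Sum>j<i. ennreal (W \<omega> a / w * e j)))"
          proof -
            have "(\<Sum>j<i. D \<omega> * ennreal (stick_exp \<kappa> a j \<omega>) * emeasure (glue_law i \<omega>) {yh a j \<omega><..yh a (Suc j) \<omega>}
             * ennreal (growth \<kappa> a j \<omega> * (W \<omega> a / W \<omega> (yh a j \<omega>))))
              = (\<Sum>j<i. f \<omega> * ennreal (W \<omega> a / w * e j))"
            proof (intro sum.cong refl)
              fix j assume "j \<in> {..<i}"
              then show "D \<omega> * ennreal (stick_exp \<kappa> a j \<omega>) * emeasure (glue_law i \<omega>) {yh a j \<omega><..yh a (Suc j) \<omega>}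
                 * ennreal (growth \<kappa> a j \<omega> * (W \<omega> a / W \<omega> (yh a j \<omega>))) = f \<omega> * ennreal (W \<omega> a / w * e j)"
                using gt by (subst summand[symmetric]) (simp_all only: lessThan_iff D_def if_False mult.assoc)
            qed
            then show ?thesis using gt by (simp add: D0_def D_def p0 distrib_left sum_distrib_left)
          qed
          ultimately show ?thesis by simp
        qed
      qed
    qed
    finally show ?thesis by (auto intro: add_mono)
  qed
qed

end

subsection \<open>Void probabilities and the length of paths\<close>

text \<open>Bernoulli's inequality, from concavity of \<open>ln\<close>: \<open>1 + x\<close> is the
  convex combination of \<open>1 + c * x\<close> and \<open>1\<close> with weight
  \<open>1 / c\<close>. It turns the weighted relative mass of a stick into a weighted increment of
  \<open>ln W\<close>.\<close>

lemma one_plus_mult_le_exp_ln: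
  fixes c x :: real
  assumes "1 \<le> c" "0 \<le> x" shows "1 + c * x \<le> exp (c * ln (1 + x))"
proof -
  have "(1 / c) * ln (1 + c * x) + (1 - 1 / c) * ln 1 \<le> ln ((1 / c) * (1 + c * x) + (1 - 1 / c) * 1)"
    using concave_onD[OF ln_concave, of "1 - 1 / c" "1 + c * x" 1] assms
    by (simp add: add_pos_nonneg)
  also have "(1 / c) * (1 + c * x) + (1 - 1 / c) * 1 = 1 + x" using assms by (simp add: field_simps)
  finally have "ln (1 + c * x) \<le> c * ln (1 + x)" using assms by (simp add: field_simps)
  then have "exp (ln (1 + c * x)) \<le> exp (c * ln (1 + x))" by simp
  then show ?thesis using assms by (simp add: add_pos_nonneg)
qed

text \<open>Both sums are compared on the common refinement of the partitions \<open>t\<close> and \<open>u\<close>.\<close>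

lemma stieltjes_sum_le:
  fixes t u :: "nat \<Rightarrow> real" and \<phi> :: "real \<Rightarrow> real"
  assumes t: "mono t" and u: "mono u" "t 0 \<le> u 0" "u n \<le> t K"
    and \<phi>: "\<And>x x'. t 0 \<le> x \<Longrightarrow> x \<le> x' \<Longrightarrow> x' \<le> t K \<Longrightarrow> \<phi> x \<le> \<phi> x'"
    and C: "\<And>k. k < K \<Longrightarrow> 0 \<le> C k"
    and cC: "\<And>j k. j < n \<Longrightarrow> k < K \<Longrightarrow> u j < t (Suc k) \<Longrightarrow> t k < u (Suc j) \<Longrightarrow> u j < u (Suc j) \<Longrightarrow> c j \<le> C k"
  shows "(\<Sum>j<n. c j * (\<phi> (u (Suc j)) - \<phi> (u j))) \<le> (\<Sum>k<K. C k * (\<phi> (t (Suc k)) - \<phi> (t k)))"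
proof -
  \<comment> \<open>Clamping to cell \<open>k\<close>: increments of clamped points see only the
    overlap with the cell.\<close>
  define cl where "cl k x = max (t k) (min (t (Suc k)) x)" for k x
  have tS: "t k \<le> t (Suc k)" for k using t by (simp add: mono_iff_le_Suc)
  have uS: "u j \<le> u (Suc j)" for j using u(1) by (simp add: mono_iff_le_Suc)
  have t0: "t 0 \<le> t k" for k using t by (simp add: monoD)
  have tK: "t k \<le> t K" if "k \<le> K" for k using t that by (simp add: monoD)
  have cl_range: "t k \<le> cl k x" "cl k x \<le> t (Suc k)" for k x using tS[of k] by (auto simp: cl_def)
  have tele: "(\<Sum>k<m. \<phi> (cl k x) - \<phi> (t k)) = \<phi> x - \<phi> (t 0)" if "t 0 \<le> x" "x \<le> t m" for m x
    using that
  proof (induction m)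
    case (Suc m)
    show ?case
    proof (cases "x \<le> t m")
      case True
      then have "cl m x = t m" using tS[of m] by (simp add: cl_def)
      then show ?thesis using Suc True by simp
    next
      case False
      have "cl k x = t (Suc k)" if "k < m" for k
        using False monoD[OF t, of "Suc k" m] that tS[of k] by (auto simp: cl_def)
      then have "(\<Sum>k<m. \<phi> (cl k x) - \<phi> (t k)) = (\<Sum>k<m. \<phi> (t (Suc k)) - \<phi> (t k))"
        by (intro sum.cong) auto
      also have "\<dots> = \<phi> (t m) - \<phi> (t 0)" by (rule sum_lessThan_telescope)
      finally show ?thesis using False Suc.prems by (simp add: cl_def)
    qed
  qed simp
  have ub: "t 0 \<le> u j" "u j \<le> t K" if "j \<le> n" for j
    using that u monoD[OF u(1), of 0 j] monoD[OF u(1), of j n] by auto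
  have "(\<Sum>j<n. c j * (\<phi> (u (Suc j)) - \<phi> (u j)))
      = (\<Sum>j<n. \<Sum>k<K. c j * (\<phi> (cl k (u (Suc j))) - \<phi> (cl k (u j))))"
  proof (intro sum.cong refl)
    fix j assume "j \<in> {..<n}"
    then have "\<phi> (u (Suc j)) - \<phi> (u j) = (\<Sum>k<K. \<phi> (cl k (u (Suc j))) - \<phi> (t k)) - (\<Sum>k<K. \<phi> (cl k (u j)) - \<phi> (t k))"
      using ub[of j] ub[of "Suc j"] by (simp add: tele)
    also have "\<dots> = (\<Sum>k<K. \<phi> (cl k (u (Suc j))) - \<phi> (cl k (u j)))"
      by (simp add: sum_subtractf)
    finally show "c j * (\<phi> (u (Suc j)) - \<phi> (u j)) = (\<Sum>k<K. c j * (\<phi> (cl k (u (Suc j))) - \<phi> (cl k (u j))))"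
      by (simp add: sum_distrib_left)
  qed
  also have "\<dots> \<le> (\<Sum>j<n. \<Sum>k<K. C k * (\<phi> (cl k (u (Suc j))) - \<phi> (cl k (u j))))"
  proof (intro sum_mono)
    fix j k assume jk: "j \<in> {..<n}" "k \<in> {..<K}"
    have k: "t (Suc k) \<le> t K" using jk tK[of "Suc k"] by simp
    \<comment> \<open>An interval that misses the cell has equal clamped ends, so \<open>c j\<close>
      and \<open>C k\<close> need to be compared only when the two overlap.\<close>
    show "c j * (\<phi> (cl k (u (Suc j))) - \<phi> (cl k (u j))) \<le> C k * (\<phi> (cl k (u (Suc j))) - \<phi> (cl k (u j)))"
    proof (cases "u j < t (Suc k) \<and> t k < u (Suc j) \<and> u j < u (Suc j)")
      case True
      have "cl k (u j) \<le> cl k (u (Suc j))" using uS[of j] by (auto simp: cl_def)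
      then have "\<phi> (cl k (u j)) \<le> \<phi> (cl k (u (Suc j)))"
        using t0[of k] cl_range[of k] k by (intro \<phi>) (auto intro: order_trans)
      then show ?thesis using cC[of j k] True jk by (intro mult_right_mono) auto
    next
      case False
      then have "cl k (u (Suc j)) = cl k (u j)" using uS[of j] tS[of k] by (auto simp: cl_def)
      then show ?thesis by simp
    qed
  qed
  also have "\<dots> = (\<Sum>k<K. C k * (\<Sum>j<n. \<phi> (cl k (u (Suc j))) - \<phi> (cl k (u j))))"
    by (subst sum.swap) (simp add: sum_distrib_left)
  also have "\<dots> \<le> (\<Sum>k<K. C k * (\<phi> (t (Suc k)) - \<phi> (t k)))"
  proof (intro sum_mono mult_left_mono)
    fix k assume k: "k \<in> {..<K}"
    have "t (Suc k) \<le> t K" using k tK[of "Suc k"] by simp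
    then have "\<phi> (cl k (u n)) \<le> \<phi> (t (Suc k))" "\<phi> (t k) \<le> \<phi> (cl k (u 0))"
      using t0[of k] cl_range[of k] by (intro \<phi>; auto intro: order_trans)+
    then show "(\<Sum>j<n. \<phi> (cl k (u (Suc j))) - \<phi> (cl k (u j))) \<le> \<phi> (t (Suc k)) - \<phi> (t k)"
      using sum_lessThan_telescope[of "\<lambda>j. \<phi> (cl k (u j))" n] by simp
    show "0 \<le> C k" using C k by simp
  qed
  finally show ?thesis .
qed

context icrt_space
begin

section \<open>Gaps between cut points on a deterministic grid\<close>

text \<open>If a gap meeting cell \<open>k\<close> extends to the left of it by between
  \<open>i\<close> and \<open>i + 1\<close> cells, the term with index \<open>i\<close> dominates
  the exponential of this overhang. For \<open>i = 0\<close> the interval is empty and the indicator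
  is one on \<open>space M\<close>.\<close>

definition cell_left :: "real \<Rightarrow> real \<Rightarrow> real \<Rightarrow> nat \<Rightarrow> 'w \<Rightarrow> real" where
  "cell_left \<kappa> a h k \<omega> =
     (\<Sum>i\<le>k. exp (2 * \<kappa> * h * (real i + 1)) * indicator (no_points {a + real (k - i) * h<..<a + real k * h}) \<omega>)"

definition cell_right :: "real \<Rightarrow> real \<Rightarrow> real \<Rightarrow> nat \<Rightarrow> nat \<Rightarrow> 'w \<Rightarrow> real" where
  "cell_right \<kappa> a h K k \<omega> =
     (\<Sum>i<K - k. exp (2 * \<kappa> * h * (real i + 1)) * indicator (no_points {a + (real k + 1) * h<..<a + (real k + 1 + real i) * h}) \<omega>)"

definition cell_exp :: "real \<Rightarrow> real \<Rightarrow> real \<Rightarrow> nat \<Rightarrow> nat \<Rightarrow> 'w \<Rightarrow> real" where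
  "cell_exp \<kappa> a h K k \<omega> = exp (\<kappa> * h) * (cell_left \<kappa> a h k \<omega> + cell_right \<kappa> a h K k \<omega>)"

lemma cell_exp_nonneg: "0 \<le> cell_exp \<kappa> a h K k \<omega>"
  unfolding cell_exp_def cell_left_def cell_right_def
  by (intro mult_nonneg_nonneg add_nonneg_nonneg sum_nonneg) auto

text \<open>A gap meeting cell \<open>k\<close> consists of a left overhang \<open>l\<close>, at
  most one cell, and a right overhang \<open>r\<close>. Bounding
  \<open>exp (\<kappa> * (l + r))\<close> by the sum of \<open>exp (2 * \<kappa> * l)\<close> and
  \<open>exp (2 * \<kappa> * r)\<close> doubles the exponents but needs only voids on one side of
  the cell at a time.\<close>

lemma cell_exp_ge:
  assumes \<omega>: "\<omega> \<in> space M" and h: "0 < h" and \<kappa>: "0 \<le> \<kappa>" and k: "k < K"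
    and pq: "a \<le> p" "p < q" "q \<le> a + K * h" and v: "\<omega> \<in> no_points {p<..<q}"
    and meet: "p < a + (real k + 1) * h" "a + real k * h < q"
  shows "exp (\<kappa> * (q - p)) \<le> cell_exp \<kappa> a h K k \<omega>"
proof -
  define l where "l = max 0 (a + real k * h - p)"
  define r where "r = max 0 (q - (a + (real k + 1) * h))"
  have lr: "0 \<le> l" "0 \<le> r" "q - p \<le> l + h + r" by (auto simp: l_def r_def algebra_simps)
  have fl: "real (nat \<lfloor>x / h\<rfloor>) * h \<le> x \<and> x \<le> (real (nat \<lfloor>x / h\<rfloor>) + 1) * h" if "0 \<le> x" for x
  proof -
    have "0 \<le> x / h" using that h by simp
    then have "real (nat \<lfloor>x / h\<rfloor>) = of_int \<lfloor>x / h\<rfloor>" by (intro of_nat_nat) simp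
    moreover have "of_int \<lfloor>x / h\<rfloor> \<le> x / h" "x / h \<le> of_int \<lfloor>x / h\<rfloor> + 1" by linarith+
    ultimately have "real (nat \<lfloor>x / h\<rfloor>) \<le> x / h" "x / h \<le> real (nat \<lfloor>x / h\<rfloor>) + 1" by simp_all
    then show ?thesis using h by (simp_all only: pos_le_divide_eq pos_divide_le_eq)
  qed
  have no_mono: "\<omega> \<in> no_points A" if "A \<subseteq> {p<..<q}" for A
    using v that unfolding no_points_def by blast
  have L: "exp (2 * \<kappa> * l) \<le> cell_left \<kappa> a h k \<omega>"
  proof -
    define i where "i = nat \<lfloor>l / h\<rfloor>"
    have i: "real i * h \<le> l" "l \<le> (real i + 1) * h" using fl[OF lr(1)] by (simp_all add: i_def)
    have "l \<le> real k * h" using pq h by (simp add: l_def)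
    with i(1) have "real i * h \<le> real k * h" by (rule order_trans)
    then have ik: "i \<le> k" using h by simp
    have "{a + real (k - i) * h<..<a + real k * h} \<subseteq> {p<..<q}"
      using i(1) ik meet h by (cases "i = 0") (auto simp: l_def of_nat_diff algebra_simps split: if_splits)
    then have n: "\<omega> \<in> no_points {a + real (k - i) * h<..<a + real k * h}" by (rule no_mono)
    have "\<kappa> * l \<le> \<kappa> * ((real i + 1) * h)" by (rule mult_left_mono[OF i(2) \<kappa>])
    then have "exp (2 * \<kappa> * l) \<le> exp (2 * \<kappa> * h * (real i + 1)) * indicator (no_points {a + real (k - i) * h<..<a + real k * h}) \<omega>"
      using n by (simp add: algebra_simps)
    also have "\<dots> \<le> cell_left \<kappa> a h k \<omega>"
      unfolding cell_left_def using ik by (intro member_le_sum) auto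
    finally show ?thesis .
  qed
  have R: "exp (2 * \<kappa> * r) \<le> cell_right \<kappa> a h K k \<omega>"
  proof -
    define i where "i = nat \<lfloor>r / h\<rfloor>"
    have i: "real i * h \<le> r" "r \<le> (real i + 1) * h" using fl[OF lr(2)] by (simp_all add: i_def)
    have iK: "i < K - k"
    proof (cases "r = 0")
      case True then show ?thesis using k by (simp add: i_def)
    next
      case False
      then have "(real (k + 1) + real i) * h \<le> real K * h"
        using i(1) pq by (simp add: r_def algebra_simps split: if_splits)
      then have "real (k + 1 + i) \<le> real K" using h by simp
      then show ?thesis by linarith
    qed
    have "{a + (real k + 1) * h<..<a + (real k + 1 + real i) * h} \<subseteq> {p<..<q}"
      using i(1) meet h by (cases "i = 0") (auto simp: r_def algebra_simps split: if_splits)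
    then have n: "\<omega> \<in> no_points {a + (real k + 1) * h<..<a + (real k + 1 + real i) * h}" by (rule no_mono)
    have "\<kappa> * r \<le> \<kappa> * ((real i + 1) * h)" by (rule mult_left_mono[OF i(2) \<kappa>])
    then have "exp (2 * \<kappa> * r) \<le> exp (2 * \<kappa> * h * (real i + 1)) * indicator (no_points {a + (real k + 1) * h<..<a + (real k + 1 + real i) * h}) \<omega>"
      using n by (simp add: algebra_simps)
    also have "\<dots> \<le> cell_right \<kappa> a h K k \<omega>"
      unfolding cell_right_def using iK by (intro member_le_sum) auto
    finally show ?thesis .
  qed
  have "exp (\<kappa> * (q - p)) \<le> exp (\<kappa> * (l + h + r))"
    using lr \<kappa> by (simp add: mult_left_mono)
  also have "\<dots> = exp (\<kappa> * h) * exp (\<kappa> * (l + r))" by (simp add: exp_add[symmetric] algebra_simps)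
  also have "exp (\<kappa> * (l + r)) \<le> exp (2 * \<kappa> * max l r)"
    using mult_left_mono[OF _ \<kappa>, of "l + r" "2 * max l r"] by (simp add: mult.assoc mult.left_commute)
  also have "\<dots> \<le> exp (2 * \<kappa> * l) + exp (2 * \<kappa> * r)"
    by (cases "l \<le> r") (auto simp: max_def)
  also have "\<dots> \<le> cell_left \<kappa> a h k \<omega> + cell_right \<kappa> a h K k \<omega>" using L R by (rule add_mono)
  finally show ?thesis by (simp add: cell_exp_def)
qed

text \<open>A Stieltjes sum of the gap weights against \<open>ln W\<close>. Its partition is
  deterministic, so the cut points enter through \<open>cell_exp\<close> alone.\<close>

definition cell_sum :: "real \<Rightarrow> real \<Rightarrow> real \<Rightarrow> nat \<Rightarrow> 'w \<Rightarrow> real" where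
  "cell_sum \<kappa> a h K \<omega> = (\<Sum>k<K. cell_exp \<kappa> a h K k \<omega> * (ln (W \<omega> (a + (real k + 1) * h)) - ln (W \<omega> (a + real k * h))))"

lemma no_points_between:
  assumes "stick_tree (yy \<omega>) (zz \<omega>)" "\<omega> \<in> space M"
  shows "\<omega> \<in> no_points {yh a j \<omega><..<yh a (Suc j) \<omega>}"
proof -
  interpret stick_tree "yy \<omega>" "zz \<omega>" by fact
  have "Y i \<omega> \<notin> {yh a j \<omega><..<yh a (Suc j) \<omega>}" if i: "1 \<le> i" for i
  proof
    assume "Y i \<omega> \<in> {yh a j \<omega><..<yh a (Suc j) \<omega>}"
    moreover have "yy \<omega> i = Y i \<omega>" using i by (simp add: yy_def)
    ultimately have "yy \<omega> j < yy \<omega> i" "yy \<omega> i < yy \<omega> (Suc j)" by (auto simp: yh_def max_def split: if_splits)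
    then have "j < i" "i < Suc j" using y_mono by (simp_all add: strict_mono_less)
    then show False by simp
  qed
  then show ?thesis using assms by (simp add: no_points_def)
qed

text \<open>Each factor of \<open>growth\<close> is at most the exponential of a weighted increment
  of \<open>ln W\<close>. The resulting sum over the random sticks is moved to the fixed grid by
  \<open>stieltjes_sum_le\<close>, whose condition on the weights is \<open>cell_exp_ge\<close>; the
  quotient of masses is at most one.\<close>

lemma growth_le_exp_cell_sum:
  assumes st: "stick_tree (yy \<omega>) (zz \<omega>)" and \<omega>: "\<omega> \<in> space M" and h: "0 < h" and \<kappa>: "0 \<le> \<kappa>" and a: "0 \<le> a"
    and Wa: "0 < W \<omega> a" and i: "yy \<omega> i \<le> a + K * h"
  shows "growth \<kappa> a i \<omega> * (W \<omega> a / W \<omega> (yh a i \<omega>)) \<le> exp (cell_sum \<kappa> a h K \<omega>)"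
proof -
  interpret stick_tree "yy \<omega>" "zz \<omega>" by fact
  have Wpos: "0 < W \<omega> x" if "a \<le> x" for x using W_mono[OF that, of \<omega>] Wa by simp
  have ya: "a \<le> yh a j \<omega>" for j by (simp add: yh_def)
  have ym: "yh a j \<omega> \<le> yh a (Suc j) \<omega>" for j using y_le[of j "Suc j"] by (auto simp: yh_def)
  have mono_yh: "mono (\<lambda>j. yh a j \<omega>)" by (simp add: mono_iff_le_Suc ym)
  define \<phi> where "\<phi> x = ln (W \<omega> x)" for x
  have "growth \<kappa> a i \<omega> \<le> (\<Prod>j<i. exp (stick_exp \<kappa> a j \<omega> * (\<phi> (yh a (Suc j) \<omega>) - \<phi> (yh a j \<omega>))))"
    unfolding growth_def
  proof (intro prod_mono conjI)
    fix j
    define x where "x = (W \<omega> (yh a (Suc j) \<omega>) - W \<omega> (yh a j \<omega>)) / W \<omega> (yh a j \<omega>)"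
    have x: "0 \<le> x" unfolding x_def using Wpos[OF ya, of j] W_mono[OF ym, of \<omega> j] by simp
    have c: "1 \<le> stick_exp \<kappa> a j \<omega>" using ym[of j] \<kappa> by (simp add: stick_exp_def)
    show "0 \<le> 1 + stick_exp \<kappa> a j \<omega> * x" using x c by simp
    have "1 + x = W \<omega> (yh a (Suc j) \<omega>) / W \<omega> (yh a j \<omega>)"
      unfolding x_def using Wpos[OF ya, of j] by (simp add: field_simps)
    then have "ln (1 + x) = \<phi> (yh a (Suc j) \<omega>) - \<phi> (yh a j \<omega>)"
      using Wpos[OF ya, of j] Wpos[OF ya, of "Suc j"] by (simp add: \<phi>_def ln_div)
    then show "1 + stick_exp \<kappa> a j \<omega> * x \<le> exp (stick_exp \<kappa> a j \<omega> * (\<phi> (yh a (Suc j) \<omega>) - \<phi> (yh a j \<omega>)))"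
      using one_plus_mult_le_exp_ln[OF c x] by simp
  qed
  also have "\<dots> = exp (\<Sum>j<i. stick_exp \<kappa> a j \<omega> * (\<phi> (yh a (Suc j) \<omega>) - \<phi> (yh a j \<omega>)))"
    by (simp add: exp_sum)
  also have "(\<Sum>j<i. stick_exp \<kappa> a j \<omega> * (\<phi> (yh a (Suc j) \<omega>) - \<phi> (yh a j \<omega>))) \<le> cell_sum \<kappa> a h K \<omega>"
  proof -
    define t where "t k = a + real k * h" for k :: nat
    have "(\<Sum>j<i. stick_exp \<kappa> a j \<omega> * (\<phi> (yh a (Suc j) \<omega>) - \<phi> (yh a j \<omega>)))
        \<le> (\<Sum>k<K. cell_exp \<kappa> a h K k \<omega> * (\<phi> (t (Suc k)) - \<phi> (t k)))"
    proof (rule stieltjes_sum_le[where u = "\<lambda>j. yh a j \<omega>"])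
      show "mono t" using h by (intro monoI) (auto simp: t_def mult_right_mono)
      show "yh a i \<omega> \<le> t K" using i h a by (auto simp: yh_def t_def)
      show "\<phi> x \<le> \<phi> x'" if "t 0 \<le> x" "x \<le> x'" "x' \<le> t K" for x x'
        unfolding \<phi>_def using that Wpos[of x] W_mono[of x x' \<omega>] by (simp add: t_def)
      fix j k assume jk: "j < i" "k < K" "yh a j \<omega> < t (Suc k)" "t k < yh a (Suc j) \<omega>" "yh a j \<omega> < yh a (Suc j) \<omega>"
      have "yh a (Suc j) \<omega> \<le> yh a i \<omega>" using jk by (intro monoD[OF mono_yh]) simp
      moreover have "yh a i \<omega> \<le> a + K * h" using i h by (simp add: yh_def)
      ultimately have "yh a (Suc j) \<omega> \<le> a + K * h" by linarith
      then show "stick_exp \<kappa> a j \<omega> \<le> cell_exp \<kappa> a h K k \<omega>"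
        unfolding stick_exp_def using jk ya no_points_between[OF st \<omega>]
        by (intro cell_exp_ge[OF \<omega> h \<kappa>]) (auto simp: t_def algebra_simps)
    qed (use mono_yh ya cell_exp_nonneg in \<open>auto simp: t_def\<close>)
    then show ?thesis unfolding cell_sum_def by (simp add: t_def \<phi>_def add.commute)
  qed
  finally have g: "growth \<kappa> a i \<omega> \<le> exp (cell_sum \<kappa> a h K \<omega>)" by simp
  have q: "0 \<le> W \<omega> a / W \<omega> (yh a i \<omega>)" "W \<omega> a / W \<omega> (yh a i \<omega>) \<le> 1"
    using Wpos[OF ya, of i] W_mono[OF ya, of \<omega> i] Wa by simp_all
  have "growth \<kappa> a i \<omega> * (W \<omega> a / W \<omega> (yh a i \<omega>)) \<le> growth \<kappa> a i \<omega> * 1"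
    using q growth_ge_1[OF st, of \<kappa> a i] by (intro mult_left_mono) auto
  then show ?thesis using g by simp
qed

text \<open>For \<open>\<kappa> * h = 1 / 8\<close> the middle cell contributes
  \<open>exp (1 / 8)\<close>, and each of the two sides a geometric series with first term
  \<open>exp (1 / 4)\<close> and ratio \<open>exp (- 1 / 4)\<close>.\<close>

definition cell_const :: real where
  "cell_const = 2 * exp (3 / 8) / (1 - exp (- 1 / 4))"

lemma cell_const_pos: "0 < cell_const"
  by (simp add: cell_const_def)

lemma cell_exp_measurable:
  assumes "space N = space M" "\<And>i. 1 \<le> i \<Longrightarrow> Y i \<in> borel_measurable N"
  shows "cell_exp \<kappa> a h K k \<in> borel_measurable N"
proof -
  have [measurable]: "no_points {s<..<t} \<in> sets N" for s t by (rule no_points_sets[OF assms]) auto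
  show ?thesis unfolding cell_exp_def cell_left_def cell_right_def by measurable
qed

lemma Y_events: "no_points {s<..<t} \<in> events"
  using Y_meas by (intro no_points_sets) auto

text \<open>With \<open>\<kappa> = m / 8\<close> the weights are beaten by the void probabilities when \<open>m / 2 \<le> W a\<close>.\<close>

lemma cell_exp_expectation:
  assumes f: "f \<in> borel_measurable (measure_algebra M mu)" and a: "0 \<le> a" and m: "0 < m" and k: "k < K"
    and low: "\<And>\<omega>. \<omega> \<in> space M \<Longrightarrow> f \<omega> \<noteq> 0 \<Longrightarrow> m / 2 \<le> W \<omega> a"
  shows "(\<integral>\<^sup>+ \<omega>. f \<omega> * ennreal (cell_exp (m / 8) a (1 / m) K k \<omega>) \<partial>M) \<le> ennreal cell_const * (\<integral>\<^sup>+ \<omega>. f \<omega> \<partial>M)"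
proof -
  define h where "h = 1 / m"
  have h: "0 < h" "m * h = 1" using m by (simp_all add: h_def)
  have fM [measurable]: "f \<in> borel_measurable M" by (rule measurable_from_subalg[OF subalgebra_measure f])
  define I where "I = (\<integral>\<^sup>+ \<omega>. f \<omega> \<partial>M)"
  \<comment> \<open>As \<open>m * h = 1\<close>, the weight is \<open>exp ((i + 1) / 4)\<close>
    while a void of \<open>i\<close> cells has conditional probability at most
    \<open>exp (- i / 2)\<close>.\<close>
  have one: "(\<integral>\<^sup>+ \<omega>. f \<omega> * ennreal (exp (2 * (m / 8) * h * (real i + 1)) * indicator (no_points {s<..<s + real i * h}) \<omega>) \<partial>M)
      \<le> ennreal (exp (1 / 4) * exp (- 1 / 4) ^ i) * I" if s: "a \<le> s" for s :: real and i :: nat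
  proof -
    have e: "2 * (m / 8) * h * (real i + 1) = (real i + 1) / 4" using h by (simp add: field_simps)
    have ni: "(\<lambda>\<omega>. f \<omega> * indicator (no_points {s<..<s + real i * h}) \<omega>) \<in> borel_measurable M"
      using fM Y_events by measurable
    have "(\<integral>\<^sup>+ \<omega>. f \<omega> * ennreal (exp (2 * (m / 8) * h * (real i + 1)) * indicator (no_points {s<..<s + real i * h}) \<omega>) \<partial>M)
        = (\<integral>\<^sup>+ \<omega>. ennreal (exp ((real i + 1) / 4)) * (f \<omega> * indicator (no_points {s<..<s + real i * h}) \<omega>) \<partial>M)"
      unfolding e by (intro nn_integral_cong) (simp add: mult_ac split: split_indicator)
    also have "\<dots> = ennreal (exp ((real i + 1) / 4)) * (\<integral>\<^sup>+ \<omega>. f \<omega> * indicator (no_points {s<..<s + real i * h}) \<omega> \<partial>M)"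
      by (rule nn_integral_cmult[OF ni])
    also have "\<dots> \<le> ennreal (exp ((real i + 1) / 4)) * (ennreal (exp (- (m / 2) * (s + real i * h - s))) * I)"
      unfolding I_def
    proof (intro mult_left_mono void_bound[OF f])
      show "m / 2 \<le> W \<omega> s" if "\<omega> \<in> space M" "f \<omega> \<noteq> 0" for \<omega>
        using low[OF that] W_mono[OF s, of \<omega>] by linarith
    qed (use a s h in auto)
    also have "\<dots> = ennreal (exp (1 / 4) * exp (- 1 / 4) ^ i) * I"
    proof -
      have "(real i + 1) / 4 + - (m / 2) * (s + real i * h - s) = 1 / 4 + real i * (- 1 / 4)"
        using h by (simp add: field_simps)
      then have "exp ((real i + 1) / 4) * exp (- (m / 2) * (s + real i * h - s)) = exp (1 / 4) * exp (- 1 / 4) ^ i"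
        by (simp only: exp_add[symmetric] exp_of_nat_mult[symmetric])
      then show ?thesis by (simp only: mult.assoc[symmetric] ennreal_mult[symmetric] exp_ge_zero)
    qed
    finally show ?thesis .
  qed
  have geo: "(\<Sum>i\<in>A. exp (1 / 4) * exp (- 1 / 4) ^ i) \<le> exp (1 / 4) / (1 - exp (- 1 / 4 :: real))" if "finite A" for A :: "nat set"
  proof -
    have "(\<Sum>i\<in>A. exp (- 1 / 4 :: real) ^ i) \<le> (\<Sum>i. exp (- 1 / 4) ^ i)"
      using that by (intro sum_le_suminf summable_geometric) auto
    also have "\<dots> = 1 / (1 - exp (- 1 / 4))" by (intro suminf_geometric) simp
    finally have "exp (1 / 4) * (\<Sum>i\<in>A. exp (- 1 / 4 :: real) ^ i) \<le> exp (1 / 4) * (1 / (1 - exp (- 1 / 4)))"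
      by (intro mult_left_mono) auto
    then show ?thesis by (simp add: sum_distrib_left)
  qed
  have sum_le: "(\<integral>\<^sup>+ \<omega>. f \<omega> * ennreal (\<Sum>i\<in>A. exp (2 * (m / 8) * h * (real i + 1)) * indicator (no_points {s i<..<s i + real i * h}) \<omega>) \<partial>M)
      \<le> ennreal (exp (1 / 4) / (1 - exp (- 1 / 4))) * I"
    if A: "finite A" and s: "\<And>i. i \<in> A \<Longrightarrow> a \<le> s i" for A :: "nat set" and s
  proof -
    have "(\<integral>\<^sup>+ \<omega>. f \<omega> * ennreal (\<Sum>i\<in>A. exp (2 * (m / 8) * h * (real i + 1)) * indicator (no_points {s i<..<s i + real i * h}) \<omega>) \<partial>M)
        = (\<integral>\<^sup>+ \<omega>. (\<Sum>i\<in>A. f \<omega> * ennreal (exp (2 * (m / 8) * h * (real i + 1)) * indicator (no_points {s i<..<s i + real i * h}) \<omega>)) \<partial>M)"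
    proof (intro nn_integral_cong)
      fix \<omega>
      have "ennreal (\<Sum>i\<in>A. exp (2 * (m / 8) * h * (real i + 1)) * indicator (no_points {s i<..<s i + real i * h}) \<omega>)
          = (\<Sum>i\<in>A. ennreal (exp (2 * (m / 8) * h * (real i + 1)) * indicator (no_points {s i<..<s i + real i * h}) \<omega>))"
        by (rule sum_ennreal[symmetric]) auto
      then show "f \<omega> * ennreal (\<Sum>i\<in>A. exp (2 * (m / 8) * h * (real i + 1)) * indicator (no_points {s i<..<s i + real i * h}) \<omega>)
          = (\<Sum>i\<in>A. f \<omega> * ennreal (exp (2 * (m / 8) * h * (real i + 1)) * indicator (no_points {s i<..<s i + real i * h}) \<omega>))"
        by (simp only: sum_distrib_left)
    qed
    also have "\<dots> = (\<Sum>i\<in>A. \<integral>\<^sup>+ \<omega>. f \<omega> * ennreal (exp (2 * (m / 8) * h * (real i + 1)) * indicator (no_points {s i<..<s i + real i * h}) \<omega>) \<partial>M)"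
    proof (intro nn_integral_sum)
      fix i
      have [measurable]: "no_points {s i<..<s i + real i * h} \<in> events" by (rule Y_events)
      show "(\<lambda>\<omega>. f \<omega> * ennreal (exp (2 * (m / 8) * h * (real i + 1)) * indicator (no_points {s i<..<s i + real i * h}) \<omega>))
          \<in> borel_measurable M" by measurable
    qed
    also have "\<dots> \<le> (\<Sum>i\<in>A. ennreal (exp (1 / 4) * exp (- 1 / 4) ^ i) * I)"
      by (intro sum_mono one s)
    also have "\<dots> = ennreal (\<Sum>i\<in>A. exp (1 / 4) * exp (- 1 / 4) ^ i) * I"
      by (simp add: sum_distrib_right[symmetric] sum_ennreal)
    also have "\<dots> \<le> ennreal (exp (1 / 4) / (1 - exp (- 1 / 4))) * I"
      using geo[OF A] by (intro mult_right_mono ennreal_leI) auto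
    finally show ?thesis .
  qed
  define c where "c = exp (1 / 4) / (1 - exp (- 1 / 4 :: real))"
  have c0: "0 \<le> c" by (simp add: c_def)
  have L: "(\<integral>\<^sup>+ \<omega>. f \<omega> * ennreal (cell_left (m / 8) a h k \<omega>) \<partial>M) \<le> ennreal c * I"
  proof -
    have eq: "cell_left (m / 8) a h k \<omega> = (\<Sum>i\<in>{..k}. exp (2 * (m / 8) * h * (real i + 1))
        * indicator (no_points {a + real (k - i) * h<..<(a + real (k - i) * h) + real i * h}) \<omega>)" for \<omega>
      unfolding cell_left_def by (intro sum.cong refl) (simp add: of_nat_diff algebra_simps)
    show ?thesis unfolding eq c_def using h by (intro sum_le) auto
  qed
  have R: "(\<integral>\<^sup>+ \<omega>. f \<omega> * ennreal (cell_right (m / 8) a h K k \<omega>) \<partial>M) \<le> ennreal c * I"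
  proof -
    have eq: "cell_right (m / 8) a h K k \<omega> = (\<Sum>i\<in>{..<K - k}. exp (2 * (m / 8) * h * (real i + 1))
        * indicator (no_points {a + (real k + 1) * h<..<(a + (real k + 1) * h) + real i * h}) \<omega>)" for \<omega>
      unfolding cell_right_def by (intro sum.cong refl) (simp add: algebra_simps)
    show ?thesis unfolding eq c_def using h by (intro sum_le) auto
  qed
  have nn: "0 \<le> cell_left (m / 8) a h k \<omega>" "0 \<le> cell_right (m / 8) a h K k \<omega>" for \<omega>
    unfolding cell_left_def cell_right_def by (auto intro!: sum_nonneg)
  have meas: "cell_left (m / 8) a h k \<in> borel_measurable M" "cell_right (m / 8) a h K k \<in> borel_measurable M"
    unfolding cell_left_def cell_right_def using Y_events by measurable
  have "(\<integral>\<^sup>+ \<omega>. f \<omega> * ennreal (cell_exp (m / 8) a h K k \<omega>) \<partial>M)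
      = (\<integral>\<^sup>+ \<omega>. ennreal (exp (1 / 8)) * (f \<omega> * ennreal (cell_left (m / 8) a h k \<omega>) + f \<omega> * ennreal (cell_right (m / 8) a h K k \<omega>)) \<partial>M)"
    using nn h by (intro nn_integral_cong) (simp add: cell_exp_def ennreal_mult ennreal_plus distrib_left mult_ac)
  also have "\<dots> = ennreal (exp (1 / 8)) * ((\<integral>\<^sup>+ \<omega>. f \<omega> * ennreal (cell_left (m / 8) a h k \<omega>) \<partial>M)
        + (\<integral>\<^sup>+ \<omega>. f \<omega> * ennreal (cell_right (m / 8) a h K k \<omega>) \<partial>M))"
    using fM meas by (simp add: nn_integral_cmult nn_integral_add)
  also have "\<dots> \<le> ennreal (exp (1 / 8)) * (ennreal c * I + ennreal c * I)"
    using L R by (intro mult_left_mono add_mono) auto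
  also have "\<dots> = ennreal cell_const * I"
  proof -
    have "exp (1 / 8) * (2 * c) = cell_const"
      by (simp add: cell_const_def c_def exp_add[symmetric])
    then show ?thesis
      using c0 by (simp add: distrib_right[symmetric] mult.assoc[symmetric] ennreal_mult[symmetric] ennreal_plus[symmetric] del: ennreal_plus)
  qed
  finally show ?thesis by (simp add: I_def h_def)
qed

lemma cell_sum_nonneg:
  assumes "0 < W \<omega> a" "0 < h" shows "0 \<le> cell_sum \<kappa> a h K \<omega>"
  unfolding cell_sum_def
proof (intro sum_nonneg mult_nonneg_nonneg cell_exp_nonneg)
  fix k
  have "0 < W \<omega> (a + real k * h)" using W_mono[of a "a + real k * h" \<omega>] assms by simp
  then show "0 \<le> ln (W \<omega> (a + (real k + 1) * h)) - ln (W \<omega> (a + real k * h))"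
    using W_mono[of "a + real k * h" "a + (real k + 1) * h" \<omega>] assms by (simp add: algebra_simps)
qed

lemma low_event: "{\<omega> \<in> space M. m / 2 \<le> W \<omega> a} \<in> sets (measure_algebra M mu)"
proof -
  have [measurable]: "(\<lambda>\<omega>. W \<omega> a) \<in> borel_measurable (measure_algebra M mu)" by (rule W_meas[OF sees_mu_measure])
  have "{\<omega> \<in> space (measure_algebra M mu). m / 2 \<le> W \<omega> a} \<in> sets (measure_algebra M mu)" by measurable
  then show ?thesis by (simp add: measure_algebra_def)
qed

text \<open>The sum of all cell weights dominates the exponential of \<open>m / 8\<close> times any
  gap in the range, so with Markov's inequality this controls the longest gap.\<close>

lemma cell_exp_sum_expectation:
  assumes a: "0 \<le> a" and m: "0 < m"
  defines "E \<equiv> {\<omega> \<in> space M. m / 2 \<le> W \<omega> a}"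
  shows "(\<integral>\<^sup>+ \<omega>. indicator E \<omega> * ennreal (\<Sum>k<K. cell_exp (m / 8) a (1 / m) K k \<omega>) \<partial>M) \<le> ennreal (cell_const * K)"
proof -
  have E: "(indicator E :: _ \<Rightarrow> ennreal) \<in> borel_measurable (measure_algebra M mu)"
    unfolding E_def using low_event by simp
  have EM: "(indicator E :: _ \<Rightarrow> ennreal) \<in> borel_measurable M"
    by (rule measurable_from_subalg[OF subalgebra_measure E])
  have meas: "cell_exp (m / 8) a (1 / m) K k \<in> borel_measurable M" for k
    using Y_meas by (intro cell_exp_measurable) auto
  have "(\<integral>\<^sup>+ \<omega>. indicator E \<omega> * ennreal (\<Sum>k<K. cell_exp (m / 8) a (1 / m) K k \<omega>) \<partial>M)
      = (\<Sum>k<K. \<integral>\<^sup>+ \<omega>. indicator E \<omega> * ennreal (cell_exp (m / 8) a (1 / m) K k \<omega>) \<partial>M)"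
    using EM meas cell_exp_nonneg
    by (subst nn_integral_sum[symmetric]) (auto simp: sum_distrib_left[symmetric] sum_ennreal)
  also have "\<dots> \<le> (\<Sum>k<K. ennreal cell_const * (\<integral>\<^sup>+ \<omega>. indicator E \<omega> \<partial>M))"
  proof (intro sum_mono cell_exp_expectation[OF E a m])
    show "m / 2 \<le> W \<omega> a" if "indicator E \<omega> \<noteq> (0 :: ennreal)" for \<omega>
      using that by (simp add: indicator_eq_0_iff) (simp add: E_def)
  qed auto
  also have "\<dots> \<le> (\<Sum>k<K. ennreal cell_const * 1)"
  proof (intro sum_mono mult_left_mono)
    have "(\<integral>\<^sup>+ \<omega>. indicator E \<omega> \<partial>M) \<le> (\<integral>\<^sup>+ \<omega>. 1 \<partial>M)" by (intro nn_integral_mono) (simp split: split_indicator)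
    then show "(\<integral>\<^sup>+ \<omega>. indicator E \<omega> \<partial>M) \<le> 1" by (simp add: emeasure_space_1)
  qed simp
  also have "\<dots> = ennreal (cell_const * K)"
    using cell_const_pos by (simp add: ennreal_of_nat_eq_real_of_nat ennreal_mult[symmetric] mult.commute)
  finally show ?thesis .
qed

text \<open>Where \<open>m / 2 \<le> W \<omega> a\<close>, the increments of \<open>ln W\<close> are
  nonnegative weights depending on \<open>mu\<close> alone, so \<open>cell_exp_expectation\<close>
  applies to each cell. They telescope to \<open>ln (W \<omega> b) - ln (W \<omega> a)\<close>, and
  \<open>2 \<le> m\<close> makes the subtracted term nonnegative.\<close>

lemma cell_sum_expectation:
  assumes a: "0 \<le> a" and m: "2 \<le> m" and b: "b = a + K * (1 / m)" "1 \<le> b"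
  defines "E \<equiv> {\<omega> \<in> space M. m / 2 \<le> W \<omega> a}"
  shows "(\<integral>\<^sup>+ \<omega>. indicator E \<omega> * ennreal (cell_sum (m / 8) a (1 / m) K \<omega>) \<partial>M) \<le> ennreal (cell_const * (ln b + 1))"
proof -
  define h where "h = 1 / m"
  have h: "0 < h" using m by (simp add: h_def)
  define \<psi> where "\<psi> k \<omega> = ln (W \<omega> (a + (real k + 1) * h)) - ln (W \<omega> (a + real k * h))" for k :: nat and \<omega>
  have Wpos: "1 \<le> W \<omega> (a + real k * h)" if "\<omega> \<in> E" for \<omega> and k :: nat
    using that W_mono[of a "a + real k * h" \<omega>] h m by (auto simp: E_def)
  have \<psi>0: "0 \<le> \<psi> k \<omega>" if "\<omega> \<in> E" for k \<omega>
    unfolding \<psi>_def using Wpos[OF that, of k] W_mono[of "a + real k * h" "a + (real k + 1) * h" \<omega>] h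
    by (simp add: algebra_simps)
  have E: "E \<in> sets (measure_algebra M mu)" unfolding E_def by (rule low_event)
  have Wm: "(\<lambda>\<omega>. W \<omega> x) \<in> borel_measurable (measure_algebra M mu)" for x by (rule W_meas[OF sees_mu_measure])
  define f where "f k \<omega> = indicator E \<omega> * ennreal (\<psi> k \<omega>)" for k \<omega>
  have f: "f k \<in> borel_measurable (measure_algebra M mu)" for k
    unfolding f_def \<psi>_def using E Wm by measurable
  have fM: "f k \<in> borel_measurable M" for k by (rule measurable_from_subalg[OF subalgebra_measure f])
  have meas: "cell_exp (m / 8) a h K k \<in> borel_measurable M" for k
    using Y_meas by (intro cell_exp_measurable) auto
  have "(\<integral>\<^sup>+ \<omega>. indicator E \<omega> * ennreal (cell_sum (m / 8) a h K \<omega>) \<partial>M)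
      = (\<integral>\<^sup>+ \<omega>. (\<Sum>k<K. f k \<omega> * ennreal (cell_exp (m / 8) a h K k \<omega>)) \<partial>M)"
  proof (intro nn_integral_cong)
    fix \<omega>
    show "indicator E \<omega> * ennreal (cell_sum (m / 8) a h K \<omega>) = (\<Sum>k<K. f k \<omega> * ennreal (cell_exp (m / 8) a h K k \<omega>))"
    proof (cases "\<omega> \<in> E")
      case True
      have "cell_sum (m / 8) a h K \<omega> = (\<Sum>k<K. \<psi> k \<omega> * cell_exp (m / 8) a h K k \<omega>)"
        unfolding cell_sum_def \<psi>_def by (simp add: mult.commute)
      then show ?thesis
        using True \<psi>0[OF True] cell_exp_nonneg[of "m/8" a h K _ \<omega>]
        by (simp add: f_def ennreal_mult[symmetric] sum_ennreal)
    qed (simp add: f_def)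
  qed
  also have "\<dots> = (\<Sum>k<K. \<integral>\<^sup>+ \<omega>. f k \<omega> * ennreal (cell_exp (m / 8) a h K k \<omega>) \<partial>M)"
    using fM meas by (intro nn_integral_sum borel_measurable_times_ennreal measurable_compose[OF _ measurable_ennreal])
  also have "\<dots> \<le> (\<Sum>k<K. ennreal cell_const * (\<integral>\<^sup>+ \<omega>. f k \<omega> \<partial>M))"
    unfolding h_def
  proof (intro sum_mono cell_exp_expectation[OF f a])
    show "m / 2 \<le> W \<omega> a" if "f k \<omega> \<noteq> 0" for k \<omega>
      using that by (auto simp: f_def E_def indicator_def split: if_splits)
  qed (use m in auto)
  also have "\<dots> = ennreal cell_const * (\<integral>\<^sup>+ \<omega>. (\<Sum>k<K. f k \<omega>) \<partial>M)"
    using fM by (simp add: sum_distrib_left[symmetric] nn_integral_sum)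
  also have "\<dots> \<le> ennreal cell_const * (\<integral>\<^sup>+ \<omega>. ennreal (ln b) + ennreal (1 / b) * ennreal (W \<omega> b) \<partial>M)"
  proof (intro mult_left_mono nn_integral_mono)
    fix \<omega>
    show "(\<Sum>k<K. f k \<omega>) \<le> ennreal (ln b) + ennreal (1 / b) * ennreal (W \<omega> b)"
    proof (cases "\<omega> \<in> E")
      case True
      have "(\<Sum>k<K. f k \<omega>) = ennreal (\<Sum>k<K. \<psi> k \<omega>)"
        using True \<psi>0[OF True] by (simp add: f_def sum_ennreal)
      also have "(\<Sum>k<K. \<psi> k \<omega>) = ln (W \<omega> b) - ln (W \<omega> a)"
        using sum_lessThan_telescope[of "\<lambda>k. ln (W \<omega> (a + real k * h))" K]
        by (simp add: \<psi>_def b h_def add.commute)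
      also have "\<dots> \<le> ln (W \<omega> b)" using Wpos[OF True, of 0] by simp
      \<comment> \<open>The tangent of \<open>ln\<close> at one makes the bound linear in
        \<open>W \<omega> b\<close>, whose expectation is at most \<open>b\<close>.\<close>
      also have "\<dots> \<le> ln b + 1 / b * W \<omega> b"
      proof -
        have "0 < W \<omega> b" using Wpos[OF True, of K] by (simp add: b h_def)
        then have "ln (W \<omega> b / b) \<le> W \<omega> b / b - 1" using b by (intro ln_le_minus_one) simp
        then show ?thesis using \<open>0 < W \<omega> b\<close> b(2) by (simp add: ln_div)
      qed
      finally show ?thesis
        using b(2) W_nonneg by (simp add: ennreal_leI ennreal_plus ennreal_mult[symmetric])
    qed (simp add: f_def)
  qed simp
  also have "\<dots> = ennreal cell_const * (ennreal (ln b) + ennreal (1 / b) * ennreal (mean b))"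
    using W_meas[OF sees_mu_M, of b] b(2)
    by (simp add: nn_integral_add nn_integral_cmult W_expectation emeasure_space_1)
  also have "\<dots> \<le> ennreal cell_const * (ennreal (ln b) + 1)"
  proof (intro mult_left_mono add_left_mono)
    have "mean b / b \<le> 1" using mean_le[of b] b(2) by simp
    then show "ennreal (1 / b) * ennreal (mean b) \<le> 1"
      using b(2) mean_nonneg[of b] by (simp add: ennreal_mult[symmetric])
  qed simp
  also have "\<dots> = ennreal (cell_const * (ln b + 1))"
    using b(2) cell_const_pos by (simp add: ennreal_mult ennreal_plus)
  finally show ?thesis by (simp add: h_def)
qed

end

subsection \<open>The field along paths\<close>

locale icrt_gff = icrt_space M \<theta> X Y Z + brownian M B
  for M :: "'w measure" and \<theta> X Y Z B +
  assumes indep: "indep_of_data M B X Y Z"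
begin

abbreviation G :: "'w \<Rightarrow> real \<Rightarrow> real" where
  "G \<omega> \<equiv> icrt_field (yy \<omega>) (zz \<omega>) (\<lambda>t. B t \<omega>)"

definition data_algebra :: "'w measure" where
  "data_algebra = vimage_algebra (space M)
     (\<lambda>\<omega>. (\<lambda>i\<in>{1..}. X i \<omega>, \<lambda>i\<in>{1..}. Y i \<omega>, \<lambda>i\<in>{1..}. Z i \<omega>))
     ((\<Pi>\<^sub>M i\<in>{1..}. borel) \<Otimes>\<^sub>M (\<Pi>\<^sub>M i\<in>{1..}. borel) \<Otimes>\<^sub>M (\<Pi>\<^sub>M i\<in>{1..}. borel))"

lemma space_data [simp]: "space data_algebra = space M"
  by (simp add: data_algebra_def)

lemma indep_path_data: "indep_set (sets path_algebra) (sets data_algebra)"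
  using indep by (simp add: indep_of_data_def path_algebra_def data_algebra_def)

lemma data_meas:
  assumes i: "1 \<le> i"
  shows X_data: "X i \<in> borel_measurable data_algebra"
    and Y_data: "Y i \<in> borel_measurable data_algebra"
    and Z_data: "Z i \<in> borel_measurable data_algebra"
proof -
  have m: "(\<lambda>\<omega>. (\<lambda>i\<in>{1..}. X i \<omega>, \<lambda>i\<in>{1..}. Y i \<omega>, \<lambda>i\<in>{1..}. Z i \<omega>)) \<in> data_algebra \<rightarrow>\<^sub>M
     ((\<Pi>\<^sub>M i\<in>{1..}. borel) \<Otimes>\<^sub>M (\<Pi>\<^sub>M i\<in>{1..}. borel) \<Otimes>\<^sub>M (\<Pi>\<^sub>M i\<in>{1..}. borel))"
    unfolding data_algebra_def by (rule measurable_vimage_algebra1) (auto simp: space_PiM space_pair_measure)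
  have mX: "(\<lambda>\<omega>. \<lambda>i\<in>{1..}. X i \<omega>) \<in> data_algebra \<rightarrow>\<^sub>M (\<Pi>\<^sub>M i\<in>{1..}. borel)"
    using measurable_compose[OF m measurable_fst] by simp
  have mY: "(\<lambda>\<omega>. \<lambda>i\<in>{1..}. Y i \<omega>) \<in> data_algebra \<rightarrow>\<^sub>M (\<Pi>\<^sub>M i\<in>{1..}. borel)"
    using measurable_compose[OF measurable_compose[OF m measurable_snd] measurable_fst] by simp
  have mZ: "(\<lambda>\<omega>. \<lambda>i\<in>{1..}. Z i \<omega>) \<in> data_algebra \<rightarrow>\<^sub>M (\<Pi>\<^sub>M i\<in>{1..}. borel)"
    using measurable_compose[OF measurable_compose[OF m measurable_snd] measurable_snd] by simp
  have i': "i \<in> {1..}" using i by simp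
  show "X i \<in> borel_measurable data_algebra" "Y i \<in> borel_measurable data_algebra"
    "Z i \<in> borel_measurable data_algebra"
    using measurable_compose[OF mX measurable_component_singleton[OF i']]
      measurable_compose[OF mY measurable_component_singleton[OF i']]
      measurable_compose[OF mZ measurable_component_singleton[OF i']] i by simp_all
qed

lemma sees_mu_data: "sees_mu data_algebra"
  unfolding sees_mu_def using mu_meas_of_X[of data_algebra] X_data by simp

lemma yy_data: "(\<lambda>\<omega>. yy \<omega> k) \<in> borel_measurable data_algebra"
  unfolding yy_def using Y_data[of k] by (cases "k = 0") auto

lemma zz_data: "(\<lambda>\<omega>. zz \<omega> k) \<in> borel_measurable data_algebra"
  unfolding zz_def using Z_data[of k] by (cases "k = 0") auto

lemma yh_data: "yh a j \<in> borel_measurable data_algebra"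
  unfolding yh_def using yy_data[of j] by measurable

text \<open>Unboundedness is tested at integers and strict monotonicity at successors, which leaves
  countably many measurable conditions.\<close>

lemma tree_set_data: "{\<omega> \<in> space M. stick_tree (yy \<omega>) (zz \<omega>)} \<in> sets data_algebra"
proof -
  note [measurable] = yy_data zz_data
  have ub: "(\<forall>u. \<exists>n. u \<le> y n) \<longleftrightarrow> (\<forall>m::nat. \<exists>n. real m \<le> y n)" for y :: "nat \<Rightarrow> real"
    by (meson order_trans real_arch_simple)
  have eq: "stick_tree (yy \<omega>) (zz \<omega>) \<longleftrightarrow> (\<forall>n. yy \<omega> n < yy \<omega> (Suc n)) \<and> (\<forall>m::nat. \<exists>n. real m \<le> yy \<omega> n)
      \<and> yy \<omega> 0 = 0 \<and> zz \<omega> 0 = 0 \<and> (\<forall>i. 0 \<le> zz \<omega> i \<and> zz \<omega> i \<le> yy \<omega> i)" for \<omega>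
    by (simp only: stick_tree_def strict_mono_Suc_iff ub conj_assoc)
  have "{\<omega> \<in> space data_algebra. stick_tree (yy \<omega>) (zz \<omega>)} \<in> sets data_algebra"
    unfolding eq by measurable
  then show ?thesis by (simp only: space_data)
qed

text \<open>The increment of the field from the base of stick \<open>j\<close> down to
  \<open>[0, a]\<close>, in the form of \<open>field_diff_proj\<close>; it is meant for sticks that
  start beyond \<open>a\<close>.\<close>

definition root_incr :: "real \<Rightarrow> nat \<Rightarrow> 'w \<Rightarrow> real" where
  "root_incr a j \<omega> = (\<Sum>i<j. B (yh a i \<omega> + exit_len (yy \<omega>) (zz \<omega>) a j (zz \<omega> j) i) \<omega> - B (yh a i \<omega>) \<omega>)"

text \<open>Given the tree the increment is a centred Gaussian of variance
  \<open>root_len a j\<close>. The pieces of the path lie in different sticks, hence are ordered,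
  and they are determined by the data, as \<open>exp_increments_le\<close> requires.\<close>

lemma exp_root_incr:
  fixes g :: "'w \<Rightarrow> ennreal"
  assumes a: "0 \<le> a" and g: "g \<in> borel_measurable data_algebra"
    and range: "\<And>\<omega>. \<omega> \<in> space M \<Longrightarrow> g \<omega> \<noteq> 0 \<Longrightarrow> a < yy \<omega> j \<and> yy \<omega> j \<le> b"
  obtains h where "h \<in> borel_measurable M"
    "AE \<omega> in M. h \<omega> = g \<omega> * ennreal (exp (c * root_incr a j \<omega>))"
    "(\<integral>\<^sup>+ \<omega>. h \<omega> \<partial>M) \<le> (\<integral>\<^sup>+ \<omega>. g \<omega> * ennreal (exp (c\<^sup>2 / 2 * root_len a j \<omega>)) \<partial>M)"
proof -
  \<comment> \<open>The weight is cut off where the tree conditions fail, so that the order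
    conditions hold wherever it is nonzero; almost surely nothing changes.\<close>
  define g' where "g' \<omega> = g \<omega> * indicator {\<omega> \<in> space M. stick_tree (yy \<omega>) (zz \<omega>)} \<omega>" for \<omega>
  have g': "g' \<in> borel_measurable data_algebra"
    unfolding g'_def using g tree_set_data by measurable
  have nz: "stick_tree (yy \<omega>) (zz \<omega>)" "a < yy \<omega> j" "yy \<omega> j \<le> b" if "\<omega> \<in> space M" "g' \<omega> \<noteq> 0" for \<omega>
    using that range[of \<omega>] by (auto simp: g'_def indicator_def split: if_splits)
  define q where "q i \<omega> = yh a i \<omega> + exit_len (yy \<omega>) (zz \<omega>) a j (zz \<omega> j) i" for i \<omega>
  have q: "q i \<in> borel_measurable data_algebra" for i
    unfolding q_def by (intro borel_measurable_add yh_data exit_len_measurable yy_data zz_data)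
  have qb: "0 \<le> yh a i \<omega> \<and> yh a i \<omega> \<le> q i \<omega> \<and> q i \<omega> \<le> yh a (Suc i) \<omega>" 
    if "\<omega> \<in> space M" "g' \<omega> \<noteq> 0" for \<omega> i
  proof -
    interpret stick_tree "yy \<omega>" "zz \<omega>" by (rule nz(1)[OF that])
    show ?thesis using exit_len_bounds[of "zz \<omega> j" j a i] z_le[of j] a by (simp add: q_def yh_def)
  qed
  have mono: "yh a i \<omega> \<le> yh a k \<omega>" if "\<omega> \<in> space M" "g' \<omega> \<noteq> 0" "i \<le> k" for \<omega> i k
  proof -
    interpret stick_tree "yy \<omega>" "zz \<omega>" by (rule nz(1)[OF that(1,2)])
    show ?thesis using y_le[OF that(3)] by (auto simp: yh_def)
  qed
  have AEg: "AE \<omega> in M. g' \<omega> = g \<omega>"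
    using AE_tree AE_space by eventually_elim (simp add: g'_def)
  obtain h where h: "h \<in> borel_measurable M"
    "AE \<omega> in M. h \<omega> = g' \<omega> * ennreal (exp (c * (\<Sum>i<j. B (q i \<omega>) \<omega> - B (yh a i \<omega>) \<omega>)))"
    "(\<integral>\<^sup>+ \<omega>. h \<omega> \<partial>M) \<le> (\<integral>\<^sup>+ \<omega>. g' \<omega> * ennreal (exp (c\<^sup>2 / 2 * (\<Sum>i<j. q i \<omega> - yh a i \<omega>))) \<partial>M)"
  proof (rule exp_increments_le[where n = j and b = b and c = c, OF indep_path_data space_data g' yh_data q])
    fix \<omega> i assume *: "\<omega> \<in> space M" "g' \<omega> \<noteq> 0" "i < j"
    have "yh a (Suc i) \<omega> \<le> yh a j \<omega>" using * by (intro mono) auto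
    also have "\<dots> \<le> b" using nz[OF *(1,2)] by (simp add: yh_def)
    finally show "0 \<le> yh a i \<omega> \<and> yh a i \<omega> \<le> q i \<omega> \<and> q i \<omega> \<le> b" using qb[OF *(1,2), of i] by auto
  next
    fix \<omega> i k assume *: "\<omega> \<in> space M" "g' \<omega> \<noteq> 0" "i < k" "k < j"
    have "yh a (Suc i) \<omega> \<le> yh a k \<omega>" using * by (intro mono) auto
    then show "q i \<omega> \<le> yh a k \<omega>" using qb[OF *(1,2), of i] by auto
  qed blast
  show ?thesis
  proof (rule that[OF h(1)])
    show "AE \<omega> in M. h \<omega> = g \<omega> * ennreal (exp (c * root_incr a j \<omega>))"
      using h(2) AEg by eventually_elim (simp add: root_incr_def q_def)
    have "(\<integral>\<^sup>+ \<omega>. g' \<omega> * ennreal (exp (c\<^sup>2 / 2 * (\<Sum>i<j. q i \<omega> - yh a i \<omega>))) \<partial>M)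
        = (\<integral>\<^sup>+ \<omega>. g \<omega> * ennreal (exp (c\<^sup>2 / 2 * root_len a j \<omega>)) \<partial>M)"
    proof (intro nn_integral_cong_AE, use AEg AE_space in eventually_elim)
      fix \<omega> assume e: "g' \<omega> = g \<omega>" and \<omega>: "\<omega> \<in> space M"
      show "g' \<omega> * ennreal (exp (c\<^sup>2 / 2 * (\<Sum>i<j. q i \<omega> - yh a i \<omega>)))
          = g \<omega> * ennreal (exp (c\<^sup>2 / 2 * root_len a j \<omega>))"
        using range[OF \<omega>] by (cases "g \<omega> = 0") (auto simp: e q_def root_len_def path_len_def)
    qed
    then show "(\<integral>\<^sup>+ \<omega>. h \<omega> \<partial>M) \<le> (\<integral>\<^sup>+ \<omega>. g \<omega> * ennreal (exp (c\<^sup>2 / 2 * root_len a j \<omega>)) \<partial>M)"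
      using h(3) by simp
  qed
qed

lemma cell_sum_meas:
  assumes "sees_mu N" "\<And>i. 1 \<le> i \<Longrightarrow> Y i \<in> borel_measurable N"
  shows "cell_sum \<kappa> a h K \<in> borel_measurable N"
proof -
  have "space N = space M" using assms(1) by (simp add: sees_mu_def)
  note [measurable] = cell_exp_measurable[OF this assms(2)] W_meas[OF assms(1)]
  show ?thesis unfolding cell_sum_def by measurable
qed

text \<open>The normalising weight \<open>exp (- S)\<close> depends on \<open>mu\<close> and the cut
  points only, so it is admissible both in the Gaussian step, given the data, and in
  \<open>exp_root_len_bound\<close>. The latter returns at most \<open>exp S\<close> by
  \<open>growth_le_exp_cell_sum\<close>, which cancels; what is left is the probability that stick
  \<open>j\<close> starts in \<open>[0, b]\<close>. The choice of \<open>c\<close> gives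
  \<open>c\<^sup>2 / 2 = m / 8\<close>.\<close>

lemma exp_root_incr_bound:
  assumes a: "0 \<le> a" and m: "2 \<le> m" and b: "b = a + real K * (1 / m)"
    and c: "c\<^sup>2 = m / 4"
  obtains h where "h \<in> borel_measurable M"
    "AE \<omega> in M. \<omega> \<in> space M \<longrightarrow> m / 2 \<le> W \<omega> a \<longrightarrow> a < yy \<omega> j \<longrightarrow> yy \<omega> j \<le> b \<longrightarrow>
       ennreal (exp (c * root_incr a j \<omega> - cell_sum (m / 8) a (1 / m) K \<omega>)) \<le> h \<omega>"
    "(\<integral>\<^sup>+ \<omega>. h \<omega> \<partial>M) \<le> (\<integral>\<^sup>+ \<omega>. indicator {i. 1 \<le> i \<and> Y i \<omega> \<in> {0..b}} j \<partial>M)"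
proof -
  define S where "S \<omega> = cell_sum (m / 8) a (1 / m) K \<omega>" for \<omega>
  define g :: "'w \<Rightarrow> ennreal" where
    "g \<omega> = (if m / 2 \<le> W \<omega> a \<and> a < yy \<omega> j \<and> yy \<omega> j \<le> b then ennreal (exp (- S \<omega>)) else 0)" for \<omega>
  have g: "g \<in> borel_measurable N" if "sees_mu N" "\<And>i. 1 \<le> i \<Longrightarrow> Y i \<in> borel_measurable N"
    "(\<lambda>\<omega>. yy \<omega> j) \<in> borel_measurable N" for N
  proof -
    note [measurable] = W_meas[OF that(1)] cell_sum_meas[OF that(1,2)] that(3)
    show ?thesis unfolding g_def S_def by measurable
  qed
  have gD: "g \<in> borel_measurable data_algebra" by (intro g sees_mu_data Y_data yy_data)
  have gF: "g \<in> borel_measurable FP" by (intro g sees_mu_points Y_points_meas yy_FP)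
  have g0: "g \<omega> \<noteq> 0 \<Longrightarrow> m / 2 \<le> W \<omega> a \<and> a < yy \<omega> j \<and> yy \<omega> j \<le> b" for \<omega>
    by (auto simp: g_def split: if_splits)
  obtain h where h: "h \<in> borel_measurable M"
    "AE \<omega> in M. h \<omega> = g \<omega> * ennreal (exp (c * root_incr a j \<omega>))"
    "(\<integral>\<^sup>+ \<omega>. h \<omega> \<partial>M) \<le> (\<integral>\<^sup>+ \<omega>. g \<omega> * ennreal (exp (c\<^sup>2 / 2 * root_len a j \<omega>)) \<partial>M)"
    using exp_root_incr[OF a gD, of j b c] g0 by blast
  have c2: "c\<^sup>2 / 2 = m / 8" using c by simp
  show ?thesis
  proof (rule that[OF h(1)])
    show "AE \<omega> in M. \<omega> \<in> space M \<longrightarrow> m / 2 \<le> W \<omega> a \<longrightarrow> a < yy \<omega> j \<longrightarrow> yy \<omega> j \<le> b \<longrightarrow>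
       ennreal (exp (c * root_incr a j \<omega> - cell_sum (m / 8) a (1 / m) K \<omega>)) \<le> h \<omega>"
      using h(2)
    proof eventually_elim
      case (elim \<omega>)
      have "exp (c * root_incr a j \<omega> - S \<omega>) = exp (- S \<omega>) * exp (c * root_incr a j \<omega>)"
        by (simp add: exp_add[symmetric])
      then show ?case unfolding elim by (simp add: g_def S_def[symmetric] ennreal_mult)
    qed
    have "(\<integral>\<^sup>+ \<omega>. g \<omega> * ennreal (exp (c\<^sup>2 / 2 * root_len a j \<omega>)) \<partial>M)
        \<le> (\<integral>\<^sup>+ \<omega>. g \<omega> * ennreal (growth (m / 8) a j \<omega> * (W \<omega> a / W \<omega> (yh a j \<omega>))) \<partial>M)"
      unfolding c2 using m by (intro exp_root_len_bound[OF gF a]) (auto dest!: g0)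
    also have "\<dots> \<le> (\<integral>\<^sup>+ \<omega>. indicator {i. 1 \<le> i \<and> Y i \<omega> \<in> {0..b}} j \<partial>M)"
    proof (intro nn_integral_mono_AE, use AE_tree AE_space in eventually_elim)
      fix \<omega> assume st: "stick_tree (yy \<omega>) (zz \<omega>)" and \<omega>: "\<omega> \<in> space M"
      show "g \<omega> * ennreal (growth (m / 8) a j \<omega> * (W \<omega> a / W \<omega> (yh a j \<omega>)))
          \<le> indicator {i. 1 \<le> i \<and> Y i \<omega> \<in> {0..b}} j"
      proof (cases "g \<omega> = 0")
        case False
        note * = g0[OF this]
        have j: "1 \<le> j" using * a by (cases j) (auto simp: yy_def)
        then have "yy \<omega> j = Y j \<omega>" by (simp add: yy_def)
        then have ind: "indicator {i. 1 \<le> i \<and> Y i \<omega> \<in> {0..b}} j = (1 :: ennreal)" using j * a by simp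
        have "growth (m / 8) a j \<omega> * (W \<omega> a / W \<omega> (yh a j \<omega>)) \<le> exp (S \<omega>)"
          unfolding S_def using * m a b by (intro growth_le_exp_cell_sum[OF st \<omega>]) auto
        then have "g \<omega> * ennreal (growth (m / 8) a j \<omega> * (W \<omega> a / W \<omega> (yh a j \<omega>)))
            \<le> ennreal (exp (- S \<omega>)) * ennreal (exp (S \<omega>))"
          by (intro mult_mono ennreal_leI) (auto simp: g_def)
        also have "\<dots> = 1" by (simp add: ennreal_mult[symmetric] exp_add[symmetric])
        finally show ?thesis unfolding ind .
      qed simp
    qed
    finally show "(\<integral>\<^sup>+ \<omega>. h \<omega> \<partial>M) \<le> (\<integral>\<^sup>+ \<omega>. indicator {i. 1 \<le> i \<and> Y i \<omega> \<in> {0..b}} j \<partial>M)"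
      using h(3) by (rule order_trans[rotated])
  qed
qed

text \<open>The sum over all sticks and both signs dominates each exponential simultaneously. Its
  expectation is at most twice the expected number of cut points in \<open>[0, b]\<close>, that is
  \<open>2 * (b * mean b)\<close>.\<close>

lemma root_incr_sum_bound:
  assumes a: "0 \<le> a" and m: "2 \<le> m" and b: "b = a + real K * (1 / m)"
  obtains V where "V \<in> borel_measurable M" "(\<integral>\<^sup>+ \<omega>. V \<omega> \<partial>M) \<le> ennreal (2 * b\<^sup>2)"
    "AE \<omega> in M. m / 2 \<le> W \<omega> a \<longrightarrow> (\<forall>j. a < yy \<omega> j \<longrightarrow> yy \<omega> j \<le> b \<longrightarrow>
       ennreal (exp (sqrt m / 2 * \<bar>root_incr a j \<omega>\<bar> - cell_sum (m / 8) a (1 / m) K \<omega>)) \<le> V \<omega>)"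
proof -
  define S where "S \<omega> = cell_sum (m / 8) a (1 / m) K \<omega>" for \<omega>
  define P where "P c j h \<longleftrightarrow> h \<in> borel_measurable M \<and>
    (AE \<omega> in M. \<omega> \<in> space M \<longrightarrow> m / 2 \<le> W \<omega> a \<longrightarrow> a < yy \<omega> j \<longrightarrow> yy \<omega> j \<le> b \<longrightarrow>
       ennreal (exp (c * root_incr a j \<omega> - S \<omega>)) \<le> h \<omega>) \<and>
    (\<integral>\<^sup>+ \<omega>. h \<omega> \<partial>M) \<le> (\<integral>\<^sup>+ \<omega>. indicator {i. 1 \<le> i \<and> Y i \<omega> \<in> {0..b}} j \<partial>M)" for c j h
  have ex: "\<exists>h. P c j h" if "c\<^sup>2 = m / 4" for c j
    using exp_root_incr_bound[OF a m b that, of j] unfolding P_def S_def by blast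
  have s2: "(sqrt m / 2)\<^sup>2 = m / 4" "(- (sqrt m / 2))\<^sup>2 = m / 4" using m by (simp_all add: power_divide)
  obtain hp where hp: "\<And>j. P (sqrt m / 2) j (hp j)" using ex[OF s2(1)] by metis
  obtain hm where hm: "\<And>j. P (- (sqrt m / 2)) j (hm j)" using ex[OF s2(2)] by metis
  define V where "V \<omega> = (\<Sum>j. hp j \<omega> + hm j \<omega>)" for \<omega>
  have hpm: "hp j \<in> borel_measurable M" and hmm: "hm j \<in> borel_measurable M" for j
    using hp[of j] hm[of j] by (auto simp: P_def)
  have b0: "0 \<le> b" using a m b by simp
  show ?thesis
  proof (rule that)
    show "V \<in> borel_measurable M" unfolding V_def using hpm hmm by measurable
    have cnt: "(\<lambda>\<omega>. indicator {i. 1 \<le> i \<and> Y i \<omega> \<in> {0..b}} j :: ennreal) \<in> borel_measurable M" for j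
    proof -
      have eq: "indicator {i. 1 \<le> i \<and> Y i \<omega> \<in> {0..b}} j
          = (if 1 \<le> j \<and> 0 \<le> Y j \<omega> \<and> Y j \<omega> \<le> b then 1 else 0 :: ennreal)" for \<omega>
        by (auto split: split_indicator)
      show ?thesis unfolding eq using Y_meas[of j] by measurable
    qed
    have "(\<integral>\<^sup>+ \<omega>. V \<omega> \<partial>M) = (\<Sum>j. (\<integral>\<^sup>+ \<omega>. hp j \<omega> \<partial>M) + (\<integral>\<^sup>+ \<omega>. hm j \<omega> \<partial>M))"
      unfolding V_def using hpm hmm by (simp add: nn_integral_suminf nn_integral_add)
    also have "\<dots> \<le> (\<Sum>j. (\<integral>\<^sup>+ \<omega>. indicator {i. 1 \<le> i \<and> Y i \<omega> \<in> {0..b}} j \<partial>M)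
        + (\<integral>\<^sup>+ \<omega>. indicator {i. 1 \<le> i \<and> Y i \<omega> \<in> {0..b}} j \<partial>M))"
      using hp hm unfolding P_def by (intro suminf_le add_mono summableI) auto
    also have "\<dots> = (\<Sum>j. \<integral>\<^sup>+ \<omega>. indicator {i. 1 \<le> i \<and> Y i \<omega> \<in> {0..b}} j \<partial>M)
        + (\<Sum>j. \<integral>\<^sup>+ \<omega>. indicator {i. 1 \<le> i \<and> Y i \<omega> \<in> {0..b}} j \<partial>M)"
      by (rule suminf_add[symmetric]) (rule summableI)+
    also have "(\<Sum>j. \<integral>\<^sup>+ \<omega>. indicator {i. 1 \<le> i \<and> Y i \<omega> \<in> {0..b}} j \<partial>M)
        = (\<integral>\<^sup>+ \<omega>. (\<Sum>j. indicator {i. 1 \<le> i \<and> Y i \<omega> \<in> {0..b}} j) \<partial>M)"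
      by (rule nn_integral_suminf[OF cnt, symmetric])
    also have "(\<integral>\<^sup>+ \<omega>. (\<Sum>j. indicator {i. 1 \<le> i \<and> Y i \<omega> \<in> {0..b}} j) \<partial>M)
        = (\<integral>\<^sup>+ \<omega>. emeasure (count_space UNIV) {i. 1 \<le> i \<and> Y i \<omega> \<in> {0..b}} \<partial>M)"
      by (intro nn_integral_cong) (simp add: nn_integral_count_space_nat[symmetric])
    also have "\<dots> + \<dots> \<le> ennreal (b * mean b) + ennreal (b * mean b)"
      using points_finite(2)[OF b0] by (intro add_mono)
    also have "\<dots> = ennreal (2 * (b * mean b))"
      using b0 mean_nonneg[OF b0] by (simp add: ennreal_plus[symmetric] del: ennreal_plus)
    also have "\<dots> \<le> ennreal (2 * b\<^sup>2)"
      using mult_left_mono[OF mean_le[OF b0] b0] by (intro ennreal_leI) (simp add: power2_eq_square)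
    finally show "(\<integral>\<^sup>+ \<omega>. V \<omega> \<partial>M) \<le> ennreal (2 * b\<^sup>2)" .
    have "AE \<omega> in M. \<forall>j. (m / 2 \<le> W \<omega> a \<longrightarrow> a < yy \<omega> j \<longrightarrow> yy \<omega> j \<le> b \<longrightarrow>
       ennreal (exp (sqrt m / 2 * root_incr a j \<omega> - S \<omega>)) \<le> hp j \<omega> \<and>
       ennreal (exp (- (sqrt m / 2) * root_incr a j \<omega> - S \<omega>)) \<le> hm j \<omega>)"
      unfolding AE_all_countable
    proof
      fix j
      have "AE \<omega> in M. \<omega> \<in> space M \<longrightarrow> m / 2 \<le> W \<omega> a \<longrightarrow> a < yy \<omega> j \<longrightarrow> yy \<omega> j \<le> b \<longrightarrow>
          ennreal (exp (sqrt m / 2 * root_incr a j \<omega> - S \<omega>)) \<le> hp j \<omega>"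
        "AE \<omega> in M. \<omega> \<in> space M \<longrightarrow> m / 2 \<le> W \<omega> a \<longrightarrow> a < yy \<omega> j \<longrightarrow> yy \<omega> j \<le> b \<longrightarrow>
          ennreal (exp (- (sqrt m / 2) * root_incr a j \<omega> - S \<omega>)) \<le> hm j \<omega>"
        using hp[of j] hm[of j] unfolding P_def by blast+
      then show "AE \<omega> in M. (m / 2 \<le> W \<omega> a \<longrightarrow> a < yy \<omega> j \<longrightarrow> yy \<omega> j \<le> b \<longrightarrow>
          ennreal (exp (sqrt m / 2 * root_incr a j \<omega> - S \<omega>)) \<le> hp j \<omega> \<and>
          ennreal (exp (- (sqrt m / 2) * root_incr a j \<omega> - S \<omega>)) \<le> hm j \<omega>)"
        using AE_space by eventually_elim blast
    qed
    then show "AE \<omega> in M. m / 2 \<le> W \<omega> a \<longrightarrow> (\<forall>j. a < yy \<omega> j \<longrightarrow> yy \<omega> j \<le> b \<longrightarrow>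
       ennreal (exp (sqrt m / 2 * \<bar>root_incr a j \<omega>\<bar> - cell_sum (m / 8) a (1 / m) K \<omega>)) \<le> V \<omega>)"
    proof eventually_elim
      case (elim \<omega>)
      show ?case
      proof (intro impI allI)
        fix j assume *: "m / 2 \<le> W \<omega> a" "a < yy \<omega> j" "yy \<omega> j \<le> b"
        have "ennreal (exp (sqrt m / 2 * \<bar>root_incr a j \<omega>\<bar> - S \<omega>)) \<le> max (hp j \<omega>) (hm j \<omega>)"
          using elim[rule_format, OF *] by (cases "0 \<le> root_incr a j \<omega>") (auto simp: le_max_iff_disj)
        also have "\<dots> \<le> hp j \<omega> + hm j \<omega>" by (auto simp: add_increasing add_increasing2)
        also have "\<dots> = (\<Sum>j\<in>{j}. hp j \<omega> + hm j \<omega>)" by simp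
        also have "\<dots> \<le> V \<omega>" unfolding V_def by (intro sum_le_suminf summableI) auto
        finally show "ennreal (exp (sqrt m / 2 * \<bar>root_incr a j \<omega>\<bar> - cell_sum (m / 8) a (1 / m) K \<omega>)) \<le> V \<omega>"
          by (simp add: S_def)
      qed
    qed
  qed
qed

section \<open>The estimate on one scale\<close>

text \<open>The path from \<open>x\<close> to \<open>[0, a]\<close> is a piece of the stick of
  \<open>x\<close>, followed by the path from the base of this stick, which \<open>root_incr\<close>
  measures. The piece lies in a gap, so \<open>exp (m / 8 * (x - p)) \<le> b ^ 4\<close> and its
  length is at most \<open>32 * \<rho>\<close>; \<open>osc_bound\<close> turns this into
  \<open>35 = 32 + 3\<close>.\<close>

lemma scale_bound:
  assumes st: "stick_tree (yy \<omega>) (zz \<omega>)" and \<omega>: "\<omega> \<in> space M"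
    and cont: "continuous_on {0..} (\<lambda>t. B t \<omega>)"
    and a: "0 \<le> a" and m: "0 < m" and b: "b = a + real K * (1 / m)" "1 < b"
    and \<rho>: "\<rho> = ln b / m" and R: "b \<le> real R * \<rho>" and fin: "osc \<rho> R \<omega> < \<top>"
    and cells: "(\<Sum>k<K. cell_exp (m / 8) a (1 / m) K k \<omega>) \<le> b ^ 4"
    and roots: "\<And>j. a < yy \<omega> j \<Longrightarrow> yy \<omega> j \<le> b \<Longrightarrow> \<bar>root_incr a j \<omega>\<bar> \<le> D" and D: "0 \<le> D"
    and x: "0 \<le> x" "x \<le> b"
  shows "\<bar>G \<omega> x
      - G \<omega> (stick_tree.proj (yy \<omega>) (zz \<omega>) a x)\<bar>
      \<le> D + 35 * enn2real (osc \<rho> R \<omega>)"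
proof -
  interpret stick_tree "yy \<omega>" "zz \<omega>" by fact
  have \<rho>0: "0 < \<rho>" using b m by (simp add: \<rho> ln_gt_zero)
  have "R \<noteq> 0" using R b by (cases R) auto
  then have R0: "0 < R" by simp
  have osc0: "0 \<le> enn2real (osc \<rho> R \<omega>)" by simp
  show ?thesis
  proof (cases "x \<le> a")
    case True
    then show ?thesis using proj_ident[OF x(1) True] D osc0 by simp
  next
    case False
    then have xa: "a < x" by simp
    obtain j where j: "yy \<omega> j < x" "x \<le> yy \<omega> (Suc j)"
      by (rule stick_cases[OF x(1)]) (use xa a in auto)
    define p where "p = yh a j \<omega>"
    have p: "a \<le> p" "p < x" using j xa by (auto simp: p_def yh_def)
    have "G \<omega> x - G \<omega> (proj a x)
        = (\<Sum>i<Suc j. B (yh a i \<omega> + exit_len (yy \<omega>) (zz \<omega>) a (Suc j) x i) \<omega> - B (yh a i \<omega>) \<omega>)"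
      using field_diff_proj[OF x(1) j(2) a, of "\<lambda>t. B t \<omega>"] by (simp only: yh_def)
    also have "\<dots> = (if yy \<omega> j \<le> a then 0 else root_incr a j \<omega>) + (B x \<omega> - B p \<omega>)"
      using j p exit_len_eq_0[of j j "yy \<omega>" "zz \<omega>" a "zz \<omega> j"]
      by (simp add: root_incr_def p_def yh_def[symmetric])
    finally have eq: "G \<omega> x - G \<omega> (proj a x)
        = (if yy \<omega> j \<le> a then 0 else root_incr a j \<omega>) + (B x \<omega> - B p \<omega>)" .
    have "x - p \<le> 32 * \<rho>"
    proof -
      define h where "h = 1 / m"
      have h: "0 < h" using m by (simp add: h_def)
      \<comment> \<open>The grid cell in which the piece begins; \<open>p < x\<close> and
        \<open>x \<le> b\<close> ensure that it is one of the \<open>K\<close> cells.\<close>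
      define k where "k = nat \<lfloor>(p - a) / h\<rfloor>"
      have "0 \<le> (p - a) / h" using p h by simp
      then have "real k = of_int \<lfloor>(p - a) / h\<rfloor>" unfolding k_def by (intro of_nat_nat) simp
      moreover have "of_int \<lfloor>(p - a) / h\<rfloor> \<le> (p - a) / h" "(p - a) / h < of_int \<lfloor>(p - a) / h\<rfloor> + 1" by linarith+
      ultimately have "real k \<le> (p - a) / h" "(p - a) / h < real k + 1" by simp_all
      then have k: "real k * h \<le> p - a" "p - a < (real k + 1) * h"
        using h by (simp_all only: pos_le_divide_eq pos_divide_less_eq)
      have "real k * h < real K * h" using k(1) p x(2) b(1) by (simp add: h_def)
      then have kK: "k < K" using h by simp
      have "\<omega> \<in> no_points {p<..<x}"
        using no_points_between[OF st \<omega>, of a j] j xa by (auto simp: no_points_def p_def yh_def)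
      then have "exp (m / 8 * (x - p)) \<le> cell_exp (m / 8) a h K k \<omega>"
        using p x b k kK m h by (intro cell_exp_ge[OF \<omega> h]) (auto simp: h_def)
      also have "\<dots> \<le> (\<Sum>k<K. cell_exp (m / 8) a h K k \<omega>)"
        using kK cell_exp_nonneg by (intro member_le_sum) auto
      also have "\<dots> \<le> b ^ 4" using cells by (simp add: h_def)
      also have "\<dots> = exp (4 * ln b)" using b(2) exp_of_nat_mult[of 4 "ln b"] by simp
      finally have "m / 8 * (x - p) \<le> 4 * ln b" by simp
      then show ?thesis using m by (simp add: \<rho> field_simps)
    qed
    then have "\<bar>B x \<omega> - B p \<omega>\<bar> \<le> real (32 + 3) * enn2real (osc \<rho> R \<omega>)"
      using p a x R by (intro osc_bound[OF cont \<rho>0 R0 fin]) auto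
    moreover have "\<bar>if yy \<omega> j \<le> a then 0 else root_incr a j \<omega>\<bar> \<le> D"
      using roots[of j] D j x by auto
    ultimately show ?thesis unfolding eq by (simp add: abs_le_iff)
  qed
qed

text \<open>\<open>8\<close> pays for the threshold \<open>b ^ 4\<close> on the exponentials,
  \<open>4 * cell_const\<close> for \<open>cell_sum\<close> after
  \<open>ln b + 1 \<le> 2 * ln b\<close>, and \<open>210 = 35 * 6\<close> for the
  oscillation.\<close>

definition scale_const :: real where
  "scale_const = 8 + 4 * cell_const + 210 * osc_const"

lemma scale_const_nonneg: "0 \<le> scale_const"
  using cell_const_pos osc_const(2) by (simp add: scale_const_def)

text \<open>The bound \<open>T\<close> is itself random, with control of its expectation only. The
  event \<open>Bad\<close> collects three failures: too little mass on \<open>[0, a]\<close>, a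
  normalised exponential beyond \<open>b ^ 4\<close>, and cell weights beyond \<open>b ^ 4\<close>,
  which would allow long gaps.\<close>

lemma scale_estimate:
  assumes a: "1 \<le> a" and m: "m = mean a" "2 \<le> m" and b: "b = a + real K * (1 / m)" "1 \<le> ln b"
  obtains Bad T where "Bad \<in> events" "prob Bad \<le> 16 / m\<^sup>2 + (2 + cell_const) / b\<^sup>2"
    "T \<in> borel_measurable M" "(\<integral>\<^sup>+ \<omega>. T \<omega> \<partial>M) \<le> ennreal (scale_const * ln b / sqrt m)"
    "AE \<omega> in M. \<omega> \<notin> Bad \<longrightarrow> T \<omega> < \<top> \<longrightarrow> (\<forall>x. 0 \<le> x \<longrightarrow> x \<le> b \<longrightarrow>
      \<bar>G \<omega> x
        - G \<omega> (stick_tree.proj (yy \<omega>) (zz \<omega>) a x)\<bar> \<le> enn2real (T \<omega>))"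
proof -
  have a0: "0 \<le> a" using a by simp
  have ma: "m \<le> a" using mean_le[OF a0] m by simp
  have ab: "a \<le> b" using b m by simp
  have bpos: "0 < b" using ab a by simp
  have b1: "1 < b" using b(2) bpos ln_gt_zero_iff[of b] by linarith
  have Kb: "real K \<le> b\<^sup>2"
  proof -
    have "real K = (b - a) * m" using b m by simp
    also have "\<dots> \<le> b * b" using a ma ab m by (intro mult_mono) auto
    finally show ?thesis by (simp add: power2_eq_square)
  qed
  \<comment> \<open>The length scale of the longest gaps. Since \<open>m * \<rho> = ln b\<close>,
    all terms of \<open>osc_expectation\<close> become of order \<open>ln b\<close>.\<close>
  define \<rho> where "\<rho> = ln b / m"
  have \<rho>: "0 < \<rho>" using b m by (simp add: \<rho>_def)
  define R where "R = nat \<lceil>b / \<rho>\<rceil>"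
  have "0 < b / \<rho>" using bpos \<rho> by simp
  then have Rr: "real R = of_int \<lceil>b / \<rho>\<rceil>" "0 < R" unfolding R_def by simp_all
  have R1: "b \<le> real R * \<rho>"
  proof -
    have "b / \<rho> \<le> real R" unfolding Rr by linarith
    then show ?thesis using \<rho> by (simp add: pos_divide_le_eq)
  qed
  have R2: "real R \<le> 2 * b\<^sup>2"
  proof -
    have "real R \<le> b / \<rho> + 1" unfolding Rr by linarith
    also have "b / \<rho> = b * m / ln b" by (simp add: \<rho>_def)
    also have "\<dots> \<le> b * m / 1" using b(2) m(2) bpos b1 by (intro divide_left_mono) auto
    also have "\<dots> \<le> b * b" using ma ab bpos by simp
    also have "b * b + 1 \<le> 2 * b\<^sup>2" using b1 by (simp add: power2_eq_square less_1_mult less_imp_le)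
    finally show ?thesis by simp
  qed
  obtain V where V: "V \<in> borel_measurable M" "(\<integral>\<^sup>+ \<omega>. V \<omega> \<partial>M) \<le> ennreal (2 * b\<^sup>2)"
    "AE \<omega> in M. m / 2 \<le> W \<omega> a \<longrightarrow> (\<forall>j. a < yy \<omega> j \<longrightarrow> yy \<omega> j \<le> b \<longrightarrow>
       ennreal (exp (sqrt m / 2 * \<bar>root_incr a j \<omega>\<bar> - cell_sum (m / 8) a (1 / m) K \<omega>)) \<le> V \<omega>)"
    using root_incr_sum_bound[OF a0 m(2) b(1)] by blast
  define E where "E = {\<omega> \<in> space M. m / 2 \<le> W \<omega> a}"
  have E: "E \<in> events" 
    using low_event[of m a] subalgebra_measure by (auto simp: E_def subalgebra_def)
  define S where "S = cell_sum (m / 8) a (1 / m) K"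
  define C where "C \<omega> = (\<Sum>k<K. cell_exp (m / 8) a (1 / m) K k \<omega>)" for \<omega>
  have Sm [measurable]: "S \<in> borel_measurable M"
    unfolding S_def using Y_meas by (intro cell_sum_meas sees_mu_M)
  have Cm [measurable]: "C \<in> borel_measurable M"
    unfolding C_def using Y_meas by (intro borel_measurable_sum cell_exp_measurable) auto
  note [measurable] = V(1) E W_meas[OF sees_mu_M]
  define F where "F \<omega> = indicator E \<omega> * ennreal (C \<omega>)" for \<omega>
  have Fm [measurable]: "F \<in> borel_measurable M" unfolding F_def by measurable
  define Bad where "Bad = {\<omega> \<in> space M. W \<omega> a < m / 2} \<union> ({\<omega> \<in> space M. ennreal (b ^ 4) \<le> V \<omega>}
      \<union> {\<omega> \<in> space M. ennreal (b ^ 4) \<le> F \<omega>})"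
  \<comment> \<open>The first two terms solve
    \<open>exp (sqrt m / 2 * \<bar>root_incr\<bar> - S) < b ^ 4\<close> for the increment; the
    indicator is there because \<open>S\<close> is controlled in expectation only on
    \<open>E\<close>.\<close>
  define T where "T \<omega> = ennreal (8 * ln b / sqrt m) + (ennreal (2 / sqrt m) * (indicator E \<omega> * ennreal (S \<omega>)) + 35 * osc \<rho> R \<omega>)" for \<omega>
  have osc_m [measurable]: "osc \<rho> R \<in> borel_measurable M" using \<rho> Rr by (intro osc_measurable) auto
  \<comment> \<open>Expectations of order \<open>b\<^sup>2\<close> against the threshold
    \<open>b ^ 4\<close> leave \<open>c / b\<^sup>2\<close>, which is summable over the
    scales.\<close>
  have markov: "prob {\<omega> \<in> space M. ennreal (b ^ 4) \<le> u \<omega>} \<le> c / b\<^sup>2"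
    if u: "u \<in> borel_measurable M" "(\<integral>\<^sup>+ \<omega>. u \<omega> \<partial>M) \<le> ennreal (c * b\<^sup>2)" and c: "0 \<le> c" for u c
  proof -
    have "{\<omega> \<in> space M. ennreal (b ^ 4) \<le> u \<omega>} \<subseteq> {\<omega> \<in> space M. 1 \<le> ennreal (1 / b ^ 4) * u \<omega>}"
    proof safe
      fix \<omega> assume "ennreal (b ^ 4) \<le> u \<omega>"
      then have "ennreal (1 / b ^ 4) * ennreal (b ^ 4) \<le> ennreal (1 / b ^ 4) * u \<omega>" by (rule mult_left_mono) simp
      then show "1 \<le> ennreal (1 / b ^ 4) * u \<omega>" using bpos by (simp add: ennreal_mult[symmetric])
    qed
    then have "emeasure M {\<omega> \<in> space M. ennreal (b ^ 4) \<le> u \<omega>} \<le> emeasure M {\<omega> \<in> space M. 1 \<le> ennreal (1 / b ^ 4) * u \<omega>}"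
      using u(1) by (intro emeasure_mono) measurable
    also have "\<dots> \<le> ennreal (1 / b ^ 4) * (\<integral>\<^sup>+ \<omega>. u \<omega> \<partial>M)"
      using nn_integral_Markov_inequality[of u "space M" M "ennreal (1 / b ^ 4)"] u(1)
      by (simp add: nn_integral_cong[of M "\<lambda>\<omega>. u \<omega> * indicator (space M) \<omega>" u])
    also have "\<dots> \<le> ennreal (1 / b ^ 4) * ennreal (c * b\<^sup>2)" using u(2) by (rule mult_left_mono) simp
    also have "\<dots> = ennreal (c / b\<^sup>2)"
      using bpos c by (simp add: ennreal_mult[symmetric] power2_eq_square power4_eq_xxxx)
    finally show ?thesis using bpos c by (simp add: emeasure_eq_measure)
  qed
  have S0: "0 \<le> S \<omega>" if "\<omega> \<in> E" for \<omega>
    unfolding S_def using that m by (intro cell_sum_nonneg) (auto simp: E_def)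
  show ?thesis
  proof (rule that)
    show "Bad \<in> events" unfolding Bad_def by measurable
    have "prob Bad \<le> prob {\<omega> \<in> space M. W \<omega> a < m / 2} + (prob {\<omega> \<in> space M. ennreal (b ^ 4) \<le> V \<omega>}
        + prob {\<omega> \<in> space M. ennreal (b ^ 4) \<le> F \<omega>})"
    proof -
      have 1: "{\<omega> \<in> space M. W \<omega> a < m / 2} \<in> events" "{\<omega> \<in> space M. ennreal (b ^ 4) \<le> V \<omega>} \<in> events"
        "{\<omega> \<in> space M. ennreal (b ^ 4) \<le> F \<omega>} \<in> events" by measurable
      have "prob Bad \<le> prob {\<omega> \<in> space M. W \<omega> a < m / 2} + prob ({\<omega> \<in> space M. ennreal (b ^ 4) \<le> V \<omega>}
        \<union> {\<omega> \<in> space M. ennreal (b ^ 4) \<le> F \<omega>})" unfolding Bad_def using 1 by (intro measure_Un_le sets.Un)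
      also have "prob ({\<omega> \<in> space M. ennreal (b ^ 4) \<le> V \<omega>} \<union> {\<omega> \<in> space M. ennreal (b ^ 4) \<le> F \<omega>})
          \<le> prob {\<omega> \<in> space M. ennreal (b ^ 4) \<le> V \<omega>} + prob {\<omega> \<in> space M. ennreal (b ^ 4) \<le> F \<omega>}"
        using 1 by (intro measure_Un_le)
      finally show ?thesis by simp
    qed
    also have "prob {\<omega> \<in> space M. W \<omega> a < m / 2} \<le> 16 / m\<^sup>2"
    proof -
      have "prob {\<omega> \<in> space M. W \<omega> a < m / 2} \<le> exp (- m\<^sup>2 / 16)"
        unfolding m(1) using a by (intro W_lower_tail) simp
      also have "\<dots> = 1 / exp (m\<^sup>2 / 16)" by (simp only: minus_divide_left[symmetric] exp_minus inverse_eq_divide)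
      also have "\<dots> \<le> 1 / (m\<^sup>2 / 16)"
      proof (intro divide_left_mono)
        show "m\<^sup>2 / 16 \<le> exp (m\<^sup>2 / 16)" using exp_ge_add_one_self[of "m\<^sup>2 / 16"] by linarith
      qed (use m(2) in auto)
      finally show ?thesis by simp
    qed
    also have "prob {\<omega> \<in> space M. ennreal (b ^ 4) \<le> V \<omega>} \<le> 2 / b\<^sup>2"
      using V by (intro markov) auto
    also have "prob {\<omega> \<in> space M. ennreal (b ^ 4) \<le> F \<omega>} \<le> cell_const / b\<^sup>2"
    proof (rule markov[OF Fm])
      have "(\<integral>\<^sup>+ \<omega>. F \<omega> \<partial>M) \<le> ennreal (cell_const * K)"
        unfolding F_def C_def E_def using m by (intro cell_exp_sum_expectation a0) simp
      also have "\<dots> \<le> ennreal (cell_const * b\<^sup>2)"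
        using Kb cell_const_pos by (intro ennreal_leI mult_left_mono) auto
      finally show "(\<integral>\<^sup>+ \<omega>. F \<omega> \<partial>M) \<le> ennreal (cell_const * b\<^sup>2)" .
    qed (use cell_const_pos in simp)
    finally show "prob Bad \<le> 16 / m\<^sup>2 + (2 + cell_const) / b\<^sup>2" by (simp add: add_divide_distrib)
    show "T \<in> borel_measurable M" unfolding T_def by measurable
    have "(\<integral>\<^sup>+ \<omega>. T \<omega> \<partial>M) = ennreal (8 * ln b / sqrt m)
        + (ennreal (2 / sqrt m) * (\<integral>\<^sup>+ \<omega>. indicator E \<omega> * ennreal (S \<omega>) \<partial>M) + 35 * (\<integral>\<^sup>+ \<omega>. osc \<rho> R \<omega> \<partial>M))"
      unfolding T_def by (simp add: nn_integral_add nn_integral_cmult emeasure_space_1)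
    also have "\<dots> \<le> ennreal (8 * ln b / sqrt m) + (ennreal (2 / sqrt m) * ennreal (cell_const * (ln b + 1))
        + 35 * ennreal (osc_const * (6 * ln b) / sqrt m))"
    proof (intro add_left_mono add_mono mult_left_mono)
      show "(\<integral>\<^sup>+ \<omega>. indicator E \<omega> * ennreal (S \<omega>) \<partial>M) \<le> ennreal (cell_const * (ln b + 1))"
        unfolding E_def S_def using b1 by (intro cell_sum_expectation[OF a0 m(2) b(1)]) simp
      have "ln (2 * real R) \<le> ln (4 * b\<^sup>2)"
        using R2 Rr(2) bpos by (subst ln_le_cancel_iff) auto
      also have "\<dots> = 2 * ln 2 + 2 * ln b"
        using bpos ln_realpow[of 2 2] by (simp add: ln_mult ln_realpow)
      also have "\<dots> \<le> 2 + 2 * ln b" using ln_2_less_1 by simp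
      \<comment> \<open>The left side is at most \<open>3 + 5 / 2 * ln b\<close>, and
        \<open>1 \<le> ln b\<close> absorbs the constant.\<close>
      finally have "ln (2 * real R) + m * \<rho> / 2 + 1 \<le> 6 * ln b"
        using b(2) m by (simp add: \<rho>_def)
      then have "osc_const * (ln (2 * real R) + m * \<rho> / 2 + 1) / sqrt m \<le> osc_const * (6 * ln b) / sqrt m"
        using osc_const(2) m by (intro divide_right_mono mult_left_mono) auto
      then have le: "ennreal (osc_const * (ln (2 * real R) + m * \<rho> / 2 + 1) / sqrt m) \<le> ennreal (osc_const * (6 * ln b) / sqrt m)"
        by (rule ennreal_leI)
      have "0 < m" using m(2) by linarith
      from order_trans[OF osc_expectation[OF \<rho> Rr(2) this] le]
      show "(\<integral>\<^sup>+ \<omega>. osc \<rho> R \<omega> \<partial>M) \<le> ennreal (osc_const * (6 * ln b) / sqrt m)" .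
    qed auto
    also have "\<dots> = ennreal (8 * ln b / sqrt m + (2 / sqrt m * (cell_const * (ln b + 1)) + 35 * (osc_const * (6 * ln b) / sqrt m)))"
    proof -
      have "0 \<le> osc_const * (6 * ln b) / sqrt m" "0 \<le> 2 / sqrt m" "0 \<le> cell_const * (ln b + 1)" "0 \<le> 8 * ln b / sqrt m"
        using osc_const(2) cell_const_pos b m by auto
      then show ?thesis
        by (simp only: ennreal_plus ennreal_mult mult_nonneg_nonneg add_nonneg_nonneg zero_le_numeral ennreal_numeral)
    qed
    also have "\<dots> \<le> ennreal (scale_const * ln b / sqrt m)"
    proof (rule ennreal_leI)
      have "cell_const * (ln b + 1) \<le> cell_const * (2 * ln b)" using cell_const_pos b by (intro mult_left_mono) auto
      then have "8 * ln b + 2 * (cell_const * (ln b + 1)) + 35 * (osc_const * (6 * ln b)) \<le> scale_const * ln b"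
        by (simp add: scale_const_def algebra_simps)
      then have "(8 * ln b + 2 * (cell_const * (ln b + 1)) + 35 * (osc_const * (6 * ln b))) / sqrt m \<le> scale_const * ln b / sqrt m"
        using m by (intro divide_right_mono) auto
      then show "8 * ln b / sqrt m + (2 / sqrt m * (cell_const * (ln b + 1)) + 35 * (osc_const * (6 * ln b) / sqrt m))
          \<le> scale_const * ln b / sqrt m" by (simp add: add_divide_distrib)
    qed
    finally show "(\<integral>\<^sup>+ \<omega>. T \<omega> \<partial>M) \<le> ennreal (scale_const * ln b / sqrt m)" .
    show "AE \<omega> in M. \<omega> \<notin> Bad \<longrightarrow> T \<omega> < \<top> \<longrightarrow> (\<forall>x. 0 \<le> x \<longrightarrow> x \<le> b \<longrightarrow>
      \<bar>G \<omega> x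
        - G \<omega> (stick_tree.proj (yy \<omega>) (zz \<omega>) a x)\<bar> \<le> enn2real (T \<omega>))"
      using V(3) AE_tree AE_continuous AE_space
    proof eventually_elim
      case (elim \<omega>)
      show ?case
      proof (intro impI allI)
        fix x assume good: "\<omega> \<notin> Bad" and Tfin: "T \<omega> < \<top>" and x: "0 \<le> x" "x \<le> b"
        have WE: "m / 2 \<le> W \<omega> a" using good elim(4) by (auto simp: Bad_def not_less)
        then have \<omega>E: "\<omega> \<in> E" using elim(4) by (simp add: E_def)
        have Vb: "V \<omega> < ennreal (b ^ 4)" using good elim(4) by (auto simp: Bad_def not_le)
        have Fb: "F \<omega> < ennreal (b ^ 4)" using good elim(4) by (auto simp: Bad_def not_le)
        have C: "C \<omega> \<le> b ^ 4"
        proof -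
          have "0 \<le> C \<omega>" unfolding C_def by (intro sum_nonneg cell_exp_nonneg)
          then show ?thesis using Fb \<omega>E by (simp add: F_def ennreal_less_iff)
        qed
        have fin: "osc \<rho> R \<omega> < \<top>"
          using Tfin by (auto simp: T_def ennreal_mult_less_top less_top)
        define D where "D = 8 * ln b / sqrt m + 2 / sqrt m * S \<omega>"
        have D0: "0 \<le> D" unfolding D_def using S0[OF \<omega>E] b m by simp
        have roots: "\<bar>root_incr a j \<omega>\<bar> \<le> D" if j: "a < yy \<omega> j" "yy \<omega> j \<le> b" for j
        proof -
          have "ennreal (exp (sqrt m / 2 * \<bar>root_incr a j \<omega>\<bar> - S \<omega>)) \<le> V \<omega>"
            using elim(1) WE j by (simp add: S_def)
          also note Vb
          finally have "exp (sqrt m / 2 * \<bar>root_incr a j \<omega>\<bar> - S \<omega>) < b ^ 4" by (simp add: ennreal_less_iff)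
          also have "b ^ 4 = exp (4 * ln b)" using bpos exp_of_nat_mult[of 4 "ln b"] by simp
          finally have "sqrt m / 2 * \<bar>root_incr a j \<omega>\<bar> \<le> 4 * ln b + S \<omega>" by simp
          then have "\<bar>root_incr a j \<omega>\<bar> \<le> (4 * ln b + S \<omega>) / (sqrt m / 2)"
            using m by (simp add: pos_le_divide_eq mult.commute)
          then show ?thesis by (simp add: D_def add_divide_distrib mult.commute)
        qed
        have "\<bar>G \<omega> x
          - G \<omega> (stick_tree.proj (yy \<omega>) (zz \<omega>) a x)\<bar>
          \<le> D + 35 * enn2real (osc \<rho> R \<omega>)"
          using m b b1 R1 fin C roots D0 x
          by (intro scale_bound[OF elim(2,4,3) a0 _ b(1) b1 \<rho>_def]) (auto simp: C_def)
        also have "\<dots> = enn2real (T \<omega>)"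
        proof -
          have o: "osc \<rho> R \<omega> = ennreal (enn2real (osc \<rho> R \<omega>))" using fin by simp
          have nn: "0 \<le> 8 * ln b / sqrt m" "0 \<le> 2 / sqrt m * S \<omega>" "0 \<le> 2 / sqrt m" "0 \<le> enn2real (osc \<rho> R \<omega>)"
            using S0[OF \<omega>E] b m by auto
          have "T \<omega> = ennreal (8 * ln b / sqrt m) + (ennreal (2 / sqrt m) * ennreal (S \<omega>) + ennreal 35 * ennreal (enn2real (osc \<rho> R \<omega>)))"
            unfolding T_def using \<omega>E o by simp
          also have "\<dots> = ennreal (8 * ln b / sqrt m + (2 / sqrt m * S \<omega> + 35 * enn2real (osc \<rho> R \<omega>)))"
            using nn S0[OF \<omega>E]
            by (simp only: ennreal_plus ennreal_mult mult_nonneg_nonneg add_nonneg_nonneg zero_le_numeral)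
          finally show ?thesis unfolding D_def using nn by (simp only: add.assoc enn2real_ennreal add_nonneg_nonneg mult_nonneg_nonneg zero_le_numeral)
        qed
        finally show "\<bar>G \<omega> x
          - G \<omega> (stick_tree.proj (yy \<omega>) (zz \<omega>) a x)\<bar> \<le> enn2real (T \<omega>)" .
      qed
    qed
  qed
qed

end

subsection \<open>Summation over the scales\<close>

definition tower :: "nat \<Rightarrow> real" where "tower n = 2 ^ (2 ^ n)"

lemma tower_pos: "0 < tower n" by (simp add: tower_def)

lemma ln_tower: "ln (tower n) = 2 ^ n * ln 2"
  unfolding tower_def by (subst ln_realpow) simp_all

lemma tower_ge: "2 ^ n \<le> tower n"
  unfolding tower_def by (intro power_increasing less_imp_le[OF less_exp]) simp

lemma mono_tower: "mono tower"
  unfolding tower_def by (intro monoI power_increasing) simp_all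

lemma tower_unbounded: "\<exists>n. x \<le> tower n"
proof -
  obtain n where "x \<le> real n" using real_arch_simple by blast
  also have "real n \<le> 2 ^ n" by (rule less_imp_le[OF of_nat_less_two_power])
  also have "\<dots> \<le> tower n" by (rule tower_ge)
  finally show ?thesis by blast
qed

context icrt_space
begin

text \<open>The integral of \<open>1 / l\<close> over one piece is \<open>2 ^ k * ln 2\<close>. As
  \<open>mean\<close> increases, evaluating it at the right end bounds the piece of the integral
  from below by \<open>ln 2 / 2\<close> times the term with index \<open>Suc k\<close>; the pieces
  are disjoint.\<close>

lemma summable_tower_mean:
  assumes A: "set_integrable lborel {A..} (\<lambda>l. 1 / (l * sqrt (mean l)))"
  shows "summable (\<lambda>n. 2 ^ n / sqrt (mean (tower n)))"
proof -
  define f where "f l = 1 / (l * sqrt (mean l))" for l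
  define g where "g l = ennreal (indicator {A..} l * f l)" for l
  have gm: "g \<in> borel_measurable lborel"
    using A unfolding set_integrable_def g_def f_def by (auto dest: borel_measurable_integrable)
  have fin: "(\<integral>\<^sup>+ l. g l \<partial>lborel) < \<infinity>"
  proof -
    have "(\<integral>\<^sup>+ l. g l \<partial>lborel) \<le> (\<integral>\<^sup>+ l. ennreal (norm (indicator {A..} l *\<^sub>R f l)) \<partial>lborel)"
      unfolding g_def by (intro nn_integral_mono ennreal_leI) simp
    also have "\<dots> < \<infinity>"
      using A unfolding set_integrable_def f_def by (simp add: integrable_iff_bounded)
    finally show ?thesis .
  qed
  obtain N where N: "A \<le> tower N" using tower_unbounded by blast
  define c where "c n = 2 ^ n / sqrt (mean (tower n))" for n
  define I where "I n = {tower (N + n)..<tower (Suc (N + n))}" for n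
  have c0: "0 \<le> c n" for n using mean_nonneg[of "tower n"] tower_pos[of n] by (simp add: c_def)
  have piece: "ennreal (ln 2 / 2 * c (Suc (N + n))) \<le> (\<integral>\<^sup>+ l. g l * indicator (I n) l \<partial>lborel)" for n
  proof -
    define k where "k = N + n"
    have sk: "0 < tower k" "tower k \<le> tower (Suc k)" using tower_pos monoD[OF mono_tower, of k "Suc k"] by simp_all
    have Ak: "A \<le> tower k" using N monoD[OF mono_tower, of N k] by (simp add: k_def)
    define s where "s = sqrt (mean (tower (Suc k)))"
    have s: "0 < s" using mean_pos[OF tower_pos] by (simp add: s_def)
    have "ennreal (ln (tower (Suc k)) - ln (tower k))
        = (\<integral>\<^sup>+ l. ennreal (1 / l) * indicator {tower k..tower (Suc k)} l \<partial>lborel)"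
      using sk by (intro nn_integral_FTC_Icc[symmetric]) (auto intro!: derivative_eq_intros simp: divide_inverse)
    also have "\<dots> = (\<integral>\<^sup>+ l. ennreal (1 / l) * indicator (I n) l \<partial>lborel)"
      unfolding I_def k_def[symmetric]
    proof (intro nn_integral_cong_AE eventually_mono[OF AE_lborel_singleton[of "tower (Suc k)"]])
      fix l assume "l \<noteq> tower (Suc k)"
      then show "ennreal (1 / l) * indicator {tower k..tower (Suc k)} l = ennreal (1 / l) * indicator {tower k..<tower (Suc k)} l"
        by (auto simp: indicator_def)
    qed
    finally have "ennreal (1 / s) * ennreal (ln (tower (Suc k)) - ln (tower k))
        = (\<integral>\<^sup>+ l. ennreal (1 / s) * (ennreal (1 / l) * indicator (I n) l) \<partial>lborel)"
      by (subst nn_integral_cmult) (simp_all add: I_def)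
    also have "\<dots> \<le> (\<integral>\<^sup>+ l. g l * indicator (I n) l \<partial>lborel)"
    proof (intro nn_integral_mono)
      fix l
      show "ennreal (1 / s) * (ennreal (1 / l) * indicator (I n) l) \<le> g l * indicator (I n) l"
      proof (cases "l \<in> I n")
        case True
        then have l: "tower k \<le> l" "l < tower (Suc k)" by (auto simp: I_def k_def)
        have l0: "0 < l" using l sk by simp
        have "sqrt (mean l) \<le> s" unfolding s_def using l l0 by (intro real_sqrt_le_mono mean_mono) auto
        moreover have "0 < sqrt (mean l)" using mean_pos[OF l0] by simp
        ultimately have "1 / s \<le> 1 / sqrt (mean l)" using s by (intro divide_left_mono mult_pos_pos) auto
        then have "1 / s * (1 / l) \<le> 1 / sqrt (mean l) * (1 / l)" using l0 by (intro mult_right_mono) auto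
        also have "\<dots> = f l" by (simp add: f_def mult.commute)
        finally have "ennreal (1 / s) * ennreal (1 / l) \<le> ennreal (f l)"
          using s l0 by (simp add: ennreal_mult[symmetric] ennreal_leI)
        then show ?thesis using True l Ak by (simp add: g_def)
      qed simp
    qed
    also have "ennreal (1 / s) * ennreal (ln (tower (Suc k)) - ln (tower k)) = ennreal (ln 2 / 2 * c (Suc (N + n)))"
    proof -
      have "ln (tower (Suc k)) - ln (tower k) = 2 ^ k * ln 2" by (simp add: ln_tower)
      then have e: "1 / s * (ln (tower (Suc k)) - ln (tower k)) = ln 2 / 2 * c (Suc k)"
        by (simp add: c_def s_def)
      have "ennreal (1 / s) * ennreal (ln (tower (Suc k)) - ln (tower k))
          = ennreal (1 / s * (ln (tower (Suc k)) - ln (tower k)))"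
        using s sk by (intro ennreal_mult[symmetric]) auto
      then show ?thesis unfolding e by (simp only: k_def)
    qed
    finally show ?thesis .
  qed
  have disj: "disjoint_family I"
  proof -
    have "I i \<inter> I j = {}" if "i < j" for i j
      using monoD[OF mono_tower, of "Suc (N + i)" "N + j"] that by (auto simp: I_def)
    then show ?thesis unfolding disjoint_family_on_def by (metis Int_commute linorder_neqE_nat)
  qed
  have "(\<Sum>n. ennreal (ln 2 / 2 * c (Suc (N + n)))) \<le> (\<Sum>n. \<integral>\<^sup>+ l. g l * indicator (I n) l \<partial>lborel)"
    by (intro suminf_le piece summableI)
  also have "\<dots> = (\<integral>\<^sup>+ l. (\<Sum>n. g l * indicator (I n) l) \<partial>lborel)"
    using gm by (intro nn_integral_suminf[symmetric] borel_measurable_times_ennreal) (simp_all add: I_def)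
  also have "\<dots> = (\<integral>\<^sup>+ l. g l * indicator (\<Union>n. I n) l \<partial>lborel)"
    using suminf_indicator[OF disj] by simp
  also have "\<dots> \<le> (\<integral>\<^sup>+ l. g l \<partial>lborel)" by (intro nn_integral_mono) (simp split: split_indicator)
  finally have "(\<Sum>n. ennreal (ln 2 / 2 * c (Suc (N + n)))) < \<top>" using fin by (auto intro: le_less_trans)
  then have "summable (\<lambda>n. ln 2 / 2 * c (Suc (N + n)))"
    using c0 by (intro summable_suminf_not_top) auto
  then have "summable (\<lambda>n. c (n + Suc N))"
    by (subst (asm) summable_cmult_iff) (simp add: add.commute)
  then show ?thesis unfolding c_def by (rule summable_iff_shift[THEN iffD1])
qed

end

context icrt_gff
begin

text \<open>Borel-Cantelli disposes of the bad events, whose probabilities are of order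
  \<open>(1 / 4) ^ n\<close>. The sum of the random bounds has finite expectation, so it is finite
  almost surely, and both facts together give the hypotheses of
  \<open>field_approx_of_summable\<close>.\<close>

lemma AE_field_uniformly_continuous:
  assumes A: "set_integrable lborel {A..} (\<lambda>l. 1 / (l * sqrt (mean l)))"
  shows "AE \<omega> in M. uniformly_continuous_map (line_metric (yy \<omega>) (zz \<omega>)) euclidean_metric
           (G \<omega>)"
proof -
  define m where "m n = mean (tower n)" for n
  define c where "c n = 2 ^ n / sqrt (m n)" for n
  have mpos: "0 < m n" for n unfolding m_def by (rule mean_pos[OF tower_pos])
  have c: "summable c" "\<And>n. 0 \<le> c n"
    using summable_tower_mean[OF A] mpos by (simp_all add: c_def[abs_def] m_def less_imp_le)
  have "\<forall>\<^sub>F n in sequentially. c n < 1"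
    using order_tendstoD(2)[OF summable_LIMSEQ_zero[OF c(1)], of 1] by simp
  then obtain n1 where n1: "\<And>n. n \<ge> n1 \<Longrightarrow> c n < 1" unfolding eventually_sequentially by blast
  define n0 where "n0 = max n1 2"
  \<comment> \<open>The terms of a summable sequence are eventually below one, and this already
    forces the growth of the mean that makes the lower tails of the mass summable.\<close>
  have m4: "4 ^ n \<le> m n" if "n \<ge> n0" for n
  proof -
    have "c n < 1" using that n1[of n] by (simp add: n0_def)
    then have "2 ^ n < sqrt (m n)" using mpos[of n] by (simp add: c_def)
    then have "(2 ^ n)\<^sup>2 < (sqrt (m n))\<^sup>2" by (intro power_strict_mono) auto
    then have "(2 ^ n)\<^sup>2 < m n" using mpos[of n] by simp
    then show ?thesis by (simp add: power2_eq_square power_mult_distrib[symmetric])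
  qed
  \<comment> \<open>The grid consists of whole cells of length \<open>1 / m n\<close>, so
    \<open>b n\<close> may overshoot \<open>tower (Suc n)\<close>, by at most one cell.\<close>
  define K where "K n = nat \<lceil>(tower (Suc n) - tower n) * m n\<rceil>" for n
  define b where "b n = tower n + real (K n) * (1 / m n)" for n
  have sS: "tower n \<le> tower (Suc n)" for n using monoD[OF mono_tower, of n "Suc n"] by simp
  have Kr: "(tower (Suc n) - tower n) * m n \<le> real (K n)" "real (K n) \<le> (tower (Suc n) - tower n) * m n + 1" for n
  proof -
    have "0 \<le> (tower (Suc n) - tower n) * m n" using sS[of n] mpos[of n] by simp
    then have "real (K n) = of_int \<lceil>(tower (Suc n) - tower n) * m n\<rceil>"
      unfolding K_def by (intro of_nat_nat) (simp add: less_le_trans[of "-1" 0])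
    then show "(tower (Suc n) - tower n) * m n \<le> real (K n)" "real (K n) \<le> (tower (Suc n) - tower n) * m n + 1"
      by linarith+
  qed
  have b_ge: "tower (Suc n) \<le> b n" for n
    using Kr(1)[of n] mpos[of n] by (simp add: b_def field_simps)
  have b_le: "b n \<le> tower (Suc n) + 1 / m n" for n
  proof -
    have "real (K n) * (1 / m n) \<le> ((tower (Suc n) - tower n) * m n + 1) * (1 / m n)"
      using Kr(2)[of n] mpos[of n] by (intro mult_right_mono) auto
    also have "\<dots> = tower (Suc n) - tower n + 1 / m n" using mpos[of n] by (simp add: add_divide_distrib)
    finally show ?thesis by (simp add: b_def)
  qed
  have big: "2 \<le> m n" "1 \<le> ln (b n)" "ln (b n) \<le> 4 * 2 ^ n" "1 \<le> tower n" "(2::real) ^ n \<le> b n" if n: "n \<ge> n0" for n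
  proof -
    have n2: "2 \<le> n" using n by (simp add: n0_def)
    have "(4::real) ^ 2 \<le> 4 ^ n" using n2 by (intro power_increasing) auto
    then show m2: "2 \<le> m n" using m4[OF n] by simp
    show "1 \<le> tower n" by (simp add: tower_def)
    show "2 ^ n \<le> b n" using tower_ge[of n] sS[of n] b_ge[of n] by linarith
    have bp: "0 < b n" using b_ge[of n] tower_pos[of "Suc n"] by linarith
    have "(2::real) ^ 3 \<le> 2 ^ Suc n" using n2 by (intro power_increasing) auto
    then have "8 * ln 2 \<le> (2::real) ^ Suc n * ln 2" by (intro mult_right_mono) auto
    also have "\<dots> = ln (tower (Suc n))" by (simp only: ln_tower)
    also have "\<dots> \<le> ln (b n)" using b_ge[of n] tower_pos[of "Suc n"] by simp
    finally have "8 * ln 2 \<le> ln (b n)" .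
    moreover have "1 / 2 \<le> ln (2 :: real)" using ln_ge_iff[of 2 "1/2"] exp_bound[of "1/2"] by (simp add: power2_eq_square)
    ultimately show "1 \<le> ln (b n)" by simp
    have "1 / m n \<le> 1" using m2 by simp
    then have "b n \<le> 2 * tower (Suc n)" using b_le[of n] \<open>1 \<le> tower n\<close> sS[of n] by linarith
    then have "ln (b n) \<le> ln (2 * tower (Suc n))" using bp by simp
    also have "\<dots> = (1 + 2 ^ Suc n) * ln 2" using tower_pos[of "Suc n"] by (simp add: ln_mult ln_tower algebra_simps)
    also have "\<dots> \<le> (1 + 2 ^ Suc n) * 1" using ln_2_less_1 by (intro mult_left_mono) auto
    also have "\<dots> \<le> 4 * 2 ^ n"
    proof -
      have "(1::real) \<le> 2 ^ n" by simp
      then show ?thesis unfolding power_Suc mult_1_right by linarith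
    qed
    finally show "ln (b n) \<le> 4 * 2 ^ n" .
  qed
  \<comment> \<open>For \<open>n < n0\<close> the empty event and the bound zero satisfy
    \<open>P\<close>, so that sequences indexed by all \<open>n\<close> can be chosen.\<close>
  define P where "P n Bad T \<longleftrightarrow> Bad \<in> events \<and> prob Bad \<le> (18 + cell_const) * (1 / 4) ^ n \<and>
      T \<in> borel_measurable M \<and> (\<integral>\<^sup>+ \<omega>. T \<omega> \<partial>M) \<le> ennreal (4 * scale_const * c n) \<and>
      (n0 \<le> n \<longrightarrow> (AE \<omega> in M. \<omega> \<notin> Bad \<longrightarrow> T \<omega> < \<top> \<longrightarrow> (\<forall>x. 0 \<le> x \<longrightarrow> x \<le> tower (Suc n) \<longrightarrow>
        \<bar>G \<omega> x
          - G \<omega> (stick_tree.proj (yy \<omega>) (zz \<omega>) (tower n) x)\<bar> \<le> enn2real (T \<omega>))))"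
    for n Bad T
  have "\<exists>Bad T. P n Bad T" for n
  proof (cases "n0 \<le> n")
    case False
    then have "P n {} (\<lambda>_. 0)" using cell_const_pos by (simp add: P_def)
    then show ?thesis by blast
  next
    case True
    note bn = big[OF True]
    obtain Bad T where BT: "Bad \<in> events" "prob Bad \<le> 16 / (m n)\<^sup>2 + (2 + cell_const) / (b n)\<^sup>2"
      "T \<in> borel_measurable M" "(\<integral>\<^sup>+ \<omega>. T \<omega> \<partial>M) \<le> ennreal (scale_const * ln (b n) / sqrt (m n))"
      "AE \<omega> in M. \<omega> \<notin> Bad \<longrightarrow> T \<omega> < \<top> \<longrightarrow> (\<forall>x. 0 \<le> x \<longrightarrow> x \<le> b n \<longrightarrow>
      \<bar>G \<omega> x
        - G \<omega> (stick_tree.proj (yy \<omega>) (zz \<omega>) (tower n) x)\<bar> \<le> enn2real (T \<omega>))"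
      by (rule scale_estimate[OF bn(4) m_def bn(1) b_def bn(2)]) blast
    have "prob Bad \<le> (18 + cell_const) * (1 / 4) ^ n"
    proof -
      have "(4::real) ^ n \<le> (m n)\<^sup>2"
      proof -
        have "(4::real) ^ n * 1 \<le> m n * m n" using m4[OF True] bn(1) by (intro mult_mono) auto
        then show ?thesis by (simp add: power2_eq_square)
      qed
      then have "16 / (m n)\<^sup>2 \<le> 16 / 4 ^ n" using mpos[of n] by (intro divide_left_mono) auto
      moreover have "(4::real) ^ n \<le> (b n)\<^sup>2"
        using power_mono[OF bn(5), of 2] by (simp add: power2_eq_square power_mult_distrib[symmetric])
      then have "(2 + cell_const) / (b n)\<^sup>2 \<le> (2 + cell_const) / 4 ^ n"
        using cell_const_pos order_less_le_trans[of 0 "4 ^ n" "(b n)\<^sup>2"] by (intro divide_left_mono) auto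
      ultimately have "prob Bad \<le> 16 / 4 ^ n + (2 + cell_const) / 4 ^ n" using BT(2) by linarith
      then show ?thesis by (simp add: power_one_over add_divide_distrib[symmetric])
    qed
    moreover have "(\<integral>\<^sup>+ \<omega>. T \<omega> \<partial>M) \<le> ennreal (4 * scale_const * c n)"
    proof -
      have "scale_const * ln (b n) \<le> scale_const * (4 * 2 ^ n)"
        using bn(3) scale_const_nonneg by (rule mult_left_mono)
      then have "scale_const * ln (b n) / sqrt (m n) \<le> scale_const * (4 * 2 ^ n) / sqrt (m n)"
        using mpos[of n] by (intro divide_right_mono) auto
      also have "\<dots> = 4 * scale_const * c n" by (simp add: c_def)
      finally show ?thesis using BT(4) by (auto intro: order_trans ennreal_leI)
    qed
    moreover have "AE \<omega> in M. \<omega> \<notin> Bad \<longrightarrow> T \<omega> < \<top> \<longrightarrow> (\<forall>x. 0 \<le> x \<longrightarrow> x \<le> tower (Suc n) \<longrightarrow>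
        \<bar>G \<omega> x
          - G \<omega> (stick_tree.proj (yy \<omega>) (zz \<omega>) (tower n) x)\<bar> \<le> enn2real (T \<omega>))"
      using BT(5) by eventually_elim (meson b_ge order_trans)
    ultimately have "P n Bad T" unfolding P_def using BT(1,3) by blast
    then show ?thesis by blast
  qed
  then obtain Bad T where BT: "\<And>n. P n (Bad n) (T n)" by metis
  have Badm: "Bad n \<in> events" and Badp: "prob (Bad n) \<le> (18 + cell_const) * (1 / 4) ^ n"
    and Tm: "T n \<in> borel_measurable M" and Tint: "(\<integral>\<^sup>+ \<omega>. T n \<omega> \<partial>M) \<le> ennreal (4 * scale_const * c n)" for n
    using BT[of n] unfolding P_def by blast+
  have ev: "AE \<omega> in M. \<forall>\<^sub>F n in sequentially. \<omega> \<in> space M - Bad n"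
  proof (rule borel_cantelli_AE1[OF Badm])
    show "emeasure M (Bad n) < \<infinity>" for n by (simp add: emeasure_eq_measure)
    have "summable (\<lambda>n. (18 + cell_const) * (1 / 4) ^ n)" by (intro summable_mult summable_geometric) simp
    then show "summable (\<lambda>n. prob (Bad n))"
      by (rule summable_comparison_test'[where N = 0]) (use Badp in simp)
  qed
  have "(\<integral>\<^sup>+ \<omega>. (\<Sum>n. T n \<omega>) \<partial>M) = (\<Sum>n. \<integral>\<^sup>+ \<omega>. T n \<omega> \<partial>M)" by (rule nn_integral_suminf[OF Tm])
  also have "\<dots> \<le> (\<Sum>n. ennreal (4 * scale_const * c n))" by (intro suminf_le Tint summableI)
  also have "\<dots> = ennreal (\<Sum>n. 4 * scale_const * c n)"
    using c scale_const_nonneg by (intro suminf_ennreal2 summable_mult) auto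
  finally have "(\<integral>\<^sup>+ \<omega>. (\<Sum>n. T n \<omega>) \<partial>M) \<noteq> \<infinity>" by (auto simp: top_unique)
  then have Tfin: "AE \<omega> in M. (\<Sum>n. T n \<omega>) \<noteq> \<infinity>"
    using Tm by (intro nn_integral_noteq_infinite borel_measurable_suminf_order) auto
  have "AE \<omega> in M. \<forall>n. n0 \<le> n \<longrightarrow> \<omega> \<notin> Bad n \<longrightarrow> T n \<omega> < \<top> \<longrightarrow> (\<forall>x. 0 \<le> x \<longrightarrow> x \<le> tower (Suc n) \<longrightarrow>
        \<bar>G \<omega> x
          - G \<omega> (stick_tree.proj (yy \<omega>) (zz \<omega>) (tower n) x)\<bar> \<le> enn2real (T n \<omega>))"
    unfolding AE_all_countable
  proof
    fix n
    show "AE \<omega> in M. n0 \<le> n \<longrightarrow> \<omega> \<notin> Bad n \<longrightarrow> T n \<omega> < \<top> \<longrightarrow> (\<forall>x. 0 \<le> x \<longrightarrow> x \<le> tower (Suc n) \<longrightarrow>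
        \<bar>G \<omega> x
          - G \<omega> (stick_tree.proj (yy \<omega>) (zz \<omega>) (tower n) x)\<bar> \<le> enn2real (T n \<omega>))"
      using BT[of n] unfolding P_def by (cases "n0 \<le> n") auto
  qed
  then show ?thesis
    using ev Tfin AE_tree AE_continuous
  proof eventually_elim
    case (elim \<omega>)
    interpret stick_tree "yy \<omega>" "zz \<omega>" by (rule elim(4))
    obtain n2 where n2: "\<And>n. n \<ge> n2 \<Longrightarrow> \<omega> \<in> space M - Bad n"
      using elim(2) unfolding eventually_sequentially by blast
    have Tf: "T n \<omega> < \<top>" for n
    proof -
      have "T n \<omega> = (\<Sum>k\<in>{n}. T k \<omega>)" by simp
      also have "\<dots> \<le> (\<Sum>k. T k \<omega>)" by (intro sum_le_suminf summableI) auto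
      also have "\<dots> < \<top>" using elim(3) by (simp add: less_top)
      finally show ?thesis .
    qed
    have sum: "summable (\<lambda>n. enn2real (T n \<omega>))"
    proof (rule summable_suminf_not_top)
      have "(\<Sum>n. ennreal (enn2real (T n \<omega>))) = (\<Sum>n. T n \<omega>)" using Tf by simp
      then show "(\<Sum>n. ennreal (enn2real (T n \<omega>))) \<noteq> \<top>" using elim(3) by simp
    qed simp
    have "\<exists>a\<ge>0. \<forall>x\<ge>0. \<bar>G \<omega> x
        - G \<omega> (proj a x)\<bar> \<le> e" if "0 < e" for e
    proof (rule field_approx_of_summable[where l = tower and \<sigma> = "\<lambda>n. enn2real (T n \<omega>)" and start = "max n0 n2"])
      show "0 \<le> tower n" for n using tower_pos[of n] by simp
      show "\<bar>G \<omega> x - G \<omega> (proj (tower n) x)\<bar>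
          \<le> enn2real (T n \<omega>)" if "max n0 n2 \<le> n" "0 \<le> x" "x \<le> tower (Suc n)" for n x
        using elim(1) n2[of n] that Tf[of n] by auto
    qed (use mono_tower tower_unbounded sum that in auto)
    then show ?case by (intro field_uniformly_continuous[OF elim(5)])
  qed
qed

end

theorem theorem2p4:
  fixes M :: "'w measure"
    and \<theta> :: "nat \<Rightarrow> real"
    and X :: "nat \<Rightarrow> 'w \<Rightarrow> ereal"
    and Y Z :: "nat \<Rightarrow> 'w \<Rightarrow> real"
    and B :: "real \<Rightarrow> 'w \<Rightarrow> real"
  assumes "prob_space M"
    and "\<And>i. 0 \<le> \<theta> i"
    and "(\<lambda>i. (\<theta> i)\<^sup>2) sums 1"
    and "\<And>i. 1 \<le> i \<Longrightarrow> \<theta> (Suc i) \<le> \<theta> i"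
    and "icrt_data M \<theta> X Y Z"
    and "standard_brownian_motion M B"
    and "indep_of_data M B X Y Z"
    and "\<exists>a>0. set_integrable lborel {a..}
           (\<lambda>l. 1 / (l * sqrt (LINT \<omega>|M. measure (icrt_mu \<theta> (\<lambda>i. X i \<omega>)) {0..l})))"
  shows "AE \<omega> in M. \<exists>g.
           continuous_map (mtopology_of (icrt (\<lambda>i. Y i \<omega>) (\<lambda>i. Z i \<omega>))) euclideanreal g \<and>
           (\<forall>x\<ge>0. g (icrt_embed (\<lambda>i. Y i \<omega>) (\<lambda>i. Z i \<omega>) x)
                    = icrt_field (\<lambda>i. Y i \<omega>) (\<lambda>i. Z i \<omega>) (\<lambda>t. B t \<omega>) x)"
proof -
  interpret prob_space M by fact
  interpret icrt_gff M \<theta> X Y Z B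
    by unfold_locales (use assms in auto)
  from assms(8) obtain A where "set_integrable lborel {A..} (\<lambda>l. 1 / (l * sqrt (mean l)))"
    unfolding mean_def mu_def by blast
  \<comment> \<open>\<open>AE_yy_eq\<close> returns from the sequences normalised at index zero to
    the given ones.\<close>
  from AE_field_uniformly_continuous[OF this] AE_tree AE_yy_eq show ?thesis
  proof eventually_elim
    case (elim \<omega>)
    from stick_tree.field_extends[OF elim(2,1)] show ?case
      using elim(3) by simp
  qed
qed

end
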